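(* Let $X$ be an Asplund space, let $\{\Omega_i\}_{i\in T}$ be a system of subsets of $X$ closed around the point $\bar{x}\in\Omega:=\bigcap_{i\in T}\Omega_i$, and let $x^*\in X^*$ be an $R$-normal to $\Omega$ at $\bar{x}$ for some rate function $R$. Then for any $\varepsilon>0$ there exist a finite index subset $I\subset T$, Fréchet normals $x_i^*\in\widehat{N}(x_i;\Omega_i)$ with $\|x_i-\bar{x}\|<\varepsilon$ for $i\in I$, and a number $\lambda\ge0$ such that $$\lambda x^*\in\sum_{i\in I}x_i^*+\varepsilon\mathbb{B}^*\quad\text{and}\quad\lambda^2+\lambda^2\|x^*\|^2+\sum_{i\in I}\|x_i^*\|^2=1.$$
   Context: A Banach space is Asplund if each of its separable subspaces has a separable dual. $\mathbb{B}^*$ is the closed unit ball of the dual $X^*$; $B(\bar{x},\rho)$ is the closed ball centered at $\bar{x}$ with radius $\rho$; $|I|$ is the number of elements of a finite set $I$. Fréchet normal cone: $\widehat{N}(x;\Omega):=\{x^*\in X^*\mid\limsup_{u\to x,\,u\in\Omega}\frac{\langle x^*,u-x\rangle}{\|u-x\|}\le0\}$ for $x\in\Omega$, and $\widehat{N}(x;\Omega):=\emptyset$ for $x\notin\Omega$. A function $R(\cdot):\mathbb{R}_+\to\mathbb{R}_+$ is a rate function if there is a real number $M$ such that $rR(r)\le M$ for all $r$ and $\lim_{r\downarrow0}R(r)=\infty$; rate functions are assumed to be continuous (on $(0,\infty)$). Write $R_r:=R(r)$. Rated normals: $x^*\in X^*$ is an $R$-normal to the intersection $\Omega=\bigcap_{i\in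 T}\Omega_i$ at $\bar{x}\in\Omega$ if for any $r\downarrow0$ (i.e., for all sufficiently small $r>0$) there is a finite set $I=I(r)\subset T$, of cardinality $|I(r)|^{3/2}=o(R_r)$ as $r\downarrow0$, such that $$\langle x^*,x-\bar{x}\rangle-r\|x-\bar{x}\|<r\quad\text{for all } x\in\bigcap_{i\in I}\Omega_i\cap B(\bar{x},rR_r).$$
   Formalization: "Closed around x̄" is taken uniformly: one radius ρ>0 makes every Ω_i∩B(x̄,ρ) closed; with radii depending on i the claim fails (Ω_n=(−1/n,1/n) in ℝ, x̄=0, x*=1). *)

theory Defs
  imports "HOL-Analysis.Analysis" "HOL-Library.Landau_Symbols"
begin

section \<open>Asplund spaces\<close>

text \<open>The topological dual of a linear subspace \<open>Y\<close>. Functionals on \<open>Y\<close> are represented by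
  functions on the ambient space that are \<open>undefined\<close> outside \<open>Y\<close>.\<close>

definition dual_on :: "'a::real_normed_vector set \<Rightarrow> ('a \<Rightarrow> real) set" where
  "dual_on Y = {f \<in> extensional Y.
     (\<forall>x\<in>Y. \<forall>y\<in>Y. f (x + y) = f x + f y) \<and>
     (\<forall>c. \<forall>x\<in>Y. f (c *\<^sub>R x) = c * f x) \<and>
     (\<exists>K. \<forall>x\<in>Y. \<bar>f x\<bar> \<le> K * norm x)}"

definition dual_norm_on :: "'a::real_normed_vector set \<Rightarrow> ('a \<Rightarrow> real) \<Rightarrow> real" where
  "dual_norm_on Y f = (SUP y\<in>{y\<in>Y. norm y \<le> 1}. \<bar>f y\<bar>)"

definition separable_dual :: "'a::real_normed_vector set \<Rightarrow> bool" where
  "separable_dual Y \<longleftrightarrow>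
     (\<exists>D. countable D \<and> D \<subseteq> dual_on Y \<and>
        (\<forall>f\<in>dual_on Y. \<forall>e>0. \<exists>g\<in>D. dual_norm_on Y (\<lambda>y. f y - g y) < e))"

definition asplund :: "'a::banach itself \<Rightarrow> bool" where
  "asplund _ \<longleftrightarrow>
     (\<forall>Y::'a set. subspace Y \<and> separable_space (top_of_set Y) \<longrightarrow> separable_dual Y)"


section \<open>Normals\<close>

text \<open>The filter \<open>at x within \<Omega>\<close> excludes \<open>x\<close> itself; at an isolated point of \<open>\<Omega>\<close> the upper limit
  is \<open>- \<infinity>\<close>, so every functional is a normal there.\<close>

definition frechet_normal_cone ::
    "'a::real_normed_vector \<Rightarrow> 'a set \<Rightarrow> ('a \<Rightarrow>\<^sub>L real) set" where
  "frechet_normal_cone x \<Omega> =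
     (if x \<in> \<Omega>
      then {f. Limsup (at x within \<Omega>) (\<lambda>u. ereal (blinfun_apply f (u - x) / norm (u - x))) \<le> 0}
      else {})"

text \<open>Only the values on \<open>{0..}\<close> matter. Continuity, a standing assumption on
  rate functions, is included.\<close>

definition rate_function :: "(real \<Rightarrow> real) \<Rightarrow> bool" where
  "rate_function R \<longleftrightarrow>
     (\<forall>r\<ge>0. R r \<ge> 0) \<and>
     (\<exists>M. \<forall>r\<ge>0. r * R r \<le> M) \<and>
     filterlim R at_top (at_right 0) \<and>
     continuous_on {0<..} R"

definition rated_normal ::
    "(real \<Rightarrow> real) \<Rightarrow> 'i set \<Rightarrow> ('i \<Rightarrow> 'a::real_normed_vector set) \<Rightarrow> 'a \<Rightarrow> ('a \<Rightarrow>\<^sub>L real) \<Rightarrow> bool" where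
  "rated_normal R T \<Omega> xbar f \<longleftrightarrow>
     xbar \<in> (\<Inter>i\<in>T. \<Omega> i) \<and>
     (\<exists>I :: real \<Rightarrow> 'i set.
        (\<lambda>r. real (card (I r)) powr (3 / 2)) \<in> o[at_right 0](R) \<and>
        (\<forall>\<^sub>F r in at_right 0.
           finite (I r) \<and> I r \<subseteq> T \<and>
           (\<forall>x \<in> (\<Inter>i\<in>I r. \<Omega> i) \<inter> cball xbar (r * R r).
              blinfun_apply f (x - xbar) - r * norm (x - xbar) < r)))"

text \<open>The system is closed around a point when a single neighbourhood works for all members;
  for infinite \<open>T\<close> this is stronger than local closedness of each member.\<close>

definition system_closed_around ::
    "'i set \<Rightarrow> ('i \<Rightarrow> 'a::real_normed_vector set) \<Rightarrow> 'a \<Rightarrow> bool" where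
  "system_closed_around T \<Omega> xbar \<longleftrightarrow> (\<exists>\<rho>>0. \<forall>i\<in>T. closed (\<Omega> i \<inter> cball xbar \<rho>))"

end

(* If the intersection of finitely many sets Omega_i lies on one side of xstar up to s inside a ball
   of radius rho around xbar, then sqrt (max 0 (s - xstar (x - xbar))^2 + sum_i |x - x_i|^2) is
   positive on the product of the sets and equals s at xbar. A Borwein-Preiss minimiser close to xbar
   yields multipliers with an error of order s / rho in each of the card I + 1 variables, and
   rated normality makes card I * s / rho arbitrarily small.

   The minimiser gives Frechet normals only if |.|^2 is Frechet differentiable, so the argument is run
   in a separable subspace Y, whose dual is separable. There |y|^2 is replaced by
   theta y = SUP f. f y - q f with a quadratic q on Y* chosen such that maximising sequences converge
   in norm.

   Y is closed under countably many witness operations, and then, by the Hahn-Banach theorem in the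
   product space, normals relative to Y extend to the whole space with the same error bound: the only
   obstructions to an extension are finite configurations of points, which can be moved into Y. *)

theory Submission
  imports Defs "HOL-Analysis.Finite_Function_Topology"
begin

text \<open>An Asplund space need not have an equivalent Frechet smooth norm, so smoothness is
  sought on separable subspaces only. A conjugate function is used there because Frechet
  differentiability of a conjugate amounts to norm convergence of maximising sequences (Smulian),
  and this can be built into \<open>q\<close> term by term.

  The square root is minimised, and not the sum of squares, because its derivative is normalised:
  division by twice the minimal value turns the slack and the gauges at the minimiser into numbers
  \<open>l\<close> and \<open>\<tau> i\<close> with
  \<open>l\<^sup>2 + (\<Sum>i<m. (\<tau> i)\<^sup>2) = 1\<close>, so the multipliers cannot all
  vanish as the errors shrink.

  The minimiser is known only after the subspace has been chosen, and its components lie in the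
  closure of the countable set, not in the set itself. Hence the witness operations refer to
  arbitrary base points, with rational data and with room for approximation. The normals are
  extended jointly, since the bound on their sum couples them.\<close>

section \<open>The Hahn--Banach theorem in cone form\<close>

text \<open>A pair \<open>(v, c)\<close> in \<open>S\<close> is a demand \<open>L v \<le> c\<close>.
  A convex cone of demands replaces a sublinear functional, so no infimum over the admissible
  \<open>c\<close> has to be formed. Partial functionals are represented by their graphs, as
  subspaces of the product; that a dominated graph is single-valued is derived at the end.\<close>

lemma Hahn_Banach_cone:
  fixes S G0 :: "('v::real_vector \<times> real) set"
  assumes S_add: "\<And>p q. p \<in> S \<Longrightarrow> q \<in> S \<Longrightarrow> p + q \<in> S"
    and S_scale: "\<And>p t. p \<in> S \<Longrightarrow> t > 0 \<Longrightarrow> t *\<^sub>R p \<in> S"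
    and S_total: "\<And>v. \<exists>c. (v, c) \<in> S"
    and G0: "subspace G0"
    and G0_le: "\<And>v a c. (v, a) \<in> G0 \<Longrightarrow> (v, c) \<in> S \<Longrightarrow> a \<le> c"
  obtains L :: "'v \<Rightarrow> real" where "linear L" "\<And>v c. (v, c) \<in> S \<Longrightarrow> L v \<le> c"
    "\<And>v a. (v, a) \<in> G0 \<Longrightarrow> L v = a"
proof -
  define \<A> where "\<A> = {G. subspace G \<and> G0 \<subseteq> G \<and> (\<forall>v a c. (v, a) \<in> G \<longrightarrow> (v, c) \<in> S \<longrightarrow> a \<le> c)}"
  have "\<exists>M\<in>\<A>. \<forall>X\<in>\<A>. M \<subseteq> X \<longrightarrow> X = M"
  proof (rule subset_Zorn_nonempty)
    show "\<A> \<noteq> {}" using G0 G0_le unfolding \<A>_def by blast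
    fix \<C> assume ne: "\<C> \<noteq> {}" and ch: "subset.chain \<A> \<C>"
    have sub: "\<C> \<subseteq> \<A>" and tot: "\<And>A B. A \<in> \<C> \<Longrightarrow> B \<in> \<C> \<Longrightarrow> A \<subseteq> B \<or> B \<subseteq> A"
      using ch unfolding subset.chain_def by (auto simp: psubset_eq)
    have "subspace (\<Union>\<C>)"
    proof (rule subspaceI)
      show "0 \<in> \<Union>\<C>" using ne sub by (auto simp: \<A>_def subspace_def)
      show "x + y \<in> \<Union>\<C>" if "x \<in> \<Union>\<C>" "y \<in> \<Union>\<C>" for x y
      proof -
        obtain A B where AB: "A \<in> \<C>" "B \<in> \<C>" "x \<in> A" "y \<in> B" using \<open>x \<in> \<Union>\<C>\<close> \<open>y \<in> \<Union>\<C>\<close> by blast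
        then obtain E where "E \<in> \<C>" "x \<in> E" "y \<in> E" using tot by blast
        moreover have "subspace E" using \<open>E \<in> \<C>\<close> sub by (auto simp: \<A>_def)
        ultimately show ?thesis using subspace_add by blast
      qed
      show "c *\<^sub>R x \<in> \<Union>\<C>" if "x \<in> \<Union>\<C>" for c x
        using that sub unfolding \<A>_def by (blast intro: subspace_scale)
    qed
    then show "\<Union>\<C> \<in> \<A>" using ne sub unfolding \<A>_def by blast
  qed
  then obtain G where G: "G \<in> \<A>" and max: "\<And>X. X \<in> \<A> \<Longrightarrow> G \<subseteq> X \<Longrightarrow> X = G" by blast
  have Gsub: "subspace G" and G0G: "G0 \<subseteq> G" and Gle: "\<And>v a c. (v, a) \<in> G \<Longrightarrow> (v, c) \<in> S \<Longrightarrow> a \<le> c"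
    using G by (auto simp: \<A>_def)
  have dom: "\<exists>a. (v0, a) \<in> G" for v0
  proof -
    \<comment> \<open>\<open>U\<close> collects the lower bounds for the value at \<open>v0\<close>.
      By \<open>sep\<close> each of them is at most every upper bound \<open>c - a\<close>, so its
      supremum is a possible value.\<close>
    define U where "U = {a - c | w a c. (w, a) \<in> G \<and> (w - v0, c) \<in> S}"
    have sep: "u \<le> c1 - a1" if "u \<in> U" "(w1, a1) \<in> G" "(w1 + v0, c1) \<in> S" for u w1 a1 c1
    proof -
      obtain w2 a2 c2 where 2: "u = a2 - c2" "(w2, a2) \<in> G" "(w2 - v0, c2) \<in> S"
        using \<open>u \<in> U\<close> by (auto simp: U_def)
      have "(w1 + w2, a1 + a2) \<in> G" using subspace_add[OF Gsub that(2) 2(2)] by simp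
      moreover have "(w1 + w2, c1 + c2) \<in> S" using S_add[OF that(3) 2(3)] by simp
      ultimately have "a1 + a2 \<le> c1 + c2" by (rule Gle)
      then show ?thesis using 2 by simp
    qed
    have zG: "(0, 0) \<in> G" using subspace_0[OF Gsub] by (simp add: zero_prod_def)
    obtain c0 where c0: "(0 + v0, c0) \<in> S" using S_total by metis
    obtain c0' where c0': "(0 - v0, c0') \<in> S" using S_total by metis
    have Une: "U \<noteq> {}" using zG c0' unfolding U_def by blast
    have bdd: "bdd_above U" using sep[OF _ zG c0] by (auto simp: bdd_above_def)
    define \<alpha> where "\<alpha> = Sup U"
    have up: "\<alpha> \<le> c - a" if "(w, a) \<in> G" "(w + v0, c) \<in> S" for w a c
      unfolding \<alpha>_def by (rule cSup_least[OF Une]) (use sep that in blast)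
    have lo: "a - c \<le> \<alpha>" if "(w, a) \<in> G" "(w - v0, c) \<in> S" for w a c
      unfolding \<alpha>_def by (rule cSup_upper[OF _ bdd]) (use that in \<open>auto simp: U_def\<close>)
    define X where "X = {p + q |p q. p \<in> G \<and> q \<in> span {(v0, \<alpha>)}}"
    have Xsub: "subspace X" unfolding X_def by (intro subspace_sums Gsub subspace_span)
    have GX: "G \<subseteq> X"
    proof
      fix p assume "p \<in> G"
      then show "p \<in> X" unfolding X_def using span_zero by (metis (mono_tags, lifting) add.right_neutral mem_Collect_eq)
    qed
    have "a \<le> c" if vaX: "(v, a) \<in> X" and vcS: "(v, c) \<in> S" for v a c
    proof -
      obtain w b t where wb: "(w, b) \<in> G" and v: "v = w + t *\<^sub>R v0" and a: "a = b + t * \<alpha>"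
      proof -
        obtain p q where "p \<in> G" "q \<in> span {(v0, \<alpha>)}" "(v, a) = p + q"
          using vaX unfolding X_def by blast
        moreover from this obtain t where "q = (t *\<^sub>R v0, t * \<alpha>)"
          by (auto simp: span_singleton)
        ultimately show thesis using that[of "fst p" "snd p" t]
          by (metis add_Pair fst_conv prod.collapse snd_conv)
      qed
      consider "t = 0" | "t > 0" | "t < 0" by linarith
      then show ?thesis
      proof cases
        case 1
        then show ?thesis using wb v a vcS Gle by auto
      next
        case 2
        have "(inverse t *\<^sub>R w, inverse t * b) \<in> G" using subspace_scale[OF Gsub wb, of "inverse t"] by simp
        moreover have "(inverse t *\<^sub>R w + v0, inverse t * c) \<in> S"
          using S_scale[OF vcS, of "inverse t"] 2 v by (simp add: scaleR_add_right)
        ultimately have "\<alpha> \<le> inverse t * c - inverse t * b" by (rule up)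
        then show ?thesis using 2 a by (simp add: field_simps)
      next
        case 3
        have "(inverse (-t) *\<^sub>R w, inverse (-t) * b) \<in> G" using subspace_scale[OF Gsub wb, of "inverse (-t)"] by simp
        moreover have "(inverse (-t) *\<^sub>R w - v0, inverse (-t) * c) \<in> S"
          using S_scale[OF vcS, of "inverse (-t)"] 3 v by (simp add: scaleR_add_right)
        ultimately have "inverse (-t) * b - inverse (-t) * c \<le> \<alpha>" by (rule lo)
        then show ?thesis using 3 a by (simp add: field_simps)
      qed
    qed
    then have "X \<in> \<A>" using Xsub GX G0G by (auto simp: \<A>_def)
    then have "X = G" using max GX by blast
    moreover have "(v0, \<alpha>) \<in> X"
      unfolding X_def using subspace_0[OF Gsub] span_base[of "(v0, \<alpha>)" "{(v0, \<alpha>)}"]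
      by (metis (mono_tags, lifting) add.left_neutral mem_Collect_eq singletonI)
    ultimately show ?thesis by blast
  qed
  have uniq: "a = b" if "(v, a) \<in> G" "(v, b) \<in> G" for v a b
  proof (rule ccontr)
    assume "a \<noteq> b"
    obtain c where c: "(0, c) \<in> S" using S_total by blast
    have "(0, a - b) \<in> G" using subspace_diff[OF Gsub that] by simp
    \<comment> \<open>A nonzero second component above 0 can be scaled beyond the bound
      \<open>c\<close>.\<close>
    from subspace_scale[OF Gsub this, of "(\<bar>c\<bar> + 1) / (a - b)"]
    have "(0, \<bar>c\<bar> + 1) \<in> G" using \<open>a \<noteq> b\<close> by simp
    from Gle[OF this c] show False by linarith
  qed
  define L where "L v = (THE a. (v, a) \<in> G)" for v
  have LG: "(v, L v) \<in> G" for v unfolding L_def by (rule theI') (use dom uniq in blast)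
  have Leq: "L v = a" if "(v, a) \<in> G" for v a using uniq[OF LG that] .
  show thesis
  proof
    show "linear L"
    proof (rule linearI)
      show "L (x + y) = L x + L y" for x y using subspace_add[OF Gsub LG LG, of x y] by (intro Leq) simp
      show "L (r *\<^sub>R x) = r *\<^sub>R L x" for r x using subspace_scale[OF Gsub LG, of r x] by (intro Leq) simp
    qed
  qed (use LG Leq Gle G0G in blast)+
qed

lemma norming_functional:
  fixes y :: "'a::real_normed_vector"
  obtains L :: "'a \<Rightarrow> real" where "linear L" "\<And>x. \<bar>L x\<bar> \<le> norm x" "L y = norm y"
proof -
  define S where "S = {(v, c). norm (v::'a) \<le> c}"
  define G0 where "G0 = span {(y, norm y)}"
  obtain L where L: "linear L" "\<And>v c. (v, c) \<in> S \<Longrightarrow> L v \<le> c" "\<And>v a. (v, a) \<in> G0 \<Longrightarrow> L v = a"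
  proof (rule Hahn_Banach_cone[of S G0])
    show "p + q \<in> S" if "p \<in> S" "q \<in> S" for p q
      using that norm_triangle_ineq[of "fst p" "fst q"] by (cases p; cases q) (auto simp: S_def)
    show "t *\<^sub>R p \<in> S" if "p \<in> S" "t > 0" for t p
      using that by (cases p) (auto simp: S_def)
    show "\<exists>c. (v, c) \<in> S" for v by (auto simp: S_def)
    show "a \<le> c" if "(v, a) \<in> G0" "(v, c) \<in> S" for v a c
      using that by (auto simp: G0_def S_def span_singleton intro: order_trans[OF mult_right_mono[OF abs_ge_self]])
  qed (auto simp: G0_def)
  have le: "L x \<le> norm x" for x by (rule L(2)) (simp add: S_def)
  show thesis
  proof
    show "\<bar>L x\<bar> \<le> norm x" for x
      using le[of x] le[of "-x"] linear_neg[OF L(1), of x] by auto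
    show "L y = norm y" by (rule L(3)) (auto simp: G0_def span_base)
  qed (rule L(1))
qed

section \<open>Smooth gauges on subspaces with separable dual\<close>

lemma dual_onI:
  assumes "\<And>x y. x \<in> Y \<Longrightarrow> y \<in> Y \<Longrightarrow> f (x + y) = f x + f y"
    and "\<And>c x. x \<in> Y \<Longrightarrow> f (c *\<^sub>R x) = c * f x"
    and "\<And>x. x \<in> Y \<Longrightarrow> \<bar>f x\<bar> \<le> K * norm x" "subspace Y"
  shows "restrict f Y \<in> dual_on Y"
  using assms subspace_add[OF assms(4)] subspace_scale[OF assms(4)] unfolding dual_on_def by (auto intro: exI[of _ K])

lemma dual_on_add: "f \<in> dual_on Y \<Longrightarrow> x \<in> Y \<Longrightarrow> y \<in> Y \<Longrightarrow> f (x + y) = f x + f y"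
  and dual_on_scale: "f \<in> dual_on Y \<Longrightarrow> x \<in> Y \<Longrightarrow> f (c *\<^sub>R x) = c * f x"
  and dual_on_bdd: "f \<in> dual_on Y \<Longrightarrow> \<exists>K. \<forall>x\<in>Y. \<bar>f x\<bar> \<le> K * norm x"
  by (auto simp: dual_on_def)

lemma dual_on_diff: "f \<in> dual_on Y \<Longrightarrow> subspace Y \<Longrightarrow> x \<in> Y \<Longrightarrow> y \<in> Y \<Longrightarrow> f (x - y) = f x - f y"
  using dual_on_add[of f Y x "(-1) *\<^sub>R y"] dual_on_scale[of f Y y "-1"] subspace_scale[of Y y "-1"] by simp

lemma dual_on_0: "f \<in> dual_on Y \<Longrightarrow> subspace Y \<Longrightarrow> f 0 = 0"
  using dual_on_scale[of f Y 0 0] subspace_0[of Y] by simp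

text \<open>The set \<open>S 0\<close> makes \<open>sqrt q\<close> an equivalent dual norm, the singletons make maximising
  sequences converge pointwise, and the kernels upgrade this to norm convergence: if \<open>f\<close> is close to
  \<open>d\<close>, then \<open>f\<close> is small on the kernel of \<open>d\<close>, and so are the members of a maximising sequence that
  tends to \<open>f\<close> pointwise; one further direction is controlled pointwise.\<close>

locale smooth_gauge =
  fixes Y :: "'a::real_normed_vector set" and S :: "nat \<Rightarrow> 'a set"
  assumes Y: "subspace Y"
    and S_sub: "S j \<subseteq> {y\<in>Y. norm y \<le> 1}" and S_ne: "S j \<noteq> {}" and S_0: "S 0 = {y\<in>Y. norm y \<le> 1}"
    and dense: "Y \<subseteq> closure {x\<in>Y. \<exists>j. S j = {inverse (1 + norm x) *\<^sub>R x}}"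
    and kernels: "f \<in> dual_on Y \<Longrightarrow> e > 0 \<Longrightarrow>
      \<exists>d\<in>dual_on Y. \<exists>j. S j = {y\<in>Y. norm y \<le> 1 \<and> d y = 0} \<and> (\<forall>y\<in>Y. norm y \<le> 1 \<longrightarrow> \<bar>f y - d y\<bar> \<le> e)"
begin

section \<open>The dual quadratic function and its conjugate\<close>

definition N :: "nat \<Rightarrow> ('a \<Rightarrow> real) \<Rightarrow> real" where "N j f = (SUP x\<in>S j. \<bar>f x\<bar>)"
definition q :: "('a \<Rightarrow> real) \<Rightarrow> real" where "q f = (suminf (\<lambda>j. (1/2)^Suc j * (N j f)\<^sup>2))"
text \<open>The Fenchel conjugate of \<open>q\<close>, restricted to \<open>Y\<close>. The square of
  the dual norm \<open>N 0\<close> lies between \<open>q\<close> and \<open>2 * q\<close>, which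
  makes the conjugate comparable with the square of the norm.\<close>

definition \<theta> :: "'a \<Rightarrow> real" where "\<theta> y = (SUP f\<in>dual_on Y. f y - q f)"

lemma S_Y: "x \<in> S j \<Longrightarrow> x \<in> Y" and S_norm: "x \<in> S j \<Longrightarrow> norm x \<le> 1" using S_sub by blast+

lemma bdd_N: assumes "f \<in> dual_on Y" shows "bdd_above ((\<lambda>x. \<bar>f x\<bar>) ` S j)"
proof -
  obtain K where K: "\<And>x. x \<in> Y \<Longrightarrow> \<bar>f x\<bar> \<le> K * norm x" using dual_on_bdd[OF assms] by blast
  have "\<bar>f x\<bar> \<le> \<bar>K\<bar>" if "x \<in> S j" for x
  proof -
    have "\<bar>f x\<bar> \<le> K * norm x" using K S_Y[OF that] by blast
    also have "\<dots> \<le> \<bar>K\<bar> * norm x" by (intro mult_right_mono) auto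
    also have "\<dots> \<le> \<bar>K\<bar> * 1" by (intro mult_left_mono) (auto simp: S_norm[OF that])
    finally show ?thesis by simp
  qed
  then show ?thesis by (auto simp: bdd_above_def)
qed

lemma N_upper: "f \<in> dual_on Y \<Longrightarrow> x \<in> S j \<Longrightarrow> \<bar>f x\<bar> \<le> N j f"
  unfolding N_def by (rule cSUP_upper[OF _ bdd_N])

lemma N_least: "(\<And>x. x \<in> S j \<Longrightarrow> \<bar>f x\<bar> \<le> K) \<Longrightarrow> N j f \<le> K"
  unfolding N_def by (rule cSUP_least[OF S_ne])

lemma N_nonneg: "f \<in> dual_on Y \<Longrightarrow> 0 \<le> N j f"
  using S_ne[of j] N_upper[of f _ j] by (meson abs_ge_zero ex_in_conv order_trans)

lemma N_le: "f \<in> dual_on Y \<Longrightarrow> N j f \<le> N 0 f"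
  by (intro N_least N_upper) (use S_sub S_0 in auto)

lemma N_bound: assumes f: "f \<in> dual_on Y" and x: "x \<in> Y" shows "\<bar>f x\<bar> \<le> N 0 f * norm x"
proof (cases "x = 0")
  case True then show ?thesis using dual_on_0[OF f Y] by simp
next
  case False
  have "inverse (norm x) *\<^sub>R x \<in> S 0" using False subspace_scale[OF Y x] by (simp add: S_0)
  from N_upper[OF f this] show ?thesis using False dual_on_scale[OF f x] by (simp add: abs_mult field_simps)
qed

lemma bound_N: "(\<And>x. x \<in> Y \<Longrightarrow> \<bar>f x\<bar> \<le> K * norm x) \<Longrightarrow> K \<ge> 0 \<Longrightarrow> N 0 f \<le> K"
  by (rule N_least) (metis S_Y S_norm mult_left_mono mult.right_neutral order_trans)

lemma summable_weights:
  assumes "\<And>j. 0 \<le> a j" "\<And>j. a j \<le> (B::real)" shows "summable (\<lambda>j. (1/2)^Suc j * a j)"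
  by (rule summable_comparison_test'[where g = "\<lambda>j. (1/2)^Suc j * B"])
    (use assms in \<open>auto intro!: mult_left_mono summable_mult2 summable_geometric simp: abs_mult\<close>)

lemma q_summable: assumes "f \<in> dual_on Y" shows "summable (\<lambda>j. (1/2)^Suc j * (N j f)\<^sup>2)"
  by (rule summable_weights[where B = "(N 0 f)\<^sup>2"]) (auto intro!: power_mono N_le N_nonneg assms)

lemma q_le: assumes "f \<in> dual_on Y" shows "q f \<le> (N 0 f)\<^sup>2"
proof -
  have "q f \<le> (suminf (\<lambda>j. (1/2)^Suc j * (N 0 f)\<^sup>2))" unfolding q_def
    by (intro suminf_le q_summable assms mult_left_mono power_mono N_le N_nonneg summable_weights[where B = "(N 0 f)\<^sup>2"]) auto
  also have "\<dots> = (N 0 f)\<^sup>2"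
    using sums_mult2[OF power_half_series, of "(N 0 f)\<^sup>2"] by (simp add: sums_iff)
  finally show ?thesis .
qed

lemma q_ge_sum: assumes "f \<in> dual_on Y" shows "(\<Sum>j<n. (1/2)^Suc j * (N j f)\<^sup>2) \<le> q f"
  unfolding q_def by (rule sum_le_suminf[OF q_summable[OF assms]]) auto

lemma q_ge: assumes "f \<in> dual_on Y" shows "(N 0 f)\<^sup>2 / 2 \<le> q f"
  using q_ge_sum[OF assms, of 1] by simp

text \<open>Young's inequality, with the half of \<open>(N 0 f)\<^sup>2\<close> that
  \<open>q_ge\<close> provides.\<close>

lemma pair_le: assumes "f \<in> dual_on Y" "y \<in> Y" shows "f y - q f \<le> (norm y)\<^sup>2 / 2"
proof -
  have "f y \<le> N 0 f * norm y" using N_bound[OF assms] by linarith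
  moreover have "N 0 f * norm y \<le> (N 0 f)\<^sup>2 / 2 + (norm y)\<^sup>2 / 2"
    using sum_squares_bound[of "N 0 f" "norm y"] by simp
  ultimately show ?thesis using q_ge[OF assms(1)] by linarith
qed

lemma zero_dual: "restrict (\<lambda>_. 0) Y \<in> dual_on Y" by (rule dual_onI[where K = 0]) (auto simp: Y)

lemma theta_upper: assumes "f \<in> dual_on Y" "y \<in> Y" shows "f y - q f \<le> \<theta> y"
  unfolding \<theta>_def by (rule cSUP_upper[OF assms(1)]) (rule bdd_aboveI2, rule pair_le[OF _ assms(2)])

lemma theta_le: assumes "y \<in> Y" shows "\<theta> y \<le> (norm y)\<^sup>2 / 2"
  unfolding \<theta>_def by (rule cSUP_least) (use zero_dual pair_le assms in auto)

lemma scaled_dual: "f \<in> dual_on Y \<Longrightarrow> restrict (\<lambda>x. t * f x) Y \<in> dual_on Y"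
  by (rule dual_onI[where K = "\<bar>t\<bar> * N 0 f"])
   (auto simp: dual_on_add dual_on_scale algebra_simps Y abs_mult intro!: mult_left_mono N_bound[simplified mult.commute])

lemma q_scaled: assumes f: "f \<in> dual_on Y" shows "q (restrict (\<lambda>x. t * f x) Y) = t\<^sup>2 * q f"
proof -
  have N: "N j (restrict (\<lambda>x. t * f x) Y) = \<bar>t\<bar> * N j f" for j
  proof -
    have "N j (restrict (\<lambda>x. t * f x) Y) = (SUP x\<in>S j. \<bar>t\<bar> * \<bar>f x\<bar>)"
      unfolding N_def by (rule SUP_cong) (auto simp: abs_mult S_Y)
    also have "\<dots> = \<bar>t\<bar> * N j f"
    proof (rule antisym)
      show "(SUP x\<in>S j. \<bar>t\<bar> * \<bar>f x\<bar>) \<le> \<bar>t\<bar> * N j f"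
        by (rule cSUP_least[OF S_ne]) (intro mult_left_mono N_upper f, auto)
      show "\<bar>t\<bar> * N j f \<le> (SUP x\<in>S j. \<bar>t\<bar> * \<bar>f x\<bar>)"
      proof (cases "t = 0")
        case True then show ?thesis using S_ne by simp
      next
        case False
        have bdd: "bdd_above ((\<lambda>x. \<bar>t\<bar> * \<bar>f x\<bar>) ` S j)"
          using N_upper[OF f, of _ j] by (auto simp: bdd_above_def intro!: exI[of _ "\<bar>t\<bar> * N j f"] mult_left_mono)
        have "N j f \<le> (SUP x\<in>S j. \<bar>t\<bar> * \<bar>f x\<bar>) / \<bar>t\<bar>"
          using cSUP_upper[OF _ bdd] False by (intro N_least) (simp add: field_simps)
        then show ?thesis using False by (simp add: field_simps)
      qed
    qed
    finally show ?thesis .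
  qed
  show ?thesis unfolding q_def N power_mult_distrib
    using suminf_mult[OF q_summable[OF f], of "t\<^sup>2"] by (simp add: mult_ac)
qed

text \<open>The midpoint inequality replaces uniform convexity: every term of \<open>q\<close> satisfies it separately.\<close>

lemma midpoint:
  assumes f: "f \<in> dual_on Y" and g: "g \<in> dual_on Y"
  defines "h \<equiv> restrict (\<lambda>x. (f x + g x) / 2) Y"
  shows "h \<in> dual_on Y"
    and "(1/2)^Suc j * (((N j f)\<^sup>2 + (N j g)\<^sup>2) / 2 - (N j h)\<^sup>2) \<le> (q f + q g) / 2 - q h"
    and "((N j f - N j g) / 2)\<^sup>2 \<le> ((N j f)\<^sup>2 + (N j g)\<^sup>2) / 2 - (N j h)\<^sup>2"
proof -
  show h: "h \<in> dual_on Y" unfolding h_def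
  proof (rule dual_onI[where K = "N 0 f + N 0 g"])
    show "\<bar>(f x + g x) / 2\<bar> \<le> (N 0 f + N 0 g) * norm x" if "x \<in> Y" for x
    proof -
      have "\<bar>f x + g x\<bar> \<le> (N 0 f + N 0 g) * norm x"
        using N_bound[OF f that] N_bound[OF g that] by (simp add: algebra_simps)
      moreover have "\<bar>(f x + g x) / 2\<bar> \<le> \<bar>f x + g x\<bar>" by simp
      ultimately show ?thesis by linarith
    qed
  qed (auto simp: dual_on_add[OF f] dual_on_add[OF g] dual_on_scale[OF f] dual_on_scale[OF g] algebra_simps add_divide_distrib Y)
  have N: "N j h \<le> (N j f + N j g) / 2" for j
  proof (rule N_least)
    show "\<bar>h x\<bar> \<le> (N j f + N j g) / 2" if "x \<in> S j" for x
      using N_upper[OF f that] N_upper[OF g that] S_Y[OF that] by (simp add: h_def)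
  qed
  show 3: "((N j f - N j g) / 2)\<^sup>2 \<le> ((N j f)\<^sup>2 + (N j g)\<^sup>2) / 2 - (N j h)\<^sup>2" for j
    using power_mono[OF N[of j] N_nonneg[OF h], of 2] by (simp add: power2_eq_square field_simps)
  let ?t = "\<lambda>j. (1/2)^Suc j * (((N j f)\<^sup>2 + (N j g)\<^sup>2) / 2 - (N j h)\<^sup>2)"
  have s: "?t sums ((q f + q g) / 2 - q h)"
    using sums_diff[OF sums_divide[OF sums_add[OF summable_sums[OF q_summable[OF f]] summable_sums[OF q_summable[OF g]]], of 2]
        summable_sums[OF q_summable[OF h]]]
    by (simp add: q_def algebra_simps add_divide_distrib)
  have nn: "0 \<le> ?t i" for i using order_trans[OF zero_le_power2 3[of i]] by simp
  have "sum ?t {j} \<le> suminf ?t" by (rule sum_le_suminf) (use s nn in \<open>auto simp: sums_iff\<close>)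
  then show "?t j \<le> (q f + q g) / 2 - q h" using s by (simp add: sums_iff)
qed


text \<open>The midpoint of two members competes in the supremum, so by \<open>midpoint\<close> the
  gap of each term of \<open>q\<close> is at most the mean of the two deficits \<open>a\<close>. The
  weight of a term is fixed, so the terms converge separately. Their limits are then identified with
  the values at the pointwise limit \<open>f\<close>.\<close>

lemma maximizing_sequence_converges:
  fixes F :: "nat \<Rightarrow> 'a \<Rightarrow> real"
  assumes w: "w \<in> Y" and F: "\<And>k. F k \<in> dual_on Y"
    and lim: "(\<lambda>k. F k w - q (F k)) \<longlonglongrightarrow> \<theta> w"
  obtains f where "f \<in> dual_on Y" "f w - q f = \<theta> w"
    "\<And>e. e > 0 \<Longrightarrow> \<forall>\<^sub>F k in sequentially. \<forall>x\<in>Y. \<bar>F k x - f x\<bar> \<le> e * norm x"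
proof -
  define a where "a k = \<theta> w - (F k w - q (F k))" for k
  have a_lim: "a \<longlonglongrightarrow> 0" unfolding a_def using tendsto_diff[OF tendsto_const lim, of "\<theta> w"] by simp
  define H where "H k l = restrict (\<lambda>x. (F k x + F l x) / 2) Y" for k l
  have H: "H k l \<in> dual_on Y" for k l unfolding H_def by (rule midpoint(1)[OF F F])
  have gap: "(1/2)^Suc j * (((N j (F k))\<^sup>2 + (N j (F l))\<^sup>2) / 2 - (N j (H k l))\<^sup>2) \<le> (a k + a l) / 2" for j k l
  proof -
    have "(F k w + F l w) / 2 - q (H k l) \<le> \<theta> w" using theta_upper[OF H w, of k l] w by (simp add: H_def)
    then have "(q (F k) + q (F l)) / 2 - q (H k l) \<le> (a k + a l) / 2" by (simp add: a_def field_simps)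
    with midpoint(2)[OF F[of k] F[of l], of j] show ?thesis unfolding H_def by linarith
  qed
  have CauchyI: "convergent b" if b: "\<And>k l. (1/2)^Suc j * ((b k - b l) / 2)\<^sup>2 \<le> (a k + a l) / 2" for b :: "nat \<Rightarrow> real" and j
  proof -
    have "Cauchy b"
    proof (rule metric_CauchyI)
      fix e :: real assume e: "e > 0"
      define r where "r = (1/2)^Suc j * (e/2)\<^sup>2"
      have "r > 0" using e by (simp add: r_def)
      from LIMSEQ_D[OF a_lim this] obtain M where M: "\<And>k. k \<ge> M \<Longrightarrow> \<bar>a k\<bar> < r" by auto
      have "dist (b k) (b l) < e" if "k \<ge> M" "l \<ge> M" for k l
      proof -
        have "(1/2)^Suc j * ((b k - b l) / 2)\<^sup>2 < r" using b[of k l] M[OF that(1)] M[OF that(2)] by argo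
        then have "((b k - b l) / 2)\<^sup>2 < (e/2)\<^sup>2" unfolding r_def by (simp only: mult_less_cancel_left_pos[of "(1/2)^Suc j :: real"] zero_less_power half_gt_zero zero_less_one)
        then have "\<bar>(b k - b l) / 2\<bar> < \<bar>e/2\<bar>" using abs_le_square_iff[of "e/2" "(b k - b l) / 2"] by linarith
        then show ?thesis using e by (simp add: dist_real_def)
      qed
      then show "\<exists>M. \<forall>m\<ge>M. \<forall>n\<ge>M. dist (b m) (b n) < e" by blast
    qed
    then show ?thesis by (simp add: Cauchy_convergent_iff)
  qed
  have "convergent (\<lambda>k. N j (F k))" for j
  proof (rule CauchyI)
    fix k l
    have "(1/2)^Suc j * ((N j (F k) - N j (F l)) / 2)\<^sup>2 \<le> (1/2)^Suc j * (((N j (F k))\<^sup>2 + (N j (F l))\<^sup>2) / 2 - (N j (H k l))\<^sup>2)"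
      unfolding H_def by (intro mult_left_mono midpoint(3) F) simp
    then show "(1/2)^Suc j * ((N j (F k) - N j (F l)) / 2)\<^sup>2 \<le> (a k + a l) / 2" using gap order_trans by blast
  qed
  then obtain L where L: "\<And>j. (\<lambda>k. N j (F k)) \<longlonglongrightarrow> L j" unfolding convergent_def by metis
  from convergent_imp_Bseq[of "\<lambda>k. N 0 (F k)"] L[of 0]
  obtain B where B: "B > 0" "\<And>k. N 0 (F k) \<le> B"
    by (auto simp: convergent_def Bseq_def abs_le_iff)
  have FB: "\<bar>F k x\<bar> \<le> B * norm x" if "x \<in> Y" for k x
    using N_bound[OF F[of k] that] mult_right_mono[OF B(2)[of k] norm_ge_zero[of x]] by linarith
  define A where "A = {x\<in>Y. \<exists>j. S j = {inverse (1 + norm x) *\<^sub>R x}}"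
  have conv_A: "convergent (\<lambda>k. F k x)" if "x \<in> A" for x
  proof -
    define p where "p = inverse (1 + norm x) *\<^sub>R x"
    have x: "x \<in> Y" and "\<exists>j. S j = {p}" using \<open>x \<in> A\<close> unfolding A_def p_def by auto
    then obtain j where j: "S j = {p}" by blast
    have p: "p \<in> Y" using S_Y j by blast
    have xp: "x = (1 + norm x) *\<^sub>R p" 
    proof -
      have "1 + norm x \<noteq> 0" using norm_ge_zero[of x] by linarith
      then show ?thesis unfolding p_def by simp
    qed
    have "convergent (\<lambda>k. F k p)"
    proof (rule CauchyI)
      fix k l
      \<comment> \<open>On a singleton the gap is exactly a squared difference of signed values, so
        the values themselves converge and not only their moduli.\<close>
      have "((N j (F k))\<^sup>2 + (N j (F l))\<^sup>2) / 2 - (N j (H k l))\<^sup>2 = ((F k p - F l p) / 2)\<^sup>2"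
        using p by (simp add: N_def j H_def power2_eq_square field_simps)
      with gap[of j k l] show "(1/2)^Suc j * ((F k p - F l p) / 2)\<^sup>2 \<le> (a k + a l) / 2" by simp
    qed
    then have "convergent (\<lambda>k. (1 + norm x) * F k p)" by (rule convergent_mult[OF convergent_const])
    then show ?thesis using dual_on_scale[OF F p, of _ "1 + norm x"] xp by simp
  qed
  have conv: "convergent (\<lambda>k. F k x)" if x: "x \<in> Y" for x
  proof -
    have "Cauchy (\<lambda>k. F k x)"
    proof (rule metric_CauchyI)
      fix e :: real assume e: "e > 0"
      define r where "r = e / (3 * B)"
      have r: "r > 0" "B * r = e / 3" using e B by (auto simp: r_def)
      obtain y where y: "y \<in> A" "dist y x < r"
        using closure_approachable[of x A] dense x r(1) unfolding A_def[symmetric] by auto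
      have yY: "y \<in> Y" using y by (simp add: A_def)
      have close: "\<bar>F k x - F k y\<bar> < e / 3" for k
      proof -
        have "\<bar>F k (x - y)\<bar> \<le> B * norm (x - y)" using FB subspace_diff[OF Y x yY] by blast
        also have "\<dots> < B * r" using y(2) B(1) by (simp add: dist_norm norm_minus_commute)
        finally show ?thesis using dual_on_diff[OF F Y x yY, of k] r(2) by simp
      qed
      have "Cauchy (\<lambda>k. F k y)" using conv_A[OF y(1)] by (simp add: Cauchy_convergent_iff)
      from metric_CauchyD[OF this, of "e/3"] e obtain M where M: "\<And>k l. k \<ge> M \<Longrightarrow> l \<ge> M \<Longrightarrow> \<bar>F k y - F l y\<bar> < e / 3"
        by (auto simp: dist_real_def)
      have "dist (F k x) (F l x) < e" if "k \<ge> M" "l \<ge> M" for k l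
        using M[OF that] close[of k] close[of l] unfolding dist_real_def by linarith
      then show "\<exists>M. \<forall>m\<ge>M. \<forall>n\<ge>M. dist (F m x) (F n x) < e" by blast
    qed
    then show ?thesis by (simp add: Cauchy_convergent_iff)
  qed
  define f where "f = restrict (\<lambda>x. lim (\<lambda>k. F k x)) Y"
  have Ff: "(\<lambda>k. F k x) \<longlonglongrightarrow> f x" if "x \<in> Y" for x
    using conv[OF that] that by (simp add: f_def convergent_LIMSEQ_iff)
  have f: "f \<in> dual_on Y"
  proof -
    have "restrict f Y \<in> dual_on Y"
    proof (rule dual_onI[where K = B])
      show "f (x + y) = f x + f y" if "x \<in> Y" "y \<in> Y" for x y
        using LIMSEQ_unique[OF Ff[OF subspace_add[OF Y that]]] tendsto_add[OF Ff[OF that(1)] Ff[OF that(2)]]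
        by (simp add: dual_on_add[OF F that])
      show "f (c *\<^sub>R x) = c * f x" if "x \<in> Y" for c x
        using LIMSEQ_unique[OF Ff[OF subspace_scale[OF Y that, of c]]] tendsto_mult_left[OF Ff[OF that], of c]
        by (simp add: dual_on_scale[OF F that])
      show "\<bar>f x\<bar> \<le> B * norm x" if "x \<in> Y" for x
        by (rule LIMSEQ_le_const2[OF tendsto_rabs[OF Ff[OF that]]]) (use FB that in auto)
    qed (rule Y)
    then show ?thesis by (simp add: f_def)
  qed
  have N_L: "N j f \<le> L j" for j
  proof (rule N_least)
    show "\<bar>f x\<bar> \<le> L j" if "x \<in> S j" for x
      by (rule LIMSEQ_le[OF tendsto_rabs[OF Ff[OF S_Y[OF that]]] L]) (use N_upper[OF F that] in auto)
  qed
  have L_le: "0 \<le> L j" "L j \<le> B" for j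
    using LIMSEQ_le_const[OF L] LIMSEQ_le_const2[OF L] N_nonneg[OF F] order_trans[OF N_le[OF F] B(2)] by blast+
  have sL: "summable (\<lambda>j. (1/2)^Suc j * (L j)\<^sup>2)"
    by (rule summable_weights[where B = "B\<^sup>2"]) (auto intro!: power_mono L_le)
  have qF: "(\<lambda>k. q (F k)) \<longlonglongrightarrow> f w - \<theta> w"
    using tendsto_diff[OF Ff[OF w] lim] by simp
  have "(\<Sum>j<n. (1/2)^Suc j * (L j)\<^sup>2) \<le> f w - \<theta> w" for n
    by (rule LIMSEQ_le[OF tendsto_sum[OF tendsto_mult_left[OF tendsto_power[OF L]]] qF])
      (use q_ge_sum[OF F] in auto)
  \<comment> \<open>The chain from the weighted sum of \<open>(L j)\<^sup>2\<close> through
    \<open>f w - \<theta> w\<close> and \<open>q f\<close> back to the same sum closes. Hence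
    \<open>f\<close> is a maximiser, and termwise comparison gives
    \<open>L j = N j f\<close>.\<close>
  then have L1: "(suminf (\<lambda>j. (1/2)^Suc j * (L j)\<^sup>2)) \<le> f w - \<theta> w" by (intro suminf_le_const sL)
  have L2: "f w - \<theta> w \<le> q f" using theta_upper[OF f w] by linarith
  have sq: "(N j f)\<^sup>2 \<le> (L j)\<^sup>2" for j using N_L N_nonneg[OF f] by (intro power_mono)
  have L3: "q f \<le> (suminf (\<lambda>j. (1/2)^Suc j * (L j)\<^sup>2))"
    unfolding q_def by (intro suminf_le q_summable f sL mult_left_mono sq) auto
  have L_eq: "L j = N j f" for j
  proof -
    let ?t = "\<lambda>j. (1/2)^Suc j * (L j)\<^sup>2 - (1/2)^Suc j * (N j f)\<^sup>2"
    have st: "summable ?t" by (rule summable_diff[OF sL q_summable[OF f]])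
    have "sum ?t {j} \<le> suminf ?t"
      by (rule sum_le_suminf[OF st]) (auto intro!: mult_left_mono sq)
    also have "\<dots> = (suminf (\<lambda>j. (1/2)^Suc j * (L j)\<^sup>2)) - q f"
      unfolding q_def by (rule suminf_diff[OF sL q_summable[OF f], symmetric])
    also have "\<dots> \<le> 0" using L1 L2 by linarith
    finally have "(L j)\<^sup>2 \<le> (N j f)\<^sup>2" by simp
    then show ?thesis using N_L[of j] N_nonneg[OF f, of j] L_le(1)[of j] by (metis antisym power2_le_imp_le)
  qed
  show thesis
  proof
    show "f \<in> dual_on Y" by (rule f)
    show "f w - q f = \<theta> w" using L1 L2 L3 by linarith
    fix e :: real assume e: "e > 0"
    \<comment> \<open>The final estimate is \<open>\<bar>g x\<bar> \<le> 3 * \<bar>g v\<bar> +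
      \<bar>\<alpha> * g x0\<bar> \<le> 9 * r + 2 * r\<close>.\<close>
    define r where "r = e / 11"
    have r: "r > 0" using e by (simp add: r_def)
    from kernels[OF f r] obtain d j where d: "d \<in> dual_on Y" and j: "S j = {y\<in>Y. norm y \<le> 1 \<and> d y = 0}"
      and fd: "\<And>y. y \<in> Y \<Longrightarrow> norm y \<le> 1 \<Longrightarrow> \<bar>f y - d y\<bar> \<le> r" by blast
    have Nf: "N j f \<le> r" using fd by (intro N_least) (force simp: j)
    obtain x0 where x0: "x0 \<in> Y" "norm x0 \<le> 1" "N 0 d \<le> 2 * \<bar>d x0\<bar>"
    proof (cases "N 0 d = 0")
      case True then show ?thesis using that[of 0] subspace_0[OF Y] by simp
    next
      case False
      then have "N 0 d / 2 < (SUP x\<in>S 0. \<bar>d x\<bar>)" using N_nonneg[OF d, of 0] by (simp add: N_def)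
      then obtain x where "x \<in> S 0" "N 0 d / 2 < \<bar>d x\<bar>" using less_cSUP_iff[OF S_ne bdd_N[OF d]] by blast
      then show ?thesis using that[of x] S_0 by auto
    qed
    have ev1: "\<forall>\<^sub>F k in sequentially. N j (F k) < 2 * r"
      using order_tendstoD(2)[OF L[of j], of "2*r"] Nf r by (simp add: L_eq)
    have ev2: "\<forall>\<^sub>F k in sequentially. \<bar>F k x0 - f x0\<bar> < r"
      using tendstoD[OF Ff[OF x0(1)] r] by (simp add: dist_real_def)
    show "\<forall>\<^sub>F k in sequentially. \<forall>x\<in>Y. \<bar>F k x - f x\<bar> \<le> e * norm x"
      using ev1 ev2
    proof eventually_elim
      case (elim k)
      define g where "g = restrict (\<lambda>x. F k x - f x) Y"
      have g: "g \<in> dual_on Y"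
        unfolding g_def
      proof (rule dual_onI[where K = "B + N 0 f"])
        show "\<bar>F k x - f x\<bar> \<le> (B + N 0 f) * norm x" if "x \<in> Y" for x
          using FB[OF that, of k] N_bound[OF f that] by (simp add: algebra_simps)
      qed (auto simp: dual_on_add[OF F] dual_on_add[OF f] dual_on_scale[OF F] dual_on_scale[OF f] algebra_simps Y)
      have "N 0 g \<le> e"
      proof (rule N_least)
        fix x assume "x \<in> S 0"
        then have x: "x \<in> Y" "norm x \<le> 1" using S_0 by auto
        \<comment> \<open>If \<open>d x0 = 0\<close>, the quotient is 0 by convention, and then
          \<open>dx\<close> forces \<open>d x = 0\<close>, so \<open>dal\<close> holds in this case
          as well.\<close>
        define \<alpha> where "\<alpha> = d x / d x0"
        have dx: "\<bar>d x\<bar> \<le> 2 * \<bar>d x0\<bar>" using N_upper[OF d, of x 0] x0(3) \<open>x \<in> S 0\<close> by linarith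
        then have al: "\<bar>\<alpha>\<bar> \<le> 2" by (cases "d x0 = 0") (auto simp: \<alpha>_def field_simps)
        have dal: "\<alpha> * d x0 = d x" using dx by (cases "d x0 = 0") (auto simp: \<alpha>_def)
        \<comment> \<open>The factor 1/3 returns the vector, of norm at most 1 + 2, to the unit
          ball.\<close>
        define v where "v = (1/3) *\<^sub>R (x - \<alpha> *\<^sub>R x0)"
        have ax: "\<alpha> *\<^sub>R x0 \<in> Y" "x - \<alpha> *\<^sub>R x0 \<in> Y" using x x0 Y by (auto intro: subspace_scale subspace_diff)
        have "\<bar>\<alpha>\<bar> * norm x0 \<le> 2 * 1" by (intro mult_mono al x0) auto
        then have "norm v \<le> 1" using norm_triangle_ineq4[of x "\<alpha> *\<^sub>R x0"] x by (simp add: v_def)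
        moreover have "d v = 0"
          unfolding v_def dual_on_scale[OF d ax(2)] dual_on_diff[OF d Y x(1) ax(1)] dual_on_scale[OF d x0(1)] dal by simp
        ultimately have v: "v \<in> S j" using ax(2) Y by (auto simp: j v_def intro: subspace_scale)
        have "\<bar>g v\<bar> \<le> 3 * r"
          using N_upper[OF F v, of k] N_upper[OF f v] elim(1) Nf S_Y[OF v] by (simp add: g_def)
        moreover have "\<bar>\<alpha> * g x0\<bar> \<le> 2 * r"
          unfolding abs_mult using elim(2) x0(1) by (intro mult_mono al) (auto simp: g_def)
        moreover have "g x = 3 * g v + \<alpha> * g x0"
          unfolding v_def dual_on_scale[OF g ax(2)] dual_on_diff[OF g Y x(1) ax(1)] dual_on_scale[OF g x0(1)] by (simp add: field_simps)
        ultimately show "\<bar>g x\<bar> \<le> e" unfolding r_def by linarith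
      qed
      show ?case
      proof (intro ballI)
        fix x assume x: "x \<in> Y"
        show "\<bar>F k x - f x\<bar> \<le> e * norm x"
          using order_trans[OF N_bound[OF g x] mult_right_mono[OF \<open>N 0 g \<le> e\<close> norm_ge_zero]] x by (simp add: g_def)
      qed
    qed
  qed
qed

section \<open>Maximisers and the derivative of the conjugate\<close>

lemma maximizer_exists:
  assumes "w \<in> Y" obtains f where "f \<in> dual_on Y" "f w - q f = \<theta> w"
proof -
  have "\<exists>f\<in>dual_on Y. \<theta> w - inverse (real (Suc k)) < f w - q f" for k
  proof -
    have bdd: "bdd_above ((\<lambda>f. f w - q f) ` dual_on Y)" by (rule bdd_aboveI2, rule pair_le[OF _ assms])
    have "\<theta> w - inverse (real (Suc k)) < (SUP f\<in>dual_on Y. f w - q f)" by (simp add: \<theta>_def)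
    then show ?thesis using less_cSUP_iff[OF _ bdd] zero_dual by blast
  qed
  then obtain F where F: "\<And>k. F k \<in> dual_on Y" "\<And>k. \<theta> w - inverse (real (Suc k)) < F k w - q (F k)" by metis
  have lim: "(\<lambda>k. F k w - q (F k)) \<longlonglongrightarrow> \<theta> w"
  proof (rule tendsto_sandwich)
    show "(\<lambda>k. \<theta> w - inverse (real (Suc k))) \<longlonglongrightarrow> \<theta> w"
      using tendsto_diff[OF tendsto_const LIMSEQ_inverse_real_of_nat, of "\<theta> w"] by simp
    show "(\<lambda>k. \<theta> w) \<longlonglongrightarrow> \<theta> w" by simp
  qed (use F theta_upper assms in \<open>auto intro!: always_eventually less_imp_le simp del: of_nat_Suc\<close>)
  show thesis by (rule maximizing_sequence_converges[OF assms F(1) lim]) (rule that)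
qed

lemma maximizer_stable:
  assumes w: "w \<in> Y" and f: "f \<in> dual_on Y" "f w - q f = \<theta> w" and e: "e > 0"
  obtains d where "d > 0" "\<And>g. g \<in> dual_on Y \<Longrightarrow> \<theta> w - d < g w - q g \<Longrightarrow> (\<forall>x\<in>Y. \<bar>g x - f x\<bar> \<le> e * norm x)"
proof -
  have "\<exists>d>0. \<forall>g\<in>dual_on Y. \<theta> w - d < g w - q g \<longrightarrow> (\<forall>x\<in>Y. \<bar>g x - f x\<bar> \<le> e * norm x)"
  proof (rule ccontr)
    assume "\<not> ?thesis"
    then have "\<exists>g\<in>dual_on Y. \<theta> w - inverse (real (Suc k)) < g w - q g \<and> \<not> (\<forall>x\<in>Y. \<bar>g x - f x\<bar> \<le> e * norm x)" for k
      by (metis inverse_positive_iff_positive of_nat_0_less_iff zero_less_Suc)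
    then obtain G where G: "\<And>k. G k \<in> dual_on Y" "\<And>k. \<theta> w - inverse (real (Suc k)) < G k w - q (G k)"
      "\<And>k. \<not> (\<forall>x\<in>Y. \<bar>G k x - f x\<bar> \<le> e * norm x)" by metis
    \<comment> \<open>Alternating with the constant \<open>f\<close> still gives a maximising
      sequence. Its norm limit is some \<open>f'\<close>, and comparison at the even indices puts
      \<open>f\<close> within \<open>e / 2\<close> of \<open>f'\<close>, at the odd ones the
      counterexamples.\<close>
    define F where "F k = (if even k then f else G k)" for k :: nat
    have F: "F k \<in> dual_on Y" "\<theta> w - inverse (real (Suc k)) < F k w - q (F k)" for k
      using f G by (auto simp: F_def)
    have lim: "(\<lambda>k. F k w - q (F k)) \<longlonglongrightarrow> \<theta> w"
    proof (rule tendsto_sandwich)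
      show "(\<lambda>k. \<theta> w - inverse (real (Suc k))) \<longlonglongrightarrow> \<theta> w"
        using tendsto_diff[OF tendsto_const LIMSEQ_inverse_real_of_nat, of "\<theta> w"] by simp
      show "(\<lambda>k. \<theta> w) \<longlonglongrightarrow> \<theta> w" by simp
    qed (use F theta_upper w in \<open>auto intro!: always_eventually less_imp_le simp del: of_nat_Suc\<close>)
    have "e / 2 > 0" using e by simp
    then obtain f' where f': "\<forall>\<^sub>F k in sequentially. \<forall>x\<in>Y. \<bar>F k x - f' x\<bar> \<le> e / 2 * norm x"
      by (rule_tac maximizing_sequence_converges[OF w F(1) lim]) blast
    from f' obtain M where M: "\<And>k x. k \<ge> M \<Longrightarrow> x \<in> Y \<Longrightarrow> \<bar>F k x - f' x\<bar> \<le> e / 2 * norm x"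
      unfolding eventually_sequentially by auto
    have "\<bar>G (2*M+1) x - f x\<bar> \<le> e * norm x" if "x \<in> Y" for x
    proof -
      have "\<bar>f x - f' x\<bar> \<le> e / 2 * norm x" "\<bar>G (2*M+1) x - f' x\<bar> \<le> e / 2 * norm x"
        using M[OF _ that, of "2*M"] M[OF _ that, of "2*M+1"] by (auto simp: F_def)
      then show ?thesis by argo
    qed
    then show False using G(3) by blast
  qed
  then show thesis using that by blast
qed

text \<open>The multiples of \<open>f\<close> compete with \<open>f\<close>, so
  \<open>t * f w - t\<^sup>2 * q f\<close> is largest at \<open>t = 1\<close>. This is Euler's
  identity for a function homogeneous of degree two.\<close>

lemma euler: assumes w: "w \<in> Y" and f: "f \<in> dual_on Y" "f w - q f = \<theta> w" shows "f w = 2 * \<theta> w" "q f = \<theta> w"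
proof -
  have le: "t * f w - t\<^sup>2 * q f \<le> f w - q f" for t
    using theta_upper[OF scaled_dual[OF f(1), of t] w] f w by (simp add: q_scaled)
  have "f w = 2 * q f"
  proof (cases "q f = 0")
    case True
    then show ?thesis using le[of 2] le[of 0] by simp
  next
    case False
    then have qp: "q f > 0" using q_ge[OF f(1)] zero_le_power2[of "N 0 f"] by linarith
    define t where "t = f w / (2 * q f)"
    have t: "f w = 2 * q f * t" using qp by (simp add: t_def)
    have "q f * (t - 1)\<^sup>2 \<le> 0"
      using le[of t] unfolding t by (simp add: power2_eq_square algebra_simps)
    then have "t = 1" using qp by (simp add: mult_le_0_iff)
    then show ?thesis using t by simp
  qed
  then show "f w = 2 * \<theta> w" "q f = \<theta> w" using f(2) by auto
qed

lemma theta_ge: assumes "y \<in> Y" shows "(norm y)\<^sup>2 / 4 \<le> \<theta> y"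
proof -
  obtain L :: "'a \<Rightarrow> real" where L: "linear L" "\<And>x. \<bar>L x\<bar> \<le> norm x" "L y = norm y" using norming_functional[of y] by metis
  define f where "f = restrict L Y"
  have f: "f \<in> dual_on Y" unfolding f_def
    by (rule dual_onI[where K = 1]) (auto simp: L linear_add linear_scale Y)
  have "N 0 f \<le> 1" by (rule bound_N) (auto simp: f_def L)
  then have qf: "q f \<le> 1" using q_le[OF f] N_nonneg[OF f, of 0] power_le_one[of "N 0 f" 2] by linarith
  \<comment> \<open>This value maximises \<open>t * norm y - t\<^sup>2\<close>, a lower bound
    obtained from the multiples of a norming functional.\<close>
  let ?t = "norm y / 2"
  have "?t * f y - ?t\<^sup>2 * q f \<le> \<theta> y"
    using theta_upper[OF scaled_dual[OF f, of ?t] assms] assms unfolding q_scaled[OF f] by simp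
  moreover have "?t\<^sup>2 * q f \<le> ?t\<^sup>2 * 1" by (intro mult_left_mono qf) auto
  moreover have "f y = norm y" using assms by (simp add: f_def L)
  ultimately show ?thesis by (simp add: power2_eq_square)
qed

text \<open>The functional is a maximiser at \<open>w\<close>. A maximiser at \<open>w + h\<close>
  competes at \<open>w\<close>, so its value at \<open>h\<close> bounds the increment from above;
  for small \<open>h\<close> it nearly maximises at \<open>w\<close> and is close to the given one
  by \<open>maximizer_stable\<close>.\<close>

lemma derivative:
  assumes w: "w \<in> Y"
  obtains g where "g \<in> dual_on Y" "g w = 2 * \<theta> w" "\<And>h. h \<in> Y \<Longrightarrow> \<bar>g h\<bar> \<le> sqrt (2 * \<theta> w) * norm h"
    "\<And>e. e > 0 \<Longrightarrow> \<exists>d>0. \<forall>h\<in>Y. norm h < d \<longrightarrow> \<theta> (w + h) \<le> \<theta> w + g h + e * norm h"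
    "\<And>h. h \<in> Y \<Longrightarrow> \<theta> (w + h) - \<theta> w \<le> norm (w + h) * norm h"
proof -
  have bound: "\<bar>g h\<bar> \<le> sqrt (2 * \<theta> v) * norm h" if "v \<in> Y" "g \<in> dual_on Y" "g v - q g = \<theta> v" "h \<in> Y" for v g h
  proof -
    have "(N 0 g)\<^sup>2 \<le> 2 * \<theta> v" using q_ge[OF that(2)] euler(2)[OF that(1-3)] by simp
    then have "N 0 g \<le> sqrt (2 * \<theta> v)" by (rule real_le_rsqrt)
    then show ?thesis using N_bound[OF that(2,4)] mult_right_mono[OF _ norm_ge_zero[of h]] order_trans by blast
  qed
  have bound': "\<bar>g h\<bar> \<le> norm v * norm h" if "v \<in> Y" "g \<in> dual_on Y" "g v - q g = \<theta> v" "h \<in> Y" for v g h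
  proof -
    have "sqrt (2 * \<theta> v) \<le> norm v" using theta_le[OF that(1)] by (intro real_le_lsqrt) auto
    then show ?thesis using bound[OF that] mult_right_mono[OF _ norm_ge_zero[of h]] order_trans by blast
  qed
  have upper: "\<theta> (w + h) \<le> \<theta> w + g h" if "h \<in> Y" "g \<in> dual_on Y" "g (w + h) - q g = \<theta> (w + h)" for g h
    using theta_upper[OF that(2) w] that dual_on_add[OF that(2) w that(1)] by simp
  obtain f where f: "f \<in> dual_on Y" "f w - q f = \<theta> w" by (rule maximizer_exists[OF w])
  show thesis
  proof
    show "f \<in> dual_on Y" "f w = 2 * \<theta> w" using f euler(1)[OF w] by auto
    show "\<bar>f h\<bar> \<le> sqrt (2 * \<theta> w) * norm h" if "h \<in> Y" for h using bound[OF w f that] .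
    show "\<theta> (w + h) - \<theta> w \<le> norm (w + h) * norm h" if h: "h \<in> Y" for h
    proof -
      have wh: "w + h \<in> Y" using subspace_add[OF Y w h] .
      obtain g where g: "g \<in> dual_on Y" "g (w + h) - q g = \<theta> (w + h)" by (rule maximizer_exists[OF wh])
      show ?thesis using upper[OF h g] bound'[OF wh g h] by linarith
    qed
    fix e :: real assume e: "e > 0"
    obtain d where d: "d > 0" "\<And>g. g \<in> dual_on Y \<Longrightarrow> \<theta> w - d < g w - q g \<Longrightarrow> (\<forall>x\<in>Y. \<bar>g x - f x\<bar> \<le> e * norm x)"
      using maximizer_stable[OF w f e] by metis
    \<comment> \<open>For \<open>norm h < 1\<close> the two functionals contribute at most
      \<open>(2 * norm w + 1) * norm h\<close>, which has to stay below \<open>d\<close>.\<close>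
    define r where "r = min 1 (d / (2 * norm w + 2))"
    have "r > 0" using d(1) norm_ge_zero[of w] by (simp add: r_def add_nonneg_pos)
    moreover have "\<theta> (w + h) \<le> \<theta> w + f h + e * norm h" if h: "h \<in> Y" "norm h < r" for h
    proof -
      have wh: "w + h \<in> Y" using subspace_add[OF Y w h(1)] .
      obtain g where g: "g \<in> dual_on Y" "g (w + h) - q g = \<theta> (w + h)" by (rule maximizer_exists[OF wh])
      have gadd: "g (w + h) = g w + g h" "f (w + h) = f w + f h" using dual_on_add w h g f by blast+
      have "\<theta> w + f h \<le> \<theta> (w + h)" using theta_upper[OF f(1) wh] f(2) gadd by simp
      moreover have "\<bar>f h\<bar> + \<bar>g h\<bar> < d"
      proof -
        have "\<bar>f h\<bar> \<le> norm w * norm h" "\<bar>g h\<bar> \<le> norm (w + h) * norm h"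
          using bound'[OF w f h(1)] bound'[OF wh g h(1)] .
        moreover have "norm (w + h) * norm h \<le> (norm w + 1) * norm h"
          using norm_triangle_ineq[of w h] h(2) by (intro mult_right_mono) (auto simp: r_def)
        moreover have "(2 * norm w + 2) * norm h < d"
        proof -
          have "norm h < d / (2 * norm w + 2)" using h(2) by (simp add: r_def)
          then show ?thesis using norm_ge_zero[of w] by (simp add: pos_less_divide_eq add_nonneg_pos mult.commute)
        qed
        moreover have "0 \<le> norm h" by simp
        ultimately show ?thesis unfolding distrib_right by linarith
      qed
      ultimately have "\<theta> w - d < g w - q g" using g(2) gadd by linarith
      from d(2)[OF g(1) this] h(1) have "\<bar>g h - f h\<bar> \<le> e * norm h" by blast
      then show ?thesis using upper[OF h(1) g] by linarith
    qed
    ultimately show "\<exists>d>0. \<forall>h\<in>Y. norm h < d \<longrightarrow> \<theta> (w + h) \<le> \<theta> w + f h + e * norm h" by blast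
  qed
qed

end

section \<open>The square of a smooth norm\<close>

text \<open>The interface to the variational argument. The differentiability clause is one-sided
  because values near a minimiser are only ever estimated from above;
  \<open>g w = 2 * \<theta> w\<close> later bounds the multipliers from below.\<close>

locale smooth_square =
  fixes Y :: "'a::real_normed_vector set" and \<theta> :: "'a \<Rightarrow> real"
  assumes Y: "subspace Y"
    and lower: "y \<in> Y \<Longrightarrow> (norm y)\<^sup>2 / 4 \<le> \<theta> y"
    and upper: "y \<in> Y \<Longrightarrow> \<theta> y \<le> (norm y)\<^sup>2 / 2"
    and lipschitz: "w \<in> Y \<Longrightarrow> h \<in> Y \<Longrightarrow> \<theta> (w + h) - \<theta> w \<le> norm (w + h) * norm h"
    and derivative: "w \<in> Y \<Longrightarrow> \<exists>g\<in>dual_on Y. g w = 2 * \<theta> w \<and> (\<forall>h\<in>Y. \<bar>g h\<bar> \<le> sqrt (2 * \<theta> w) * norm h) \<and>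
      (\<forall>e>0. \<exists>d>0. \<forall>h\<in>Y. norm h < d \<longrightarrow> \<theta> (w + h) \<le> \<theta> w + g h + e * norm h)"

lemma (in smooth_gauge) smooth_square: "smooth_square Y \<theta>"
proof
  show "subspace Y" by (rule Y)
  show "(norm y)\<^sup>2 / 4 \<le> \<theta> y" if "y \<in> Y" for y using theta_ge[OF that] .
  show "\<theta> y \<le> (norm y)\<^sup>2 / 2" if "y \<in> Y" for y using theta_le[OF that] .
  show "\<theta> (w + h) - \<theta> w \<le> norm (w + h) * norm h" if "w \<in> Y" "h \<in> Y" for w h
    by (rule derivative[OF that(1)]) (use that in blast)
  show "\<exists>g\<in>dual_on Y. g w = 2 * \<theta> w \<and> (\<forall>h\<in>Y. \<bar>g h\<bar> \<le> sqrt (2 * \<theta> w) * norm h) \<and>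
      (\<forall>e>0. \<exists>d>0. \<forall>h\<in>Y. norm h < d \<longrightarrow> \<theta> (w + h) \<le> \<theta> w + g h + e * norm h)" if "w \<in> Y" for w
    by (rule derivative[OF that]) blast
qed

lemma smooth_square_exists:
  fixes Y :: "'a::real_normed_vector set"
  assumes Y: "subspace Y" and A: "countable A" "A \<subseteq> Y" "Y \<subseteq> closure A" and sep: "separable_dual Y"
  obtains \<theta> where "smooth_square Y \<theta>"
proof -
  obtain D where D: "countable D" "D \<subseteq> dual_on Y"
    and D_dense: "\<forall>f\<in>dual_on Y. \<forall>e>0. \<exists>g\<in>D. dual_norm_on Y (\<lambda>y. f y - g y) < e"
    using sep unfolding separable_dual_def by (elim exE conjE) (rule that)
  define B where "B = {y\<in>Y. norm y \<le> 1}"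
  \<comment> \<open>The factor \<open>inverse (1 + norm x)\<close> puts \<open>x\<close> into the
    unit ball without a separate case for 0.\<close>
  define \<S> where "\<S> = insert B ((\<lambda>d. {y\<in>Y. norm y \<le> 1 \<and> d y = 0}) ` D \<union> (\<lambda>x. {inverse (1 + norm x) *\<^sub>R x}) ` A)"
  \<comment> \<open>Index 0 is reserved for the ball, as \<open>S_0\<close> demands; the other
    indices enumerate \<open>\<S>\<close>, possibly with repetitions.\<close>
  define S where "S j = (if j = 0 then B else from_nat_into \<S> (j - 1))" for j
  have "countable \<S>" "\<S> \<noteq> {}" using D(1) A(1) by (auto simp: \<S>_def)
  then have r: "range (from_nat_into \<S>) = \<S>" by (intro range_from_nat_into)
  have S_ex: "\<exists>j. S j = X" if "X \<in> \<S>" for X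
  proof -
    obtain i where "from_nat_into \<S> i = X" using \<open>X \<in> \<S>\<close> r by (metis imageE)
    then have "S (Suc i) = X" by (simp add: S_def)
    then show ?thesis ..
  qed
  have B_in: "B \<in> \<S>" by (simp add: \<S>_def)
  have S_in: "S j \<in> \<S>" for j using r B_in by (auto simp: S_def)
  have zB: "0 \<in> B" using Y by (simp add: B_def subspace_0)
  have single: "inverse (1 + norm x) *\<^sub>R x \<in> B" if "x \<in> A" for x
  proof -
    have "x \<in> Y" using that A by blast
    moreover have "1 + norm x > 0" using norm_ge_zero[of x] by linarith
    ultimately show ?thesis using Y by (simp add: B_def subspace_scale divide_simps)
  qed
  have elem: "X \<subseteq> B \<and> X \<noteq> {}" if "X \<in> \<S>" for X
  proof -
    consider "X = B" | d where "d \<in> D" "X = {y\<in>Y. norm y \<le> 1 \<and> d y = 0}"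
      | x where "x \<in> A" "X = {inverse (1 + norm x) *\<^sub>R x}" using \<open>X \<in> \<S>\<close> unfolding \<S>_def by blast
    then show ?thesis
    proof cases
      case 2
      then have "0 \<in> X" using zB D(2) dual_on_0[OF _ Y] by (auto simp: B_def)
      then show ?thesis using 2 by (auto simp: B_def)
    qed (use zB single in auto)
  qed
  interpret smooth_gauge Y S
  proof
    show "subspace Y" by (rule Y)
    show "S j \<subseteq> {y\<in>Y. norm y \<le> 1}" "S j \<noteq> {}" for j using elem[OF S_in] by (auto simp: B_def)
    show "S 0 = {y\<in>Y. norm y \<le> 1}" by (simp add: S_def B_def)
    have "A \<subseteq> {x\<in>Y. \<exists>j. S j = {inverse (1 + norm x) *\<^sub>R x}}"
      using A(2) S_ex by (auto simp: \<S>_def)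
    then show "Y \<subseteq> closure {x\<in>Y. \<exists>j. S j = {inverse (1 + norm x) *\<^sub>R x}}"
      using A(3) closure_mono by blast
    show "\<exists>d\<in>dual_on Y. \<exists>j. S j = {y\<in>Y. norm y \<le> 1 \<and> d y = 0} \<and> (\<forall>y\<in>Y. norm y \<le> 1 \<longrightarrow> \<bar>f y - d y\<bar> \<le> e)"
      if f: "f \<in> dual_on Y" and e: "e > 0" for f e
    proof -
      obtain g where g: "g \<in> D" "dual_norm_on Y (\<lambda>y. f y - g y) < e" using D_dense f e by blast
      then have gd: "g \<in> dual_on Y" using D by blast
      obtain K1 K2 where K: "\<And>x. x \<in> Y \<Longrightarrow> \<bar>f x\<bar> \<le> K1 * norm x" "\<And>x. x \<in> Y \<Longrightarrow> \<bar>g x\<bar> \<le> K2 * norm x"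
        using dual_on_bdd[OF f] dual_on_bdd[OF gd] by blast
      have "\<bar>f x - g x\<bar> \<le> \<bar>K1\<bar> + \<bar>K2\<bar>" if "x \<in> Y" "norm x \<le> 1" for x
      proof -
        have "K1 * norm x \<le> \<bar>K1\<bar> * 1" "K2 * norm x \<le> \<bar>K2\<bar> * 1"
          using that(2) by (intro mult_mono; simp)+
        then show ?thesis using K[OF that(1)] by linarith
      qed
      then have bdd: "bdd_above ((\<lambda>y. \<bar>f y - g y\<bar>) ` {y\<in>Y. norm y \<le> 1})" by (intro bdd_aboveI2) auto
      have "\<bar>f y - g y\<bar> \<le> e" if "y \<in> Y" "norm y \<le> 1" for y
        using cSUP_upper[OF _ bdd, of y] g(2) that unfolding dual_norm_on_def by simp
      moreover have "\<exists>j. S j = {y\<in>Y. norm y \<le> 1 \<and> g y = 0}"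
        using g(1) by (intro S_ex) (auto simp: \<S>_def)
      ultimately show ?thesis using gd by blast
    qed
  qed
  show thesis using that smooth_square .
qed

context smooth_square
begin

section \<open>Continuity, and weighted sums of translates\<close>

lemma nonneg: "y \<in> Y \<Longrightarrow> 0 \<le> \<theta> y"
  using lower[of y] zero_le_power2[of "norm y"] by linarith

lemma zero: "\<theta> 0 = 0"
  using lower[of 0] upper[of 0] subspace_0[OF Y] by simp

lemma diff_le: assumes "v \<in> Y" "w \<in> Y" shows "\<bar>\<theta> v - \<theta> w\<bar> \<le> (norm v + norm w) * norm (v - w)"
proof -
  have "v - w \<in> Y" "w - v \<in> Y" using assms Y by (auto intro: subspace_diff)
  from lipschitz[OF assms(2) this(1)] lipschitz[OF assms(1) this(2)]
  have "\<theta> v - \<theta> w \<le> norm v * norm (v - w)" "\<theta> w - \<theta> v \<le> norm w * norm (v - w)"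
    by (simp_all add: norm_minus_commute)
  moreover have "0 \<le> norm v * norm (v - w)" "0 \<le> norm w * norm (v - w)" by simp_all
  ultimately show ?thesis unfolding distrib_right by linarith
qed

lemma tendsto: assumes v: "v \<longlonglongrightarrow> w" "\<And>n. v n \<in> Y" "w \<in> Y" shows "(\<lambda>n. \<theta> (v n)) \<longlonglongrightarrow> \<theta> w"
proof -
  have "(\<lambda>n. (norm (v n) + norm w) * norm (v n - w)) \<longlonglongrightarrow> (norm w + norm w) * norm (w - w)"
    by (intro tendsto_intros v)
  then have "(\<lambda>n. (norm (v n) + norm w) * norm (v n - w)) \<longlonglongrightarrow> 0" by simp
  moreover have "\<forall>\<^sub>F n in sequentially. norm (\<theta> (v n) - \<theta> w) \<le> (norm (v n) + norm w) * norm (v n - w)"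
    unfolding real_norm_def by (rule always_eventually, rule allI, rule diff_le[OF v(2,3)])
  ultimately have "(\<lambda>n. \<theta> (v n) - \<theta> w) \<longlonglongrightarrow> 0" by (rule Lim_null_comparison[rotated])
  then show ?thesis by (simp add: LIM_zero_iff)
qed

text \<open>Each translate contributes a derivative of norm at most
  \<open>sqrt (2 * \<theta> (w - v n)) \<le> \<rho>\<close>. The radius of differentiability depends
  on \<open>n\<close>, so only a finite head is expanded; the tail is controlled by
  \<open>lipschitz\<close> and by its small total weight.\<close>

lemma series_derivative:
  assumes w: "w \<in> Y" and v: "\<And>n. v n \<in> Y" and bd: "\<And>n. norm (w - v n) \<le> \<rho>"
    and mu: "\<And>n. 0 \<le> \<mu> n" "summable \<mu>"
  obtains g where "g \<in> dual_on Y" "\<And>h. h \<in> Y \<Longrightarrow> \<bar>g h\<bar> \<le> suminf \<mu> * \<rho> * norm h"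
    "\<And>e. e > 0 \<Longrightarrow> \<exists>d>0. \<forall>h\<in>Y. norm h < d \<longrightarrow>
       (suminf (\<lambda>n. \<mu> n * \<theta> (w + h - v n))) \<le> (suminf (\<lambda>n. \<mu> n * \<theta> (w - v n))) + g h + e * norm h"
proof -
  have wv: "w - v n \<in> Y" for n using subspace_diff[OF Y w v] .
  obtain G where G: "\<And>n. G n \<in> dual_on Y"
    "\<And>n h. h \<in> Y \<Longrightarrow> \<bar>G n h\<bar> \<le> sqrt (2 * \<theta> (w - v n)) * norm h"
    "\<And>n e. e > 0 \<Longrightarrow> \<exists>d>0. \<forall>h\<in>Y. norm h < d \<longrightarrow> \<theta> (w - v n + h) \<le> \<theta> (w - v n) + G n h + e * norm h"
  proof -
    have "\<forall>n. \<exists>g. g \<in> dual_on Y \<and> (\<forall>h\<in>Y. \<bar>g h\<bar> \<le> sqrt (2 * \<theta> (w - v n)) * norm h) \<and>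
      (\<forall>e>0. \<exists>d>0. \<forall>h\<in>Y. norm h < d \<longrightarrow> \<theta> (w - v n + h) \<le> \<theta> (w - v n) + g h + e * norm h)"
    proof
      fix n
      obtain g where "g \<in> dual_on Y" "\<forall>h\<in>Y. \<bar>g h\<bar> \<le> sqrt (2 * \<theta> (w - v n)) * norm h"
        "\<forall>e>0. \<exists>d>0. \<forall>h\<in>Y. norm h < d \<longrightarrow> \<theta> (w - v n + h) \<le> \<theta> (w - v n) + g h + e * norm h"
        using derivative[OF wv[of n]] by (elim bexE conjE) (rule that)
      then show "\<exists>g. g \<in> dual_on Y \<and> (\<forall>h\<in>Y. \<bar>g h\<bar> \<le> sqrt (2 * \<theta> (w - v n)) * norm h) \<and>
        (\<forall>e>0. \<exists>d>0. \<forall>h\<in>Y. norm h < d \<longrightarrow> \<theta> (w - v n + h) \<le> \<theta> (w - v n) + g h + e * norm h)"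
        by (intro exI[of _ g] conjI)
    qed
    from choice[OF this] obtain G where "\<forall>n. G n \<in> dual_on Y \<and> (\<forall>h\<in>Y. \<bar>G n h\<bar> \<le> sqrt (2 * \<theta> (w - v n)) * norm h) \<and>
      (\<forall>e>0. \<exists>d>0. \<forall>h\<in>Y. norm h < d \<longrightarrow> \<theta> (w - v n + h) \<le> \<theta> (w - v n) + G n h + e * norm h)" ..
    then show thesis by (intro that[of G]) simp_all
  qed
  have rho: "0 \<le> \<rho>" using bd[of 0] norm_ge_zero[of "w - v 0"] by linarith
  have Gb: "\<bar>G n h\<bar> \<le> \<rho> * norm h" if "h \<in> Y" for n h
  proof -
    have "2 * \<theta> (w - v n) \<le> \<rho>\<^sup>2" using upper[OF wv[of n]] power_mono[OF bd[of n], of 2] by simp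
    then have "sqrt (2 * \<theta> (w - v n)) \<le> \<rho>" using rho by (simp add: real_le_lsqrt)
    then show ?thesis using G(2)[OF that, of n] mult_right_mono[OF _ norm_ge_zero[of h]] by (meson order_trans)
  qed
  have sumG: "summable (\<lambda>n. \<mu> n * G n h)" "\<bar>(suminf (\<lambda>n. \<mu> n * G n h))\<bar> \<le> suminf \<mu> * \<rho> * norm h" if "h \<in> Y" for h
  proof -
    have s: "summable (\<lambda>n. \<mu> n * (\<rho> * norm h))" by (rule summable_mult2[OF mu(2)])
    have le: "norm (\<mu> n * G n h) \<le> \<mu> n * (\<rho> * norm h)" for n
      using Gb[OF that, of n] mu(1)[of n] by (simp add: abs_mult mult_left_mono)
    show "summable (\<lambda>n. \<mu> n * G n h)" by (rule summable_comparison_test'[OF s]) (rule le)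
    have "norm (suminf (\<lambda>n. \<mu> n * G n h)) \<le> (suminf (\<lambda>n. \<mu> n * (\<rho> * norm h)))" by (rule norm_suminf_le[OF le s])
    then show "\<bar>(suminf (\<lambda>n. \<mu> n * G n h))\<bar> \<le> suminf \<mu> * \<rho> * norm h"
      using suminf_mult2[OF mu(2), of "\<rho> * norm h"] by (simp add: mult.assoc)
  qed
  define g where "g = restrict (\<lambda>h. (suminf (\<lambda>n. \<mu> n * G n h))) Y"
  have g: "g \<in> dual_on Y" unfolding g_def
  proof (rule dual_onI[where K = "suminf \<mu> * \<rho>"])
    show "(suminf (\<lambda>n. \<mu> n * G n (x + y))) = (suminf (\<lambda>n. \<mu> n * G n x)) + (suminf (\<lambda>n. \<mu> n * G n y))" if "x \<in> Y" "y \<in> Y" for x y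
      using suminf_add[OF sumG(1)[OF that(1)] sumG(1)[OF that(2)]] by (simp add: dual_on_add[OF G(1) that] distrib_left)
    show "(suminf (\<lambda>n. \<mu> n * G n (c *\<^sub>R x))) = c * (suminf (\<lambda>n. \<mu> n * G n x))" if "x \<in> Y" for c x
      using suminf_mult[OF sumG(1)[OF that], of c] by (simp add: dual_on_scale[OF G(1) that] mult_ac)
  qed (use sumG(2) Y in auto)
  have sumT: "summable (\<lambda>n. \<mu> n * \<theta> (w + h - v n))" if "h \<in> Y" for h
  proof (rule summable_comparison_test'[OF summable_mult2[OF mu(2), of "(\<rho> + norm h)\<^sup>2"]])
    fix n
    have "w + h - v n \<in> Y" using subspace_add[OF Y wv that, of n] by (simp add: algebra_simps)
    moreover have "norm (w + h - v n) \<le> \<rho> + norm h"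
      using norm_triangle_ineq[of "w - v n" h] bd[of n] by (simp add: algebra_simps)
    ultimately have "\<bar>\<theta> (w + h - v n)\<bar> \<le> (\<rho> + norm h)\<^sup>2"
      using upper[of "w + h - v n"] nonneg[of "w + h - v n"] power_mono[of "norm (w + h - v n)" "\<rho> + norm h" 2]
        zero_le_power2[of "norm (w + h - v n)"] norm_ge_zero[of "w + h - v n"] by linarith
    then show "norm (\<mu> n * \<theta> (w + h - v n)) \<le> \<mu> n * (\<rho> + norm h)\<^sup>2"
      using mu(1)[of n] by (simp add: abs_mult mult_left_mono)
  qed
  show thesis
  proof
    show "g \<in> dual_on Y" by (rule g)
    show "\<bar>g h\<bar> \<le> suminf \<mu> * \<rho> * norm h" if "h \<in> Y" for h using sumG(2)[OF that] that by (simp add: g_def)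
    fix e :: real assume e: "e > 0"
    define M where "M = suminf \<mu>"
    have M: "0 \<le> M" unfolding M_def by (rule suminf_nonneg[OF mu(2,1)])
    \<comment> \<open>Half of \<open>e\<close> is for the head, whose weights add up to at most
      \<open>M\<close>, and half for the tail.\<close>
    define e1 where "e1 = e / (2 * (M + 1))"
    have e1: "e1 > 0" "e1 * M \<le> e / 2" using e M by (auto simp: e1_def field_simps)
    \<comment> \<open>\<open>\<rho> + 1\<close> comes from \<open>lipschitz\<close> with
      \<open>norm h \<le> 1\<close>, and another \<open>\<rho>\<close> from the bound on
      \<open>G n h\<close>.\<close>
    define C where "C = 2 * \<rho> + 1"
    have C: "C > 0" using rho by (simp add: C_def)
    obtain n0 where n0: "(suminf (\<lambda>n. \<mu> (n + n0))) * C \<le> e / 2"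
    proof -
      have "e / (2 * C) > 0" using e C by simp
      from suminf_exist_split[OF this mu(2)] obtain n0 where "norm (suminf (\<lambda>n. \<mu> (n + n0))) < e / (2 * C)" by blast
      then have "(suminf (\<lambda>n. \<mu> (n + n0))) \<le> e / (2 * C)" by simp
      then have "(suminf (\<lambda>n. \<mu> (n + n0))) * C \<le> e / 2" using C by (simp add: field_simps)
      then show thesis by (rule that)
    qed
    obtain d where d: "\<And>n. d n > 0"
      "\<And>n h. h \<in> Y \<Longrightarrow> norm h < d n \<Longrightarrow> \<theta> (w - v n + h) \<le> \<theta> (w - v n) + G n h + e1 * norm h"
    proof -
      from choice[OF allI[OF G(3)[OF e1(1)]]] obtain d where "\<forall>n. d n > 0 \<and> (\<forall>h\<in>Y. norm h < d n \<longrightarrow>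
        \<theta> (w - v n + h) \<le> \<theta> (w - v n) + G n h + e1 * norm h)" ..
      then show thesis by (intro that[of d]) simp_all
    qed
    define d0 where "d0 = Min (insert 1 (d ` {..<n0}))"
    have d0: "d0 > 0" "d0 \<le> 1" "\<And>n. n < n0 \<Longrightarrow> d0 \<le> d n" using d(1) by (auto simp: d0_def)
    show "\<exists>d>0. \<forall>h\<in>Y. norm h < d \<longrightarrow>
       (suminf (\<lambda>n. \<mu> n * \<theta> (w + h - v n))) \<le> (suminf (\<lambda>n. \<mu> n * \<theta> (w - v n))) + g h + e * norm h"
    proof (intro exI[of _ d0] conjI ballI impI d0(1))
      fix h assume h: "h \<in> Y" "norm h < d0"
      define R where "R n = \<theta> (w + h - v n) - \<theta> (w - v n) - G n h" for n
      have sumR: "(\<lambda>n. \<mu> n * R n) sums ((suminf (\<lambda>n. \<mu> n * \<theta> (w + h - v n))) - (suminf (\<lambda>n. \<mu> n * \<theta> (w - v n))) - g h)"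
        using sums_diff[OF sums_diff[OF summable_sums[OF sumT[OF h(1)]] summable_sums[OF sumT[of 0, simplified, OF subspace_0[OF Y]]]]
            summable_sums[OF sumG(1)[OF h(1)]]] h(1)
        by (simp add: R_def g_def algebra_simps)
      have R1: "R n \<le> e1 * norm h" if "n < n0" for n
        using d(2)[OF h(1), of n] h(2) d0(3)[OF that] by (simp add: R_def algebra_simps)
      have R2: "R n \<le> C * norm h" for n
      proof -
        have "\<theta> (w - v n + h) - \<theta> (w - v n) \<le> norm (w - v n + h) * norm h" by (rule lipschitz[OF wv h(1)])
        also have "\<dots> \<le> (\<rho> + 1) * norm h"
          using norm_triangle_ineq[of "w - v n" h] bd[of n] h(2) d0(2) by (intro mult_right_mono) auto
        finally show ?thesis using Gb[OF h(1), of n] by (simp add: R_def C_def algebra_simps)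
      qed
      have "suminf (\<lambda>n. \<mu> n * R n) = (suminf (\<lambda>n. \<mu> (n + n0) * R (n + n0))) + (\<Sum>n<n0. \<mu> n * R n)"
        by (rule suminf_split_initial_segment) (use sumR in \<open>simp add: sums_iff\<close>)
      also have "(suminf (\<lambda>n. \<mu> (n + n0) * R (n + n0))) \<le> (suminf (\<lambda>n. \<mu> (n + n0) * (C * norm h)))"
        by (intro suminf_le mult_left_mono R2 mu(1) summable_mult2)
          (use mu(2) sumR in \<open>auto simp: summable_iff_shift sums_iff intro: summable_ignore_initial_segment\<close>)
      also have "\<dots> = (suminf (\<lambda>n. \<mu> (n + n0))) * C * norm h"
        using suminf_mult2[of "\<lambda>n. \<mu> (n + n0)" "C * norm h"] mu(2) by (simp add: summable_iff_shift mult.assoc)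
      also have "\<dots> \<le> e / 2 * norm h" by (rule mult_right_mono[OF n0]) simp
      also have "(\<Sum>n<n0. \<mu> n * R n) \<le> (\<Sum>n<n0. \<mu> n * (e1 * norm h))"
        by (intro sum_mono mult_left_mono R1 mu(1)) auto
      also have "\<dots> = (\<Sum>n<n0. \<mu> n) * (e1 * norm h)" by (rule sum_distrib_right[symmetric])
      also have "\<dots> \<le> M * (e1 * norm h)"
        unfolding M_def using e1(1) by (intro mult_right_mono sum_le_suminf mu) (auto intro: mu)
      also have "\<dots> = e1 * M * norm h" by simp
      also have "\<dots> \<le> e / 2 * norm h" by (rule mult_right_mono[OF e1(2)]) simp
      finally have "suminf (\<lambda>n. \<mu> n * R n) \<le> e * norm h" by simp
      then show "(suminf (\<lambda>n. \<mu> n * \<theta> (w + h - v n))) \<le> (suminf (\<lambda>n. \<mu> n * \<theta> (w - v n))) + g h + e * norm h"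
        using sumR by (simp add: sums_iff)
    qed
  qed
qed

end

section \<open>The Borwein--Preiss variational principle\<close>

text \<open>The gauge \<open>\<psi>\<close> satisfies no triangle inequality; completeness is
  assumed for sequences with geometrically small steps. Each point nearly minimises \<open>F\<close>
  plus the perturbations centred at its predecessors, and the tolerance \<open>s * (1/4)^n\<close>
  against the weight \<open>K * (1/2)^n\<close> yields such steps. The distance to \<open>z0\<close>
  is controlled by the first perturbation alone.\<close>

lemma Borwein_Preiss:
  fixes F :: "'z \<Rightarrow> real" and \<psi> :: "'z \<Rightarrow> 'z \<Rightarrow> real"
  assumes z0: "z0 \<in> Z" "F z0 \<le> s" and F: "\<And>z. z \<in> Z \<Longrightarrow> 0 \<le> F z" and s: "s > 0" and K: "K > 0"
    and psi: "\<And>y z. y \<in> Z \<Longrightarrow> z \<in> Z \<Longrightarrow> 0 \<le> \<psi> y z" "\<And>y z. y \<in> Z \<Longrightarrow> z \<in> Z \<Longrightarrow> \<psi> y z \<le> B"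
      "\<And>z. z \<in> Z \<Longrightarrow> \<psi> z z = 0"
    and complete: "\<And>u. (\<And>n. u n \<in> Z) \<Longrightarrow> (\<And>n. \<psi> (u (Suc n)) (u n) \<le> s / K * (1/2)^n) \<Longrightarrow>
      \<exists>z\<in>Z. (\<lambda>n. F (u n)) \<longlonglongrightarrow> F z \<and> (\<forall>k. (\<lambda>n. \<psi> (u n) (u k)) \<longlonglongrightarrow> \<psi> z (u k))"
  obtains z u where "z \<in> Z" "\<And>n. u n \<in> Z" "K * \<psi> z z0 \<le> s"
    "\<And>y. y \<in> Z \<Longrightarrow> F z + (suminf (\<lambda>n. K * (1/2)^n * \<psi> z (u n))) \<le> F y + (suminf (\<lambda>n. K * (1/2)^n * \<psi> y (u n)))"
proof -
  define P where "P n p \<longleftrightarrow> (case p of (G, z) \<Rightarrow> (n = 0 \<longrightarrow> G = F \<and> z = z0) \<and> z \<in> Z \<and>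
      (\<forall>y\<in>Z. 0 \<le> G y) \<and> (\<forall>y\<in>Z. G z \<le> G y + s * (1/4)^n))" for n and p :: "('z \<Rightarrow> real) \<times> 'z"
  define Q where "Q n p p' \<longleftrightarrow> (case p of (G, z) \<Rightarrow> case p' of (G', z') \<Rightarrow>
      G' = (\<lambda>y. G y + K * (1/2)^n * \<psi> y z) \<and> G' z' \<le> G' z)" for n and p p' :: "('z \<Rightarrow> real) \<times> 'z"
  have "\<exists>f. \<forall>n. P n (f n) \<and> Q n (f n) (f (Suc n))"
  proof (rule dependent_nat_choice)
    show "\<exists>p. P 0 p" using z0 F by (intro exI[of _ "(F, z0)"]) (force simp: P_def)
    fix p n assume "P n p"
    obtain G z where p: "p = (G, z)" by (cases p)
    define G' where "G' y = G y + K * (1/2)^n * \<psi> y z" for y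
    have z: "z \<in> Z" and G: "\<And>y. y \<in> Z \<Longrightarrow> 0 \<le> G y" using \<open>P n p\<close> by (auto simp: P_def p)
    have G': "0 \<le> G' y" if "y \<in> Z" for y using that G psi(1) z K by (simp add: G'_def)
    define I where "I = (INF y\<in>Z. G' y)"
    have bdd: "bdd_below (G' ` Z)" using G' by (auto simp: bdd_below_def)
    have "I < I + s * (1/4)^Suc n" using s by simp
    then obtain y where y: "y \<in> Z" "G' y < I + s * (1/4)^Suc n"
      unfolding I_def using cINF_less_iff[OF _ bdd] z by blast
    \<comment> \<open>The old point is kept if it is better. As the new perturbation vanishes at the
      old point (\<open>GSu\<close> below), the values \<open>G n (u n)\<close> never
      increase.\<close>
    define z' where "z' = (if G' y \<le> G' z then y else z)"
    have "z' \<in> Z" "G' z' \<le> G' z" "G' z' \<le> G' y" using y z by (auto simp: z'_def)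
    moreover have "G' z' \<le> G' x + s * (1/4)^Suc n" if "x \<in> Z" for x
      using cINF_lower[OF bdd that] y(2) \<open>G' z' \<le> G' y\<close> by (simp add: I_def)
    ultimately have "P (Suc n) (G', z')" "Q n p (G', z')" using G' by (auto simp: P_def Q_def p G'_def[abs_def])
    then show "\<exists>p'. P (Suc n) p' \<and> Q n p p'" by blast
  qed
  then obtain f where f: "\<And>n. P n (f n)" "\<And>n. Q n (f n) (f (Suc n))" by blast
  define u where "u n = snd (f n)" for n
  define G where "G n = fst (f n)" for n
  have G0: "G 0 = F" "u 0 = z0" using f(1)[of 0] by (auto simp: P_def G_def u_def split: prod.splits)
  have u: "u n \<in> Z" and Gn: "\<And>y. y \<in> Z \<Longrightarrow> G n (u n) \<le> G n y + s * (1/4)^n" for n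
    using f(1)[of n] by (auto simp: P_def G_def u_def split: prod.splits)
  have GS: "G (Suc n) y = G n y + K * (1/2)^n * \<psi> y (u n)" and Gd: "G (Suc n) (u (Suc n)) \<le> G (Suc n) (u n)" for n y
    using f(2)[of n] by (auto simp: Q_def G_def u_def split: prod.splits)
  have Gsum: "G n y = F y + (\<Sum>k<n. K * (1/2)^k * \<psi> y (u k))" for n y
    by (induction n) (auto simp: G0 GS)
  have GSu: "G (Suc n) (u n) = G n (u n)" for n using GS psi(3) u by simp
  have "\<psi> (u (Suc n)) (u n) \<le> s / K * (1/2)^n" for n
  proof -
    have "K * (1/2)^n * \<psi> (u (Suc n)) (u n) \<le> s * (1/4)^n"
      using Gd[of n] GS[of n "u (Suc n)"] GSu[of n] Gn[OF u, of n "Suc n"] by linarith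
    also have "s * (1/4)^n = (1/2)^n * (s * (1/2)^n)"
      by (simp add: power_mult_distrib[symmetric])
    finally have "(1/2)^n * (K * \<psi> (u (Suc n)) (u n)) \<le> (1/2)^n * (s * (1/2)^n)" by (simp add: mult_ac)
    then have "K * \<psi> (u (Suc n)) (u n) \<le> s * (1/2)^n" by simp
    then show ?thesis using K by (simp add: field_simps)
  qed
  then obtain z where z: "z \<in> Z" "(\<lambda>n. F (u n)) \<longlonglongrightarrow> F z" "\<And>k. (\<lambda>n. \<psi> (u n) (u k)) \<longlonglongrightarrow> \<psi> z (u k)"
    using complete[of u] u by blast
  have mono: "G m y \<le> G n y" if "m \<le> n" "y \<in> Z" for m n y
    unfolding Gsum using that K psi(1) u by (auto intro!: sum_mono2)
  have dec: "decseq (\<lambda>n. G n (u n))" by (intro decseq_SucI) (metis Gd GSu)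
  have summ: "summable (\<lambda>n. K * (1/2)^n * \<psi> y (u n))" if "y \<in> Z" for y
  proof (rule summable_comparison_test'[where g = "\<lambda>n. K * B * (1/2)^n"])
    show "summable (\<lambda>n. K * B * (1/2)^n)" by (intro summable_mult summable_geometric) simp
    show "norm (K * (1/2)^n * \<psi> y (u n)) \<le> K * B * (1/2)^n" for n
      using K psi(1)[OF that u[of n]] psi(2)[OF that u[of n]] by (simp add: abs_mult)
  qed
  define \<Phi> where "\<Phi> y = F y + (suminf (\<lambda>n. K * (1/2)^n * \<psi> y (u n)))" for y
  have G_\<Phi>: "G n y \<le> \<Phi> y" if "y \<in> Z" for n y
    unfolding Gsum \<Phi>_def using K psi(1)[OF that u] by (intro add_left_mono sum_le_suminf summ that) auto
  \<comment> \<open>The limit along \<open>u\<close> is taken in \<open>G m\<close> with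
    \<open>m\<close> fixed; only afterwards does \<open>m\<close> tend to infinity.\<close>
  have z_le: "\<Phi> z \<le> G n (u n)" for n
  proof -
    have "G m z \<le> G n (u n)" for m
    proof (rule LIMSEQ_le_const2)
      show "(\<lambda>k. G m (u k)) \<longlonglongrightarrow> G m z" unfolding Gsum by (intro tendsto_intros z)
      show "\<exists>N. \<forall>k\<ge>N. G m (u k) \<le> G n (u n)"
      proof (intro exI allI impI)
        fix k assume "k \<ge> max m n"
        then show "G m (u k) \<le> G n (u n)" using mono[of m k "u k"] u decseqD[OF dec, of n k] by simp
      qed
    qed
    then have "(\<Sum>k<m. K * (1/2)^k * \<psi> z (u k)) \<le> G n (u n) - F z" for m by (simp add: Gsum algebra_simps)
    then have "(suminf (\<lambda>k. K * (1/2)^k * \<psi> z (u k))) \<le> G n (u n) - F z" by (intro suminf_le_const summ z(1))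
    then show ?thesis by (simp add: \<Phi>_def)
  qed
  show thesis
  proof
    show "z \<in> Z" "u n \<in> Z" for n using z u by auto
    show "K * \<psi> z z0 \<le> s"
      using G_\<Phi>[OF z(1), of 1] z_le[of 0] G0 F[OF z(1)] z0(2) by (simp add: Gsum)
    fix y assume y: "y \<in> Z"
    have "\<Phi> z \<le> \<Phi> y"
    proof (rule LIMSEQ_le_const)
      show "(\<lambda>n. \<Phi> y + s * (1/4)^n) \<longlonglongrightarrow> \<Phi> y"
        using tendsto_add[OF tendsto_const tendsto_mult_right_zero[OF LIMSEQ_realpow_zero[of "1/4::real"]]] by simp
      show "\<exists>N. \<forall>n\<ge>N. \<Phi> z \<le> \<Phi> y + s * (1/4)^n"
        using z_le Gn[OF y] G_\<Phi>[OF y] by (intro exI allI impI) (meson add_right_mono order_trans)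
    qed
    then show "F z + (suminf (\<lambda>n. K * (1/2)^n * \<psi> z (u n))) \<le> F y + (suminf (\<lambda>n. K * (1/2)^n * \<psi> y (u n)))" by (simp add: \<Phi>_def)
  qed
qed

section \<open>Approximate multipliers on a separable subspace\<close>

lemma Cauchy_geometric:
  fixes u :: "nat \<Rightarrow> 'a::metric_space"
  assumes step: "\<And>n. dist (u (Suc n)) (u n) \<le> C * r ^ n" and r: "0 \<le> r" "r < 1"
  shows "Cauchy u"
proof -
  have C: "0 \<le> C" using order_trans[OF zero_le_dist step[of 0]] by simp
  have bound: "dist (u (n + k)) (u n) \<le> C / (1 - r) * r ^ n" for n k
  proof -
    have "dist (u (n + k)) (u n) \<le> (\<Sum>j<k. C * r ^ (n + j))"
    proof (induction k)
      case (Suc k)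
      then show ?case using dist_triangle[of "u (n + Suc k)" "u n" "u (n + k)"] step[of "n + k"] by simp
    qed simp
    also have "\<dots> = C * r ^ n * (\<Sum>j<k. r ^ j)" by (simp add: sum_distrib_left power_add mult_ac)
    also have "(\<Sum>j<k. r ^ j) \<le> (suminf (\<lambda>j. r ^ j))"
      by (rule sum_le_suminf) (use r in auto)
    also have "(suminf (\<lambda>j. r ^ j)) = 1 / (1 - r)" using r by (simp add: suminf_geometric)
    finally show ?thesis using C r by (simp add: mult_left_mono)
  qed
  have lim: "(\<lambda>n. C / (1 - r) * r ^ n) \<longlonglongrightarrow> 0"
    using r by (intro tendsto_mult_right_zero LIMSEQ_realpow_zero)
  show ?thesis
  proof (rule metric_CauchyI)
    fix e :: real assume "e > 0"
    then have "\<forall>\<^sub>F n in sequentially. C / (1 - r) * r ^ n < e / 2" by (intro order_tendstoD(2)[OF lim]) simp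
    then obtain M where M: "C / (1 - r) * r ^ M < e / 2" by (auto simp: eventually_sequentially)
    have "dist (u m) (u n) < e" if "m \<ge> M" "n \<ge> M" for m n
    proof -
      have "dist (u m) (u M) < e / 2" "dist (u n) (u M) < e / 2"
        using order.strict_trans1[OF bound M, of "m - M"] order.strict_trans1[OF bound M, of "n - M"] that by simp_all
      then show ?thesis using dist_triangle2[of "u m" "u n" "u M"] by linarith
    qed
    then show "\<exists>M. \<forall>m\<ge>M. \<forall>n\<ge>M. dist (u m) (u n) < e" by blast
  qed
qed

text \<open>Concavity: the graph lies below its tangent. First-order upper estimates for a sum of
  squares thus pass to its root.\<close>

lemma sqrt_le_tangent:
  assumes "b > 0" "c \<ge> 0" shows "sqrt c \<le> sqrt b + (c - b) / (2 * sqrt b)"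
proof -
  have b: "sqrt b > 0" using assms by simp
  have "0 \<le> (sqrt c - sqrt b)\<^sup>2" by simp
  then have "2 * sqrt b * sqrt c \<le> b + c" using assms by (simp add: power2_eq_square algebra_simps)
  then have "sqrt c \<le> (b + c) / (2 * sqrt b)" using b by (simp add: field_simps)
  also have "\<dots> = sqrt b + (c - b) / (2 * sqrt b)"
    using b assms by (simp add: field_simps)
  finally show ?thesis .
qed

text \<open>The squared positive part is differentiable, with derivative \<open>2 * max 0 b\<close>
  and a quadratic remainder.\<close>

lemma pos_part_square_le: "(max 0 (b + c))\<^sup>2 \<le> (max 0 b)\<^sup>2 + 2 * max 0 b * c + c\<^sup>2" for b c :: real
proof (cases "b \<ge> 0")
  case True
  have "(max 0 (b + c))\<^sup>2 \<le> (b + c)\<^sup>2" by (cases "b + c \<ge> 0") (auto simp: max_def)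
  then show ?thesis using True by (simp add: max_def power2_eq_square algebra_simps)
next
  case False
  then have "max 0 (b + c) \<le> max 0 c" by auto
  then have "(max 0 (b + c))\<^sup>2 \<le> (max 0 c)\<^sup>2" by (intro power_mono) auto
  also have "\<dots> \<le> c\<^sup>2" by (auto simp: max_def)
  finally show ?thesis using False by (simp add: max_def)
qed

text \<open>Varying \<open>y i\<close> in its set yields the normal inequality for
  \<open>g i\<close>; varying the free point in all directions of \<open>Y\<close> yields an
  equation for the sum. Each of the \<open>m + 1\<close> variables adds a perturbation derivative of
  norm at most \<open>\<kappa>\<close>. The pair \<open>v i\<close>, \<open>\<tau> i\<close>
  certifies that the norm of \<open>g i\<close> is at least about \<open>\<tau> i / 2\<close>, which
  carries the normalisation over to the multipliers.\<close>

lemma (in smooth_square) approximate_multipliers: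
  fixes \<Omega> :: "nat \<Rightarrow> 'a set" and f :: "'a \<Rightarrow> real"
  assumes "complete Y" and xY: "xbar \<in> Y" and x\<Omega>: "\<And>i. i < m \<Longrightarrow> xbar \<in> \<Omega> i"
    and cl: "\<And>i. i < m \<Longrightarrow> closed (\<Omega> i \<inter> cball xbar \<rho>)"
    and f: "bounded_linear f" and s: "s > 0" and \<rho>: "\<rho> > 0"
    and sep: "\<And>x. x \<in> cball xbar \<rho> \<Longrightarrow> (\<And>i. i < m \<Longrightarrow> x \<in> \<Omega> i) \<Longrightarrow> f (x - xbar) < s"
  defines "\<kappa> \<equiv> 64 * s / \<rho>"
  obtains y g l v \<tau> where
    "\<And>i. i < m \<Longrightarrow> y i \<in> \<Omega> i \<and> y i \<in> Y \<and> norm (y i - xbar) \<le> \<rho> / 2"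
    "\<And>i. i < m \<Longrightarrow> g i \<in> dual_on Y"
    "\<And>i h. i < m \<Longrightarrow> h \<in> Y \<Longrightarrow> \<bar>g i h\<bar> \<le> (1 + \<kappa>) * norm h"
    "\<And>i e. i < m \<Longrightarrow> e > 0 \<Longrightarrow> \<exists>d>0. \<forall>u\<in>\<Omega> i \<inter> Y. norm (u - y i) < d \<longrightarrow> g i (u - y i) \<le> e * norm (u - y i)"
    "l \<ge> 0" "\<And>h. h \<in> Y \<Longrightarrow> \<bar>(\<Sum>i<m. g i h) - l * f h\<bar> \<le> (real m + 1) * \<kappa> * norm h"
    "\<And>i. i < m \<Longrightarrow> v i \<in> Y \<and> norm (v i) \<le> 2 * \<tau> i \<and> 0 \<le> \<tau> i \<and> (\<tau> i)\<^sup>2 - 2 * \<kappa> * \<tau> i \<le> g i (v i)"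
    "l\<^sup>2 + (\<Sum>i<m. (\<tau> i)\<^sup>2) = (1::real)"
proof -
  \<comment> \<open>A tuple \<open>z\<close> stores the points of the sets at the indices below \<open>m\<close> and the free point at \<open>m\<close>.\<close>
  define Z where "Z = {z. (\<forall>i\<le>m. z i \<in> Y \<inter> cball xbar \<rho>) \<and> (\<forall>i<m. z i \<in> \<Omega> i)}"
  define \<psi> where "\<psi> y z = (\<Sum>i\<le>m. \<theta> (y i - z i))" for y z :: "nat \<Rightarrow> 'a"
  define a where "a x = max 0 (s - f (x - xbar))" for x
  define G where "G z = (a (z m))\<^sup>2 + (\<Sum>i<m. \<theta> (z m - z i))" for z :: "nat \<Rightarrow> 'a"
  define F where "F z = sqrt (G z)" for z
  \<comment> \<open>With this \<open>K\<close>, the bound \<open>K * \<psi> z z0 \<le> s\<close> and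
    \<open>lower\<close> keep the minimiser within \<open>\<rho> / 2\<close> of \<open>xbar\<close>.
    The weights add up to \<open>2 * K\<close> and differences in the ball have norm at most
    \<open>2 * \<rho>\<close>; the product of these bounds is \<open>\<kappa>\<close>.\<close>
  define K where "K = 16 * s / \<rho>\<^sup>2"
  have K: "K > 0" using s \<rho> by (simp add: K_def)
  have ZY: "z i \<in> Y" "z i \<in> cball xbar \<rho>" if "z \<in> Z" "i \<le> m" for z i using that by (auto simp: Z_def)
  have Zdiff: "y i - z j \<in> Y" "norm (y i - z j) \<le> 2 * \<rho>" if "y \<in> Z" "z \<in> Z" "i \<le> m" "j \<le> m" for y z i j
  proof -
    show "y i - z j \<in> Y" using ZY that by (intro subspace_diff[OF Y]) auto
    have "dist xbar (y i) \<le> \<rho>" "dist xbar (z j) \<le> \<rho>" using ZY(2) that by (auto simp: mem_cball)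
    then show "norm (y i - z j) \<le> 2 * \<rho>" using dist_triangle3[of "y i" "z j" xbar] by (simp add: dist_norm)
  qed
  have \<theta>_bd: "0 \<le> \<theta> (y i - z j)" "\<theta> (y i - z j) \<le> 2 * \<rho>\<^sup>2" if "y \<in> Z" "z \<in> Z" "i \<le> m" "j \<le> m" for y z i j
    using nonneg[OF Zdiff(1)[OF that]] upper[OF Zdiff(1)[OF that]] power_mono[OF Zdiff(2)[OF that], of 2]
    by (simp_all add: power_mult_distrib)
  have G_nonneg: "0 \<le> G z" if "z \<in> Z" for z
    unfolding G_def using \<theta>_bd(1)[OF that that] by (intro add_nonneg_nonneg sum_nonneg) auto
  define z0 where "z0 = (\<lambda>_::nat. xbar)"
  have z0: "z0 \<in> Z" "F z0 \<le> s"
    using xY x\<Omega> \<rho> s by (auto simp: Z_def z0_def F_def G_def a_def zero linear_0[OF bounded_linear.linear[OF f]])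
  have complete: "\<exists>z\<in>Z. (\<lambda>n. F (u n)) \<longlonglongrightarrow> F z \<and> (\<forall>k. (\<lambda>n. \<psi> (u n) (u k)) \<longlonglongrightarrow> \<psi> z (u k))"
    if u: "\<And>n. u n \<in> Z" and step: "\<And>n. \<psi> (u (Suc n)) (u n) \<le> s / K * (1/2)^n" for u
  proof -
    have conv: "\<exists>l\<in>Y. (\<lambda>n. u n i) \<longlonglongrightarrow> l" if i: "i \<le> m" for i
    proof -
      have "dist (u (Suc n) i) (u n i) \<le> sqrt (4 * s / K) * sqrt (1/2) ^ n" for n
      proof -
        have "(norm (u (Suc n) i - u n i))\<^sup>2 / 4 \<le> \<theta> (u (Suc n) i - u n i)" by (rule lower[OF Zdiff(1)[OF u u i i]])
        also have "\<dots> \<le> \<psi> (u (Suc n)) (u n)" unfolding \<psi>_def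
          by (rule member_le_sum) (use i \<theta>_bd(1)[OF u u] in auto)
        also have "\<dots> \<le> s / K * (1/2)^n" by (rule step)
        finally have "(norm (u (Suc n) i - u n i))\<^sup>2 \<le> 4 * s / K * (1/2)^n" by (simp add: field_simps)
        then have "norm (u (Suc n) i - u n i) \<le> sqrt (4 * s / K * (1/2)^n)" by (rule real_le_rsqrt)
        then show ?thesis unfolding dist_norm real_sqrt_mult real_sqrt_power .
      qed
      moreover have "sqrt (1/2) < sqrt 1" by (subst real_sqrt_less_iff) simp
      ultimately have "Cauchy (\<lambda>n. u n i)" by (intro Cauchy_geometric[of "\<lambda>n. u n i"]) auto
      then show ?thesis using \<open>complete Y\<close>[unfolded complete_def, rule_format, of "\<lambda>n. u n i"] ZY(1)[OF u i] by blast
    qed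
    define z where "z i = (SOME l. l \<in> Y \<and> (\<lambda>n. u n i) \<longlonglongrightarrow> l)" for i
    have z: "z i \<in> Y" "(\<lambda>n. u n i) \<longlonglongrightarrow> z i" if "i \<le> m" for i
      using someI_ex[of "\<lambda>l. l \<in> Y \<and> (\<lambda>n. u n i) \<longlonglongrightarrow> l"] conv[OF that] unfolding z_def by blast+
    have "z \<in> Z" unfolding Z_def
    proof (intro CollectI conjI allI impI)
      show "z i \<in> Y \<inter> cball xbar \<rho>" if "i \<le> m" for i
        using z(1)[OF that] closed_sequentially[OF closed_cball _ z(2)[OF that]] ZY(2)[OF u that] by blast
      show "z i \<in> \<Omega> i" if "i < m" for i
        using closed_sequentially[OF cl[OF that] _ z(2)] u that ZY(2)[OF u, of i] by (auto simp: Z_def)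
    qed
    moreover have "(\<lambda>n. F (u n)) \<longlonglongrightarrow> F z"
      unfolding F_def G_def a_def using Zdiff(1)[OF u u] Zdiff(1)[OF \<open>z \<in> Z\<close> \<open>z \<in> Z\<close>]
      by (intro tendsto_intros tendsto bounded_linear.tendsto[OF f] z) auto
    moreover have "(\<lambda>n. \<psi> (u n) (u k)) \<longlonglongrightarrow> \<psi> z (u k)" for k
      unfolding \<psi>_def using Zdiff(1)[OF u u] Zdiff(1)[OF \<open>z \<in> Z\<close> u]
      by (intro tendsto_intros tendsto z) auto
    ultimately show ?thesis by blast
  qed
  obtain z u where z: "z \<in> Z" and u: "\<And>n. u n \<in> Z" and z_z0: "K * \<psi> z z0 \<le> s"
    and min: "\<And>y. y \<in> Z \<Longrightarrow> F z + (suminf (\<lambda>n. K * (1/2)^n * \<psi> z (u n))) \<le> F y + (suminf (\<lambda>n. K * (1/2)^n * \<psi> y (u n)))"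
  proof (rule Borwein_Preiss[of z0 Z F s K \<psi> "(real m + 1) * (2 * \<rho>\<^sup>2)"])
    show "0 \<le> F z" if "z \<in> Z" for z using G_nonneg[OF that] by (simp add: F_def)
    show "0 \<le> \<psi> y z" if "y \<in> Z" "z \<in> Z" for y z
      unfolding \<psi>_def by (intro sum_nonneg \<theta>_bd that) auto
    show "\<psi> y z \<le> (real m + 1) * (2 * \<rho>\<^sup>2)" if "y \<in> Z" "z \<in> Z" for y z
      unfolding \<psi>_def using sum_bounded_above[of "{..m}" "\<lambda>i. \<theta> (y i - z i)" "2 * \<rho>\<^sup>2"] \<theta>_bd(2)[OF that] by (simp add: add.commute)
    show "\<psi> z z = 0" for z by (simp add: \<psi>_def zero)
  qed (use z0 s K complete in blast)+
  define \<mu> where "\<mu> n = K * (1/2)^n" for n :: nat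
  have mu: "0 \<le> \<mu> n" for n using K by (simp add: \<mu>_def)
  have mu_sum: "summable \<mu>" "suminf \<mu> = 2 * K"
    unfolding \<mu>_def using suminf_mult[of "\<lambda>n. (1/2::real)^n" K] suminf_geometric[of "1/2::real"]
    by (auto intro!: summable_mult summable_geometric)
  define E where "E i x = (suminf (\<lambda>n. \<mu> n * \<theta> (x - u n i)))" for i x
  have E_sum: "(suminf (\<lambda>n. K * (1/2)^n * \<psi> y (u n))) = (\<Sum>i\<le>m. E i (y i))" if y: "y \<in> Z" for y
  proof -
    have "summable (\<lambda>n. \<mu> n * \<theta> (y i - u n i))" if "i \<le> m" for i
    proof (rule summable_comparison_test'[OF summable_mult2[OF mu_sum(1), of "2 * \<rho>\<^sup>2"]])
      show "norm (\<mu> n * \<theta> (y i - u n i)) \<le> \<mu> n * (2 * \<rho>\<^sup>2)" for n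
        using \<theta>_bd[OF y u that that] mu[of n] by (simp add: abs_mult mult_left_mono)
    qed
    then show ?thesis unfolding E_def \<psi>_def \<mu>_def[symmetric] sum_distrib_left
      by (intro suminf_sum) auto
  qed
  \<comment> \<open>Half the radius leaves room to vary every variable without leaving the ball, and
    thus \<open>Z\<close>.\<close>
  have near: "norm (z i - xbar) \<le> \<rho> / 2" if "i \<le> m" for i
  proof -
    have "\<theta> (z i - xbar) \<le> \<psi> z z0" unfolding \<psi>_def z0_def
      by (rule member_le_sum) (use that \<theta>_bd(1)[OF z z0(1)] in \<open>auto simp: z0_def\<close>)
    moreover have "(norm (z i - xbar))\<^sup>2 / 4 \<le> \<theta> (z i - xbar)"
      by (rule lower) (use Zdiff(1)[OF z z0(1) that that] in \<open>simp add: z0_def\<close>)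
    moreover have "\<psi> z z0 \<le> s / K" using z_z0 K by (simp add: field_simps)
    moreover have "s / K = (\<rho> / 2)\<^sup>2 / 4" using s \<rho> by (simp add: K_def power2_eq_square)
    ultimately have "(norm (z i - xbar))\<^sup>2 \<le> (\<rho> / 2)\<^sup>2" by linarith
    then show ?thesis using \<rho> by (intro power2_le_imp_le[of "norm (z i - xbar)"]) auto
  qed
  \<comment> \<open>At a zero all points would coincide in a common point of the sets that violates
    \<open>sep\<close>. Positivity makes the root differentiable at \<open>G z\<close>.\<close>
  have "G z \<noteq> 0"
  proof
    assume "G z = 0"
    moreover have "0 \<le> (\<Sum>i<m. \<theta> (z m - z i))" using \<theta>_bd(1)[OF z z] by (intro sum_nonneg) auto
    moreover have "0 \<le> (a (z m))\<^sup>2" by simp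
    ultimately have "(\<Sum>i<m. \<theta> (z m - z i)) = 0" "(a (z m))\<^sup>2 = 0" unfolding G_def by linarith+
    then have 0: "(\<Sum>i<m. \<theta> (z m - z i)) = 0" "a (z m) = 0" by simp_all
    have "z m = z i" if "i < m" for i
    proof -
      have "\<theta> (z m - z i) = 0" using 0(1) that \<theta>_bd(1)[OF z z] by (subst (asm) sum_nonneg_eq_0_iff) auto
      then show ?thesis using lower[OF Zdiff(1)[OF z z, of m i]] that by simp
    qed
    then have "f (z m - xbar) < s" using z by (intro sep) (force simp: Z_def)+
    then show False using 0(2) by (simp add: a_def)
  qed
  then have Gpos: "G z > 0" using G_nonneg[OF z] by simp
  define \<phi> where "\<phi> = F z"
  have \<phi>: "\<phi> > 0" "\<phi>\<^sup>2 = G z" using Gpos by (auto simp: \<phi>_def F_def)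
  have F_le: "F y \<le> \<phi> + (G y - G z) / (2 * \<phi>)" if "y \<in> Z" for y
    using sqrt_le_tangent[OF Gpos G_nonneg[OF that]] by (simp add: \<phi>_def F_def)
  have "\<forall>i. \<exists>e. i \<le> m \<longrightarrow> e \<in> dual_on Y \<and> (\<forall>h\<in>Y. \<bar>e h\<bar> \<le> \<kappa> * norm h) \<and>
      (\<forall>r>0. \<exists>d>0. \<forall>h\<in>Y. norm h < d \<longrightarrow> E i (z i + h) \<le> E i (z i) + e h + r * norm h)"
  proof (rule allI)
    fix i
    show "\<exists>e. i \<le> m \<longrightarrow> e \<in> dual_on Y \<and> (\<forall>h\<in>Y. \<bar>e h\<bar> \<le> \<kappa> * norm h) \<and>
      (\<forall>r>0. \<exists>d>0. \<forall>h\<in>Y. norm h < d \<longrightarrow> E i (z i + h) \<le> E i (z i) + e h + r * norm h)"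
    proof (cases "i \<le> m")
      case True
      have "suminf \<mu> * (2 * \<rho>) = \<kappa>" using \<rho> by (simp add: mu_sum K_def \<kappa>_def power2_eq_square)
      obtain e where "e \<in> dual_on Y" "\<And>h. h \<in> Y \<Longrightarrow> \<bar>e h\<bar> \<le> suminf \<mu> * (2 * \<rho>) * norm h"
        "\<And>r. r > 0 \<Longrightarrow> \<exists>d>0. \<forall>h\<in>Y. norm h < d \<longrightarrow>
          (suminf (\<lambda>n. \<mu> n * \<theta> (z i + h - u n i))) \<le> (suminf (\<lambda>n. \<mu> n * \<theta> (z i - u n i))) + e h + r * norm h"
        by (rule series_derivative[where v = "\<lambda>n. u n i", OF ZY(1)[OF z True] ZY(1)[OF u True] Zdiff(2)[OF z u True True] mu mu_sum(1)])
          (erule that, blast+)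
      then show ?thesis unfolding E_def \<open>suminf \<mu> * (2 * \<rho>) = \<kappa>\<close> by (intro exI[of _ e]) simp
    qed simp
  qed
  from choice[OF this] obtain e where "\<forall>i. i \<le> m \<longrightarrow> e i \<in> dual_on Y \<and> (\<forall>h\<in>Y. \<bar>e i h\<bar> \<le> \<kappa> * norm h) \<and>
      (\<forall>r>0. \<exists>d>0. \<forall>h\<in>Y. norm h < d \<longrightarrow> E i (z i + h) \<le> E i (z i) + e i h + r * norm h)" ..
  then have e: "e i \<in> dual_on Y" "\<And>h. h \<in> Y \<Longrightarrow> \<bar>e i h\<bar> \<le> \<kappa> * norm h"
    "\<And>r. r > 0 \<Longrightarrow> \<exists>d>0. \<forall>h\<in>Y. norm h < d \<longrightarrow> E i (z i + h) \<le> E i (z i) + e i h + r * norm h"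
    if "i \<le> m" for i using that by simp_all
  define w where "w i = z m - z i" for i
  have wY: "w i \<in> Y" if "i \<le> m" for i using Zdiff(1)[OF z z _ that, of m] by (simp add: w_def)
  have "\<forall>i. \<exists>g. i < m \<longrightarrow> g \<in> dual_on Y \<and> g (w i) = 2 * \<theta> (w i) \<and> (\<forall>h\<in>Y. \<bar>g h\<bar> \<le> sqrt (2 * \<theta> (w i)) * norm h) \<and>
      (\<forall>e>0. \<exists>d>0. \<forall>h\<in>Y. norm h < d \<longrightarrow> \<theta> (w i + h) \<le> \<theta> (w i) + g h + e * norm h)"
  proof (rule allI)
    fix i
    show "\<exists>g. i < m \<longrightarrow> g \<in> dual_on Y \<and> g (w i) = 2 * \<theta> (w i) \<and> (\<forall>h\<in>Y. \<bar>g h\<bar> \<le> sqrt (2 * \<theta> (w i)) * norm h) \<and>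
      (\<forall>e>0. \<exists>d>0. \<forall>h\<in>Y. norm h < d \<longrightarrow> \<theta> (w i + h) \<le> \<theta> (w i) + g h + e * norm h)"
    proof (cases "i < m")
      case True
      then show ?thesis using derivative[OF wY[of i]] by (simp only: Bex_def simp_thms less_imp_le)
    qed simp
  qed
  from choice[OF this] obtain D where "\<forall>i. i < m \<longrightarrow> D i \<in> dual_on Y \<and> D i (w i) = 2 * \<theta> (w i) \<and> (\<forall>h\<in>Y. \<bar>D i h\<bar> \<le> sqrt (2 * \<theta> (w i)) * norm h) \<and>
      (\<forall>e>0. \<exists>d>0. \<forall>h\<in>Y. norm h < d \<longrightarrow> \<theta> (w i + h) \<le> \<theta> (w i) + D i h + e * norm h)" ..
  then have D: "D i \<in> dual_on Y" "D i (w i) = 2 * \<theta> (w i)" "\<And>h. h \<in> Y \<Longrightarrow> \<bar>D i h\<bar> \<le> sqrt (2 * \<theta> (w i)) * norm h"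
    "\<And>e. e > 0 \<Longrightarrow> \<exists>d>0. \<forall>h\<in>Y. norm h < d \<longrightarrow> \<theta> (w i + h) \<le> \<theta> (w i) + D i h + e * norm h"
    if "i < m" for i using that by simp_all
  \<comment> \<open>The negative of the derivative of the perturbed objective in variable
    \<open>i\<close>, which enters \<open>G\<close> as \<open>z m - x\<close>; the divisor
    \<open>2 * \<phi>\<close> comes from the root.\<close>
  define g where "g i = restrict (\<lambda>h. D i h / (2 * \<phi>) - e i h) Y" for i
  have \<theta>w: "0 \<le> \<theta> (w i)" "\<theta> (w i) \<le> \<phi>\<^sup>2" if "i < m" for i
  proof -
    show "0 \<le> \<theta> (w i)" using that by (intro nonneg wY) simp
    have "\<theta> (w i) \<le> (\<Sum>i<m. \<theta> (w i))" by (rule member_le_sum) (use that nonneg wY in auto)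
    then show "\<theta> (w i) \<le> \<phi>\<^sup>2" unfolding \<phi> G_def w_def by (simp add: add_increasing)
  qed
  have g_bd: "\<bar>D i h / (2 * \<phi>) - e i h\<bar> \<le> (1 + \<kappa>) * norm h" if i: "i < m" and h: "h \<in> Y" for i h
  proof -
    have "2 * \<theta> (w i) \<le> (2 * \<phi>)\<^sup>2" using \<theta>w[OF i] by (simp add: power_mult_distrib)
    then have "sqrt (2 * \<theta> (w i)) \<le> 2 * \<phi>" using \<phi>(1) by (intro real_le_lsqrt) auto
    then have "\<bar>D i h\<bar> \<le> 2 * \<phi> * norm h" using D(3)[OF i h] mult_right_mono[OF _ norm_ge_zero[of h]] order_trans by blast
    then have "\<bar>D i h / (2 * \<phi>)\<bar> \<le> norm h" using \<phi>(1) by (simp add: field_simps)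
    moreover have "\<bar>e i h\<bar> \<le> \<kappa> * norm h" using e(2)[OF _ h, of i] i by simp
    ultimately show ?thesis unfolding distrib_right mult_1 by linarith
  qed
  have gY: "g i \<in> dual_on Y" if i: "i < m" for i
    unfolding g_def
  proof (rule dual_onI[where K = "1 + \<kappa>"])
    have i': "i \<le> m" using i by simp
    show "D i (x + y) / (2 * \<phi>) - e i (x + y) = D i x / (2 * \<phi>) - e i x + (D i y / (2 * \<phi>) - e i y)" if "x \<in> Y" "y \<in> Y" for x y
      by (simp add: dual_on_add[OF D(1)[OF i] that] dual_on_add[OF e(1)[OF i'] that] add_divide_distrib)
    show "D i (c *\<^sub>R x) / (2 * \<phi>) - e i (c *\<^sub>R x) = c * (D i x / (2 * \<phi>) - e i x)" if "x \<in> Y" for c x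
      by (simp add: dual_on_scale[OF D(1)[OF i] that] dual_on_scale[OF e(1)[OF i'] that] algebra_simps)
  qed (use g_bd[OF i] Y in auto)
  have vary: "\<phi> + E i (z i) \<le> F (z(i := x)) + E i x" if "i \<le> m" "z(i := x) \<in> Z" for i x
  proof -
    have "(\<Sum>j\<le>m. E j ((z(i := x)) j)) = E i x + (\<Sum>j\<in>{..m} - {i}. E j (z j))"
      using that(1) by (subst sum.remove[of _ i]) auto
    moreover have "(\<Sum>j\<le>m. E j (z j)) = E i (z i) + (\<Sum>j\<in>{..m} - {i}. E j (z j))"
      using that(1) by (subst sum.remove[of _ i]) auto
    ultimately show ?thesis
      using min[OF that(2)] unfolding E_sum[OF that(2)] E_sum[OF z] \<phi>_def by simp
  qed
  have normal: "\<exists>d>0. \<forall>x\<in>\<Omega> i \<inter> Y. norm (x - z i) < d \<longrightarrow> g i (x - z i) \<le> r * norm (x - z i)"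
    if i: "i < m" and r: "r > 0" for i r
  proof -
    have i': "i \<le> m" using i by simp
    obtain d1 where d1: "d1 > 0" "\<And>h. h \<in> Y \<Longrightarrow> norm h < d1 \<Longrightarrow> \<theta> (w i + h) \<le> \<theta> (w i) + D i h + r * \<phi> * norm h"
      using D(4)[OF i, of "r * \<phi>"] r \<phi>(1) by auto
    obtain d2 where d2: "d2 > 0" "\<And>h. h \<in> Y \<Longrightarrow> norm h < d2 \<Longrightarrow> E i (z i + h) \<le> E i (z i) + e i h + r / 2 * norm h"
      using e(3)[OF i', of "r / 2"] r by auto
    define d where "d = min (min d1 d2) (\<rho> / 2)"
    have "g i (x - z i) \<le> r * norm (x - z i)" if x: "x \<in> \<Omega> i" "x \<in> Y" "norm (x - z i) < d" for x
    proof -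
      define h where "h = x - z i"
      have h: "h \<in> Y" "norm h < d1" "norm h < d2" "norm h < \<rho> / 2" "- h \<in> Y" "x = z i + h"
        using x ZY(1)[OF z i'] Y by (auto simp: h_def d_def subspace_diff intro: subspace_diff)
      have "dist xbar x \<le> norm h + norm (z i - xbar)"
        using norm_triangle_ineq[of h "z i - xbar"] by (simp add: h_def dist_norm norm_minus_commute)
      then have "x \<in> cball xbar \<rho>" using near[OF i'] h(4) by simp
      then have zx: "z(i := x) \<in> Z" using z x i by (auto simp: Z_def)
      have "G (z(i := x)) - G z = \<theta> (w i + - h) - \<theta> (w i)"
      proof -
        have "(\<Sum>j<m. \<theta> (z m - (z(i := x)) j)) = \<theta> (z m - x) + (\<Sum>j\<in>{..<m} - {i}. \<theta> (z m - z j))"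
          using i by (subst sum.remove[of _ i]) auto
        moreover have "(\<Sum>j<m. \<theta> (z m - z j)) = \<theta> (z m - z i) + (\<Sum>j\<in>{..<m} - {i}. \<theta> (z m - z j))"
          using i by (subst sum.remove[of _ i]) auto
        ultimately show ?thesis using i by (simp add: G_def w_def h_def)
      qed
      also have "\<dots> \<le> - D i h + r * \<phi> * norm h"
        using d1(2)[OF h(5)] h(2) dual_on_scale[OF D(1)[OF i] h(1), of "-1"] by simp
      finally have "F (z(i := x)) \<le> \<phi> + (- D i h + r * \<phi> * norm h) / (2 * \<phi>)"
        using F_le[OF zx] \<phi>(1) divide_right_mono[of "G (z(i := x)) - G z" _ "2 * \<phi>"] by (smt (verit))
      also have "\<dots> = \<phi> - D i h / (2 * \<phi>) + r / 2 * norm h" using \<phi>(1) by (simp add: field_simps)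
      finally have "D i h / (2 * \<phi>) - e i h \<le> r * norm h"
        using vary[OF i' zx] d2(2)[OF h(1,3)] h(6) by simp
      then show ?thesis using h(1) by (simp add: g_def h_def)
    qed
    moreover have "d > 0" using d1 d2 \<rho> by (simp add: d_def)
    ultimately show ?thesis by blast
  qed
  \<comment> \<open>The derivative of \<open>(a x)\<^sup>2\<close> is \<open>- 2 * a x\<close> times
    \<open>f\<close>, and \<open>2 * \<phi>\<close> divides it. \<open>L\<close> is the derivative
    of the perturbed objective in the free variable.\<close>
  define l where "l = a (z m) / \<phi>"
  define L where "L h = (\<Sum>i<m. D i h) / (2 * \<phi>) - l * f h + e m h" for h
  obtain Kf where Kf: "Kf > 0" "\<And>x. norm (f x) \<le> norm x * Kf" using bounded_linear.pos_bounded[OF f] by blast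
  have fl: "f (x + y) = f x + f y" "f (c *\<^sub>R x) = c * f x" for x y c
    using bounded_linear.linear[OF f] by (auto simp: linear_add linear_scale)
  have L_scale: "L (c *\<^sub>R h) = c * L h" if "h \<in> Y" for c h
    using dual_on_scale[OF D(1) that] dual_on_scale[OF e(1)[of m] that]
    by (simp add: L_def fl sum_distrib_left[symmetric] algebra_simps)
  have L_lower: "\<exists>d>0. \<forall>h\<in>Y. norm h < d \<longrightarrow> - r * norm h \<le> L h" if r: "r > 0" for r
  proof -
    \<comment> \<open>One share for each of the \<open>m\<close> derivatives and one for the
      remainder of the squared positive part. After division by \<open>2 * \<phi>\<close> they use
      half of \<open>r\<close>; \<open>E m\<close> uses the other half.\<close>
    define r1 where "r1 = r * \<phi> / (real m + 1)"
    have r1: "r1 > 0" "(real m + 1) * r1 = r * \<phi>" using r \<phi>(1) by (auto simp: r1_def)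
    have "\<exists>d. \<forall>i<m. d i > 0 \<and> (\<forall>h\<in>Y. norm h < d i \<longrightarrow> \<theta> (w i + h) \<le> \<theta> (w i) + D i h + r1 * norm h)"
      using D(4)[OF _ r1(1)] by metis
    then obtain d1 where d1: "\<And>i. i < m \<Longrightarrow> d1 i > 0"
      "\<And>i h. i < m \<Longrightarrow> h \<in> Y \<Longrightarrow> norm h < d1 i \<Longrightarrow> \<theta> (w i + h) \<le> \<theta> (w i) + D i h + r1 * norm h" by blast
    obtain d2 where d2: "d2 > 0" "\<And>h. h \<in> Y \<Longrightarrow> norm h < d2 \<Longrightarrow> E m (z m + h) \<le> E m (z m) + e m h + r / 2 * norm h"
      using e(3)[OF order_refl, of "r / 2"] r by auto
    \<comment> \<open>The entry \<open>r1 / Kf\<^sup>2\<close> makes \<open>(f h)\<^sup>2\<close> at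
      most \<open>r1 * norm h\<close>.\<close>
    define d where "d = Min (insert d2 (insert (\<rho> / 2) (insert (r1 / Kf\<^sup>2) (d1 ` {..<m}))))"
    have d: "d > 0" "d \<le> d2" "d \<le> \<rho> / 2" "d \<le> r1 / Kf\<^sup>2" "\<And>i. i < m \<Longrightarrow> d \<le> d1 i"
    proof -
      let ?S = "insert d2 (insert (\<rho> / 2) (insert (r1 / Kf\<^sup>2) (d1 ` {..<m})))"
      have fin: "finite ?S" by simp
      have "\<forall>x\<in>?S. 0 < x" using d1(1) d2(1) \<rho> r1 Kf(1) by auto
      then show "d > 0" unfolding d_def using Min_in[OF fin] by blast
      show "d \<le> d2" "d \<le> \<rho> / 2" "d \<le> r1 / Kf\<^sup>2" unfolding d_def by (rule Min_le[OF fin], blast)+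
      show "d \<le> d1 i" if "i < m" for i unfolding d_def by (rule Min_le[OF fin]) (use that in blast)
    qed
    have "- r * norm h \<le> L h" if h: "h \<in> Y" "norm h < d" for h
    proof -
      define x where "x = z m + h"
      have xY: "x \<in> Y" using ZY(1)[OF z order_refl] h Y by (simp add: x_def subspace_add)
      have "dist xbar x \<le> norm h + norm (z m - xbar)"
        using norm_triangle_ineq[of h "z m - xbar"] by (simp add: x_def dist_norm norm_minus_commute algebra_simps)
      then have "x \<in> cball xbar \<rho>" using near[OF order_refl] h(2) d(3) by simp
      then have zx: "z(m := x) \<in> Z" using z xY by (auto simp: Z_def)
      have "(a x)\<^sup>2 \<le> (a (z m))\<^sup>2 + 2 * a (z m) * (- f h) + (- f h)\<^sup>2"
        using pos_part_square_le[of "s - f (z m - xbar)" "- f h"] fl(1)[of "z m - xbar" h]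
        by (simp add: a_def x_def algebra_simps)
      moreover have "(- f h)\<^sup>2 \<le> r1 * norm h"
      proof -
        have "(- f h)\<^sup>2 \<le> (norm h * Kf)\<^sup>2" using power_mono[OF Kf(2)[of h], of 2] by simp
        also have "\<dots> = (norm h * Kf\<^sup>2) * norm h" by (simp add: power2_eq_square)
        also have "\<dots> \<le> r1 * norm h"
          
        proof (intro mult_right_mono)
          have "norm h \<le> r1 / Kf\<^sup>2" using h(2) d(4) by linarith
          then show "norm h * Kf\<^sup>2 \<le> r1" using Kf(1) by (simp add: pos_le_divide_eq)
        qed simp
        finally show ?thesis .
      qed
      moreover have "(\<Sum>i<m. \<theta> (x - z i)) \<le> (\<Sum>i<m. \<theta> (w i) + D i h + r1 * norm h)"
      proof (rule sum_mono)
        show "\<theta> (x - z i) \<le> \<theta> (w i) + D i h + r1 * norm h" if "i \<in> {..<m}" for i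
          using d1(2)[of i h] h d(5)[of i] that by (simp add: x_def w_def algebra_simps)
      qed
      moreover have "(\<Sum>i<m. \<theta> (w i) + D i h + r1 * norm h) = (\<Sum>i<m. \<theta> (w i)) + (\<Sum>i<m. D i h) + real m * r1 * norm h"
        by (simp add: sum.distrib)
      moreover have "G (z(m := x)) = (a x)\<^sup>2 + (\<Sum>i<m. \<theta> (x - z i))" unfolding G_def by simp
      moreover have "(real m + 1) * r1 * norm h = real m * r1 * norm h + r1 * norm h" by (simp add: algebra_simps)
      ultimately have "G (z(m := x)) - G z \<le> (\<Sum>i<m. D i h) - 2 * a (z m) * f h + r * \<phi> * norm h"
        unfolding r1(2) by (simp add: G_def w_def)
      then have "F (z(m := x)) \<le> \<phi> + ((\<Sum>i<m. D i h) - 2 * a (z m) * f h + r * \<phi> * norm h) / (2 * \<phi>)"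
        using F_le[OF zx] \<phi>(1) divide_right_mono[of "G (z(m := x)) - G z" _ "2 * \<phi>"] by (smt (verit))
      also have "\<dots> = \<phi> + (\<Sum>i<m. D i h) / (2 * \<phi>) - l * f h + r / 2 * norm h"
        using \<phi>(1) by (simp add: l_def add_divide_distrib diff_divide_distrib)
      finally have "\<phi> \<le> \<phi> + (\<Sum>i<m. D i h) / (2 * \<phi>) - l * f h + r / 2 * norm h + e m h + r / 2 * norm h"
        using vary[OF order_refl zx] d2(2)[OF h(1)] h(2) d(2) unfolding x_def by simp
      then show ?thesis by (simp add: L_def)
    qed
    then show ?thesis using d(1) by blast
  qed
  \<comment> \<open>Homogeneity spreads the first-order bound from small vectors to all of
    \<open>Y\<close>; used for \<open>h\<close> and its negative, it leaves only the value
    0.\<close>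
  have L_nonneg: "0 \<le> L h" if h: "h \<in> Y" for h
  proof (rule field_le_epsilon)
    fix r :: real assume r: "r > 0"
    define r' where "r' = r / (norm h + 1)"
    have h1: "0 < norm h + 1" using norm_ge_zero[of h] by linarith
    have r': "r' > 0" "r' * norm h \<le> r"
      using r h1 by (auto simp: r'_def pos_divide_le_eq mult_left_mono)
    obtain d where d: "d > 0" "\<And>h. h \<in> Y \<Longrightarrow> norm h < d \<Longrightarrow> - r' * norm h \<le> L h" using L_lower[OF r'(1)] by blast
    define c where "c = d / (norm h + 1)"
    have c: "c > 0" "c * norm h < d" using d(1) h1 by (auto simp: c_def pos_divide_less_eq)
    have "- r' * norm (c *\<^sub>R h) \<le> L (c *\<^sub>R h)" using c h Y by (intro d(2)) (auto simp: subspace_scale)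
    then have "c * (- r' * norm h) \<le> c * L h" using c(1) L_scale[OF h] by (simp add: mult_ac)
    then have "- r' * norm h \<le> L h" by (rule mult_left_le_imp_le[OF _ c(1)])
    then have "- (r' * norm h) \<le> L h" by simp
    then show "0 \<le> L h + r" using r'(2) by linarith
  qed
  have L_0: "L h = 0" if h: "h \<in> Y" for h
  proof -
    have "(-1) *\<^sub>R h \<in> Y" by (rule subspace_scale[OF Y h])
    then show ?thesis using L_nonneg[OF h] L_nonneg[of "(-1) *\<^sub>R h"] L_scale[OF h, of "-1"] by simp
  qed
  show thesis
  proof
    show "z i \<in> \<Omega> i \<and> z i \<in> Y \<and> norm (z i - xbar) \<le> \<rho> / 2" if "i < m" for i
      using z near that by (auto simp: Z_def)
    show "g i \<in> dual_on Y" if "i < m" for i using gY[OF that] .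
    show "\<bar>g i h\<bar> \<le> (1 + \<kappa>) * norm h" if "i < m" "h \<in> Y" for i h using g_bd[OF that] that by (simp add: g_def)
    show "\<exists>d>0. \<forall>u\<in>\<Omega> i \<inter> Y. norm (u - z i) < d \<longrightarrow> g i (u - z i) \<le> e * norm (u - z i)"
      if "i < m" "e > 0" for i e using normal[OF that] .
    show "l \<ge> 0" using \<phi>(1) by (simp add: l_def a_def)
    show "\<bar>(\<Sum>i<m. g i h) - l * f h\<bar> \<le> (real m + 1) * \<kappa> * norm h" if h: "h \<in> Y" for h
    proof -
      have "(\<Sum>i<m. g i h) = (\<Sum>i<m. D i h) / (2 * \<phi>) - (\<Sum>i<m. e i h)"
        using h by (simp add: g_def sum_subtractf sum_divide_distrib)
      then have "(\<Sum>i<m. g i h) - l * f h = - (\<Sum>i\<le>m. e i h)"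
        using L_0[OF h] by (simp add: L_def lessThan_Suc_atMost[symmetric])
      then have "\<bar>(\<Sum>i<m. g i h) - l * f h\<bar> \<le> (\<Sum>i\<le>m. \<bar>e i h\<bar>)" by (simp add: sum_abs)
      also have "\<dots> \<le> (\<Sum>i\<le>m. \<kappa> * norm h)" by (intro sum_mono e(2) h) auto
      finally show ?thesis by (simp add: algebra_simps)
    qed
    \<comment> \<open>By Euler's identity for \<open>D i\<close>, the value of \<open>g i\<close> at
      \<open>w i\<close> divided by \<open>\<phi>\<close> is the square of
      \<open>sqrt (\<theta> (w i)) / \<phi>\<close> up to the perturbation
      \<open>e i\<close>.\<close>
    show "(1 / \<phi>) *\<^sub>R w i \<in> Y \<and> norm ((1 / \<phi>) *\<^sub>R w i) \<le> 2 * (sqrt (\<theta> (w i)) / \<phi>) \<and> 0 \<le> sqrt (\<theta> (w i)) / \<phi> \<and>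
        (sqrt (\<theta> (w i)) / \<phi>)\<^sup>2 - 2 * \<kappa> * (sqrt (\<theta> (w i)) / \<phi>) \<le> g i ((1 / \<phi>) *\<^sub>R w i)" if i: "i < m" for i
    proof -
      have wi: "w i \<in> Y" "i \<le> m" using wY i by auto
      have vY: "(1 / \<phi>) *\<^sub>R w i \<in> Y" by (rule subspace_scale[OF Y wi(1)])
      have "norm (w i) \<le> sqrt (4 * \<theta> (w i))" using lower[OF wi(1)] by (intro real_le_rsqrt) simp
      then have "norm (w i) \<le> 2 * sqrt (\<theta> (w i))" by (simp add: real_sqrt_mult)
      then have nv: "norm ((1 / \<phi>) *\<^sub>R w i) \<le> 2 * (sqrt (\<theta> (w i)) / \<phi>)"
        using \<phi>(1) by (simp add: divide_right_mono)
      have \<kappa>: "0 \<le> \<kappa>" using s \<rho> by (simp add: \<kappa>_def)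
      have "g i ((1 / \<phi>) *\<^sub>R w i) = 1 / \<phi> * D i (w i) / (2 * \<phi>) - e i ((1 / \<phi>) *\<^sub>R w i)"
        using vY dual_on_scale[OF D(1)[OF i] wi(1), of "1 / \<phi>"] by (simp add: g_def)
      also have "1 / \<phi> * D i (w i) / (2 * \<phi>) = (sqrt (\<theta> (w i)) / \<phi>)\<^sup>2"
        using \<theta>w(1)[OF i] by (simp add: D(2)[OF i] power_divide power2_eq_square)
      finally have "g i ((1 / \<phi>) *\<^sub>R w i) = (sqrt (\<theta> (w i)) / \<phi>)\<^sup>2 - e i ((1 / \<phi>) *\<^sub>R w i)" .
      moreover have "e i ((1 / \<phi>) *\<^sub>R w i) \<le> \<kappa> * (2 * (sqrt (\<theta> (w i)) / \<phi>))"
        using e(2)[OF wi(2) vY] mult_left_mono[OF nv \<kappa>] by linarith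
      ultimately have "(sqrt (\<theta> (w i)) / \<phi>)\<^sup>2 - 2 * \<kappa> * (sqrt (\<theta> (w i)) / \<phi>) \<le> g i ((1 / \<phi>) *\<^sub>R w i)"
        by (simp only: mult.commute[of 2 \<kappa>] mult.assoc)
      then show ?thesis using vY nv \<theta>w(1)[OF i] \<phi>(1) by simp
    qed
    have "l\<^sup>2 + (\<Sum>i<m. (sqrt (\<theta> (w i)) / \<phi>)\<^sup>2) = ((a (z m))\<^sup>2 + (\<Sum>i<m. \<theta> (w i))) / \<phi>\<^sup>2"
      using \<theta>w(1) by (simp add: l_def power_divide add_divide_distrib sum_divide_distrib)
    then show "l\<^sup>2 + (\<Sum>i<m. (sqrt (\<theta> (w i)) / \<phi>)\<^sup>2) = 1"
      using Gpos unfolding \<phi>(2) by (simp add: G_def w_def)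
  qed
qed

section \<open>Separable reduction\<close>

text \<open>A Loewenheim-Skolem closure: one chosen answer to every query over the current set is
  adjoined, and this is iterated. Lists allow any finite number of arguments, all of which are
  present at some finite stage.\<close>

lemma countable_closed_under_witnesses:
  fixes Q :: "'q::countable \<Rightarrow> 'a list \<Rightarrow> 'a list \<Rightarrow> bool"
  assumes D0: "countable D0"
  obtains D where "countable D" "D0 \<subseteq> D"
    "\<And>q a b. set a \<subseteq> D \<Longrightarrow> Q q a b \<Longrightarrow> \<exists>b'. set b' \<subseteq> D \<and> Q q a b'"
proof -
  define W where "W q a = (SOME b. Q q a b)" for q a
  define nxt where "nxt A = A \<union> (\<Union>p\<in>(UNIV :: 'q set) \<times> lists A. set (W (fst p) (snd p)))" for A
  define A where "A n = (nxt ^^ n) D0" for n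
  have AS: "A (Suc n) = nxt (A n)" for n by (simp add: A_def)
  have c: "countable (A n)" for n
  proof (induction n)
    case 0 then show ?case using D0 by (simp add: A_def)
  next
    case (Suc n)
    then show ?case unfolding AS nxt_def by (intro countable_Un countable_UN countable_SIGMA countable_lists) (auto intro: uncountable_infinite countable_finite)
  qed
  have mono: "A i \<subseteq> A j" if "i \<le> j" for i j
    using that by (rule lift_Suc_mono_le[rotated]) (auto simp: AS nxt_def)
  define D where "D = (\<Union>n. A n)"
  have fin: "\<exists>n. F \<subseteq> A n" if "finite F" "F \<subseteq> D" for F
    using that
  proof (induction F)
    case (insert x F)
    then obtain n k where "F \<subseteq> A n" "x \<in> A k" by (auto simp: D_def)
    then have "insert x F \<subseteq> A (max n k)" using mono[of n "max n k"] mono[of k "max n k"] by auto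
    then show ?case by blast
  qed simp
  show thesis
  proof
    show "countable D" unfolding D_def by (intro countable_UN c) auto
    show "D0 \<subseteq> D" unfolding D_def by (force simp: A_def intro: exI[of _ 0])
    show "\<exists>b'. set b' \<subseteq> D \<and> Q q a b'" if a: "set a \<subseteq> D" and b: "Q q a b" for q a b
    proof -
      obtain n where n: "set a \<subseteq> A n" using fin[OF _ a] by auto
      have "set (W q a) \<subseteq> A (Suc n)" unfolding AS nxt_def using n by (force simp: lists_eq_set)
      moreover have "Q q a (W q a)" unfolding W_def using b by (rule someI)
      ultimately show ?thesis unfolding D_def by blast
    qed
  qed
qed

section \<open>Separable subspaces closed under witnesses\<close>

lemma rational_sequence: obtains r :: "nat \<Rightarrow> rat" where "(\<lambda>n. real_of_rat (r n)) \<longlonglongrightarrow> c"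
proof -
  have "\<exists>q. c < real_of_rat q \<and> real_of_rat q < c + inverse (real (Suc n))" for n
    by (rule of_rat_dense) simp
  then obtain r where r: "\<And>n. c < real_of_rat (r n)" "\<And>n. real_of_rat (r n) < c + inverse (real (Suc n))" by metis
  have "(\<lambda>n. real_of_rat (r n)) \<longlonglongrightarrow> c"
  proof (rule tendsto_sandwich[of "\<lambda>_. c" _ _ "\<lambda>n. c + inverse (real (Suc n))"])
    show "(\<lambda>n. c + inverse (real (Suc n))) \<longlonglongrightarrow> c"
      using tendsto_add[OF tendsto_const LIMSEQ_inverse_real_of_nat, of c] by simp
    show "(\<lambda>n. c) \<longlonglongrightarrow> c" by simp
    show "\<forall>\<^sub>F n in sequentially. c \<le> real_of_rat (r n)"
      by (rule always_eventually, rule allI, rule less_imp_le[OF r(1)])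
    show "\<forall>\<^sub>F n in sequentially. real_of_rat (r n) \<le> c + inverse (real (Suc n))"
      by (rule always_eventually, rule allI, rule less_imp_le[OF r(2)])
  qed
  then show thesis by (rule that)
qed

lemma subspace_closure_rational:
  fixes D :: "'a::real_normed_vector set"
  assumes ne: "D \<noteq> {}" and cl: "\<And>x y r. x \<in> D \<Longrightarrow> y \<in> D \<Longrightarrow> x + real_of_rat r *\<^sub>R y \<in> D"
  shows "subspace (closure D)"
proof -
  have comb: "x + c *\<^sub>R y \<in> closure D" if "x \<in> closure D" "y \<in> closure D" for x y c
  proof -
    obtain u where u: "\<And>n. u n \<in> D" "u \<longlonglongrightarrow> x" using \<open>x \<in> closure D\<close> unfolding closure_sequential by blast
    obtain v where v: "\<And>n. v n \<in> D" "v \<longlonglongrightarrow> y" using \<open>y \<in> closure D\<close> unfolding closure_sequential by blast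
    obtain r where r: "(\<lambda>n. real_of_rat (r n)) \<longlonglongrightarrow> c" by (rule rational_sequence)
    have "(\<lambda>n. u n + real_of_rat (r n) *\<^sub>R v n) \<longlonglongrightarrow> x + c *\<^sub>R y" by (intro tendsto_intros u v r)
    then show ?thesis unfolding closure_sequential using cl u(1) v(1) by (intro exI conjI allI) auto
  qed
  obtain d where "d \<in> D" using ne by blast
  then have "d \<in> closure D" using closure_subset by blast
  then have 0: "0 \<in> closure D" using comb[of d d "-1"] by simp
  show ?thesis
  proof (rule subspaceI)
    show "x + y \<in> closure D" if "x \<in> closure D" "y \<in> closure D" for x y using comb[OF that, of 1] by simp
    show "c *\<^sub>R x \<in> closure D" if "x \<in> closure D" for c x using comb[OF 0 that, of c] by simp
  qed (rule 0)
qed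

lemma separable_subspace_with_witnesses:
  fixes Q :: "'q::countable \<Rightarrow> 'a::real_normed_vector list \<Rightarrow> 'a list \<Rightarrow> bool"
  obtains D where "countable D" "x0 \<in> D" "subspace (closure D)"
    "\<And>q a b. set a \<subseteq> D \<Longrightarrow> Q q a b \<Longrightarrow> \<exists>b'. set b' \<subseteq> D \<and> Q q a b'"
proof -
  \<comment> \<open>Rational combinations of the first and the last entry of the list are treated as
    one more kind of query, so a single closure yields both properties.\<close>
  define Q' :: "'q + rat \<Rightarrow> 'a list \<Rightarrow> 'a list \<Rightarrow> bool" where
    "Q' p a b = (case p of Inl q \<Rightarrow> Q q a b | Inr r \<Rightarrow> b = [hd a + real_of_rat r *\<^sub>R last a])" for p a b
  obtain D where D: "countable D" "{x0} \<subseteq> D" and W: "\<And>p a b. set a \<subseteq> D \<Longrightarrow> Q' p a b \<Longrightarrow> \<exists>b'. set b' \<subseteq> D \<and> Q' p a b'"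
    using countable_closed_under_witnesses[of "{x0}" Q'] by (metis countable_empty countable_insert)
  show thesis
  proof
    show "countable D" "x0 \<in> D" using D by auto
    show "subspace (closure D)"
    proof (rule subspace_closure_rational)
      show "x + real_of_rat r *\<^sub>R y \<in> D" if "x \<in> D" "y \<in> D" for x y r
        using W[of "[x, y]" "Inr r" "[x + real_of_rat r *\<^sub>R y]"] that by (auto simp: Q'_def)
    qed (use D in auto)
    show "\<exists>b'. set b' \<subseteq> D \<and> Q q a b'" if "set a \<subseteq> D" "Q q a b" for q a b
      using W[of a "Inl q" b] that by (simp add: Q'_def)
  qed
qed

text \<open>Index, slope and radius of a constraint. Rational entries keep the type countable, so
  that shapes may occur in queries.\<close>

type_synonym shape = "nat \<times> rat \<times> rat"

text \<open>An entry \<open>((j, \<eta>, \<delta>), t, u)\<close> of a configuration stands for the constraint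
  \<open>g j (u - y j) \<le> \<eta> * norm (u - y j)\<close>, imposed for \<open>norm (u - y j) < \<delta>\<close> and taken with weight \<open>t\<close>.
  Splitting each \<open>H i\<close> into its \<open>part\<close>, a common vector \<open>w\<close> and a remainder gives the upper bound
  \<open>val\<close> below for \<open>\<Sum>i<m. g i (H i)\<close>.\<close>

definition part :: "(shape \<times> real \<times> 'a::real_vector) list \<Rightarrow> (nat \<Rightarrow> 'a) \<Rightarrow> nat \<Rightarrow> 'a" where
  "part cf y i = (\<Sum>((j, \<eta>, \<delta>), t, u)\<leftarrow>cf. if j = i then t *\<^sub>R (u - y i) else 0)"

definition cost :: "(shape \<times> real \<times> 'a::real_normed_vector) list \<Rightarrow> (nat \<Rightarrow> 'a) \<Rightarrow> real" where
  "cost cf y = (\<Sum>((j, \<eta>, \<delta>), t, u)\<leftarrow>cf. t * real_of_rat \<eta> * norm (u - y j))"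

locale separable_reduction =
  fixes m :: nat and \<Omega> :: "nat \<Rightarrow> 'a::real_normed_vector set" and f :: "'a \<Rightarrow> real" and C \<epsilon> :: real
  assumes C: "0 \<le> C" and eps: "0 \<le> \<epsilon>" and f: "linear f"
begin

definition val :: "rat \<Rightarrow> (nat \<Rightarrow> 'a) \<Rightarrow> (nat \<Rightarrow> 'a) \<Rightarrow> (shape \<times> real \<times> 'a) list \<Rightarrow> 'a \<Rightarrow> real" where
  "val l y H cf w = cost cf y + C * (\<Sum>i<m. norm (H i - w - part cf y i)) + real_of_rat l * f w + \<epsilon> * norm w"

definition admissible :: "real \<Rightarrow> (nat \<Rightarrow> 'a) \<Rightarrow> (shape \<times> real \<times> 'a) list \<Rightarrow> bool" where
  "admissible gap y cf \<longleftrightarrow> (\<forall>((j, \<eta>, \<delta>), t, u)\<in>set cf. j < m \<and> 0 \<le> \<eta> \<and> 0 \<le> t \<and> u \<in> \<Omega> j \<and>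
     norm (u - y j) < real_of_rat \<delta> - gap)"

text \<open>The list \<open>a\<close> consists of the base points followed by the arguments \<open>H\<close>; the list \<open>b\<close> consists of
  \<open>w\<close> followed by the points of the configuration. The weights are not members of the space, so they
  are quantified inside; \<open>gap\<close> and \<open>\<tau>\<close> leave room for approximating \<open>a\<close> by a countable set.\<close>

definition witness :: "shape list \<times> rat \<times> rat \<times> rat \<times> rat \<Rightarrow> 'a list \<Rightarrow> 'a list \<Rightarrow> bool" where
  "witness q a b = (case q of (\<sigma>, l, v, gap, \<tau>) \<Rightarrow> \<exists>cf w. map fst cf = \<sigma> \<and> b = w # map (snd \<circ> snd) cf \<and>
     (\<forall>(s, t, u)\<in>set cf. t \<le> real_of_rat \<tau>) \<and> admissible (real_of_rat gap) ((!) a) cf \<and>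
     val l ((!) a) (\<lambda>i. a ! (m + i)) cf w < real_of_rat v)"

section \<open>Moving configurations into the countable set\<close>

lemma part_perturb:
  assumes "\<forall>(s, t, u)\<in>set cf. 0 \<le> t \<and> t \<le> \<tau>" "norm (y i - y' i) \<le> d"
  shows "norm (part cf y i - part cf y' i) \<le> real (length cf) * (\<tau> * d)"
  using assms(1)
proof (induction cf)
  case Nil then show ?case by (simp add: part_def)
next
  case (Cons c cf)
  obtain j \<eta> \<delta> t u where c: "c = ((j, \<eta>, \<delta>), t, u)" by (metis prod.exhaust)
  have t: "0 \<le> t" "t \<le> \<tau>" using Cons.prems by (auto simp: c)
  have d: "0 \<le> d" using assms(2) norm_ge_zero order_trans by blast
  let ?x = "if j = i then t *\<^sub>R (u - y i) - t *\<^sub>R (u - y' i) else 0"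
  have "norm ?x \<le> \<tau> * d"
  proof (cases "j = i")
    case True
    have "t *\<^sub>R (u - y i) - t *\<^sub>R (u - y' i) = - (t *\<^sub>R (y i - y' i))" by (simp add: algebra_simps)
    then have "norm ?x = t * norm (y i - y' i)" using True t by simp
    also have "\<dots> \<le> \<tau> * d" using t assms(2) by (intro mult_mono) auto
    finally show ?thesis .
  qed (use t d in auto)
  moreover have "norm (part cf y i - part cf y' i) \<le> real (length cf) * (\<tau> * d)" using Cons by simp
  moreover have "part (c # cf) y i - part (c # cf) y' i = ?x + (part cf y i - part cf y' i)"
    by (simp add: part_def c)
  moreover have "real (length (c # cf)) * (\<tau> * d) = \<tau> * d + real (length cf) * (\<tau> * d)" by (simp add: algebra_simps)
  ultimately show ?case
    using norm_triangle_ineq[of ?x "part cf y i - part cf y' i"] by (smt (verit))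
qed

lemma cost_perturb:
  assumes "\<forall>((j, \<eta>, \<delta>), t, u)\<in>set cf. j < m \<and> 0 \<le> \<eta> \<and> 0 \<le> t \<and> t \<le> \<tau>" "\<And>i. i < m \<Longrightarrow> norm (y i - y' i) \<le> d"
  shows "cost cf y' \<le> cost cf y + (\<Sum>(j, \<eta>, \<delta>)\<leftarrow>map fst cf. real_of_rat \<eta>) * (\<tau> * d)"
  using assms(1)
proof (induction cf)
  case Nil then show ?case by (simp add: cost_def)
next
  case (Cons c cf)
  obtain j \<eta> \<delta> t u where c: "c = ((j, \<eta>, \<delta>), t, u)" by (metis prod.exhaust)
  have t: "0 \<le> t" "t \<le> \<tau>" "0 \<le> real_of_rat \<eta>" "j < m" using Cons.prems by (auto simp: c)
  have d: "norm (y j - y' j) \<le> d" "0 \<le> d" using assms(2)[OF t(4)] norm_ge_zero[of "y j - y' j"] by linarith+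
  have "norm (u - y' j) \<le> norm (u - y j) + d"
    using norm_triangle_ineq[of "u - y j" "y j - y' j"] d by simp
  then have "t * real_of_rat \<eta> * norm (u - y' j) \<le> t * real_of_rat \<eta> * (norm (u - y j) + d)"
    using t by (intro mult_left_mono) auto
  moreover have "t * real_of_rat \<eta> * d \<le> real_of_rat \<eta> * (\<tau> * d)"
    using t d mult_right_mono[OF t(2), of "real_of_rat \<eta> * d"] by (simp add: mult_ac)
  moreover have "cost cf y' \<le> cost cf y + (\<Sum>(j, \<eta>, \<delta>)\<leftarrow>map fst cf. real_of_rat \<eta>) * (\<tau> * d)" using Cons by simp
  ultimately show ?case by (simp add: cost_def c algebra_simps)
qed

text \<open>The Lipschitz constant depends on the configuration only through its shapes and the
  bound \<open>\<tau>\<close> on the weights. It is therefore known before a witness with the same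
  shapes is found.\<close>

lemma val_perturb:
  assumes cf: "\<forall>((j, \<eta>, \<delta>), t, u)\<in>set cf. j < m \<and> 0 \<le> \<eta> \<and> 0 \<le> t \<and> t \<le> \<tau>"
    and y: "\<And>i. i < m \<Longrightarrow> norm (y i - y' i) \<le> d" and H: "\<And>i. i < m \<Longrightarrow> norm (H i - H' i) \<le> d"
  shows "val l y' H' cf w \<le> val l y H cf w +
    ((\<Sum>(j, \<eta>, \<delta>)\<leftarrow>map fst cf. real_of_rat \<eta>) * \<tau> + C * (real m * (1 + real (length (map fst cf)) * \<tau>))) * d"
proof -
  have "norm (H' i - w - part cf y' i) \<le> norm (H i - w - part cf y i) + (1 + real (length cf) * \<tau>) * d" if "i < m" for i
  proof -
    have "norm (part cf y i - part cf y' i) \<le> real (length cf) * (\<tau> * d)"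
      by (rule part_perturb[where y = y and y' = y', OF _ y[OF that]]) (use cf in fastforce)
    moreover have "H' i - w - part cf y' i = (H i - w - part cf y i) + (H' i - H i) + (part cf y i - part cf y' i)" by simp
    ultimately show ?thesis using H[OF that]
        norm_triangle_ineq[of "(H i - w - part cf y i) + (H' i - H i)" "part cf y i - part cf y' i"]
        norm_triangle_ineq[of "H i - w - part cf y i" "H' i - H i"] by (simp add: norm_minus_commute algebra_simps)
  qed
  then have "(\<Sum>i<m. norm (H' i - w - part cf y' i)) \<le> (\<Sum>i<m. norm (H i - w - part cf y i) + (1 + real (length cf) * \<tau>) * d)"
    by (intro sum_mono) simp
  also have "\<dots> = (\<Sum>i<m. norm (H i - w - part cf y i)) + real m * ((1 + real (length cf) * \<tau>) * d)"
    by (simp add: sum.distrib)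
  finally have "C * (\<Sum>i<m. norm (H' i - w - part cf y' i)) \<le>
      C * ((\<Sum>i<m. norm (H i - w - part cf y i)) + real m * ((1 + real (length cf) * \<tau>) * d))" using C by (rule mult_left_mono)
  moreover have "cost cf y' \<le> cost cf y + (\<Sum>(j, \<eta>, \<delta>)\<leftarrow>map fst cf. real_of_rat \<eta>) * (\<tau> * d)"
    by (rule cost_perturb[where y = y and y' = y', OF cf y])
  ultimately show ?thesis unfolding val_def length_map distrib_right distrib_left by (simp add: mult_ac)
qed

text \<open>The points \<open>y\<close> and \<open>H\<close> lie only in the closure of
  \<open>D\<close>. The configuration is transferred to nearby base points in \<open>D\<close>,
  replaced there by a witness, and transferred back; \<open>val_perturb\<close> pays for both
  transfers with the same constant \<open>B\<close>.\<close>

lemma reduce: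
  assumes W: "\<And>q a b. set a \<subseteq> D \<Longrightarrow> witness q a b \<Longrightarrow> \<exists>b'. set b' \<subseteq> D \<and> witness q a b'"
    and y: "\<And>i. i < m \<Longrightarrow> y i \<in> closure D" and H: "\<And>i. i < m \<Longrightarrow> H i \<in> closure D"
    and adm: "admissible 0 y cf" and v: "val l y H cf w < v"
  obtains cf' w' where "map fst cf' = map fst cf" "admissible 0 y cf'" "val l y H cf' w' < v"
    "w' \<in> D" "\<And>s t u. (s, t, u) \<in> set cf' \<Longrightarrow> u \<in> D"
proof -
  obtain v0 where v0: "val l y H cf w < real_of_rat v0" "real_of_rat v0 < v" using of_rat_dense[OF v] by blast
  \<comment> \<open>Shapes do not limit the weights, and large weights would spoil the way back, so
    a rational bound is part of the query. The inserted 0 covers the empty configuration.\<close>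
  define \<tau>0 where "\<tau>0 = Max (insert 0 ((fst \<circ> snd) ` set cf))"
  obtain \<tau> where \<tau>: "\<tau>0 < real_of_rat \<tau>" using of_rat_dense[of \<tau>0 "\<tau>0 + 1"] by auto
  have \<tau>_ge: "0 \<le> real_of_rat \<tau>" "\<And>s t u. (s, t, u) \<in> set cf \<Longrightarrow> t \<le> real_of_rat \<tau>"
  proof -
    have le: "x \<le> \<tau>0" if "x \<in> insert 0 ((fst \<circ> snd) ` set cf)" for x unfolding \<tau>0_def by (rule Max_ge) (use that in auto)
    show "0 \<le> real_of_rat \<tau>" using le[OF insertI1] \<tau> by linarith
    show "t \<le> real_of_rat \<tau>" if "(s, t, u) \<in> set cf" for s t u
      using le[of t] \<tau> image_eqI[of t "fst \<circ> snd" "(s, t, u)" "set cf"] that by simp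
  qed
  define g0 where "g0 = Min (insert 1 ((\<lambda>((j, \<eta>, \<delta>), t, u). real_of_rat \<delta> - norm (u - y j)) ` set cf))"
  have "g0 > 0" unfolding g0_def using adm by (subst Min_gr_iff) (auto simp: admissible_def)
  \<comment> \<open>There is room for \<open>g\<close> twice: once for moving to \<open>D\<close>,
    once for returning to \<open>y\<close>.\<close>
  then obtain g where g: "0 < real_of_rat g" "real_of_rat g < g0 / 2" using of_rat_dense[of 0 "g0 / 2"] by auto
  have gap: "norm (u - y j) + 2 * real_of_rat g < real_of_rat \<delta>" if "((j, \<eta>, \<delta>), t, u) \<in> set cf" for j \<eta> \<delta> t u
  proof -
    have "g0 \<le> real_of_rat \<delta> - norm (u - y j)" unfolding g0_def by (rule Min_le) (use that in \<open>auto intro!: image_eqI[OF _ that]\<close>)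
    then show ?thesis using g by linarith
  qed
  define B where "B = (\<Sum>(j, \<eta>, \<delta>)\<leftarrow>map fst cf. real_of_rat \<eta>) * real_of_rat \<tau> +
    C * (real m * (1 + real (length (map fst cf)) * real_of_rat \<tau>))"
  have "0 \<le> (\<Sum>(j, \<eta>, \<delta>)\<leftarrow>map fst cf. real_of_rat \<eta>)"
    by (rule sum_list_nonneg) (use adm in \<open>fastforce simp: admissible_def\<close>)
  then have B: "0 \<le> B" using \<tau>_ge(1) C by (simp add: B_def)
  \<comment> \<open>The value must stay below \<open>v0\<close> on the way out and may rise from
    \<open>v0\<close> to \<open>v\<close> on the way back.\<close>
  define r where "r = min (real_of_rat v0 - val l y H cf w) (v - real_of_rat v0)"
  have r: "r > 0" using v0 by (simp add: r_def)
  define d where "d = min (real_of_rat g) (r / (2 * (B + 1)))"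
  have d: "d > 0" "d \<le> real_of_rat g" "B * d < r"
  proof -
    show "d > 0" "d \<le> real_of_rat g" using g r B by (auto simp: d_def)
    have "B * d \<le> B * (r / (2 * (B + 1)))" using B by (intro mult_left_mono) (auto simp: d_def)
    also have "\<dots> \<le> r / 2" using B r by (simp add: field_simps)
    finally show "B * d < r" using r by linarith
  qed
  have near: "\<exists>z'. \<forall>i. i < m \<longrightarrow> z' i \<in> D \<and> norm (z i - z' i) \<le> d" if z: "\<And>i. i < m \<Longrightarrow> z i \<in> closure D" for z
  proof (rule choice, rule allI)
    fix i
    show "\<exists>x. i < m \<longrightarrow> x \<in> D \<and> norm (z i - x) \<le> d"
    proof (cases "i < m")
      case True
      from closure_approachableD[OF z[OF True] d(1)] obtain x where "x \<in> D" "dist (z i) x < d" ..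
      then show ?thesis by (auto simp: dist_norm intro!: exI[of _ x])
    qed simp
  qed
  obtain y' where y': "\<And>i. i < m \<Longrightarrow> y' i \<in> D" "\<And>i. i < m \<Longrightarrow> norm (y i - y' i) \<le> d" using near[of y, OF y] by blast
  obtain H' where H': "\<And>i. i < m \<Longrightarrow> H' i \<in> D" "\<And>i. i < m \<Longrightarrow> norm (H i - H' i) \<le> d" using near[of H, OF H] by blast
  define a where "a = map y' [0..<m] @ map H' [0..<m]"
  have a: "set a \<subseteq> D" "\<And>i. i < m \<Longrightarrow> a ! i = y' i" "\<And>i. i < m \<Longrightarrow> a ! (m + i) = H' i"
    using y' H' by (auto simp: a_def nth_append)
  let ?q = "(map fst cf, l, v0, g, \<tau>)"
  have "witness ?q a (w # map (snd \<circ> snd) cf)"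
    unfolding witness_def prod.case
  proof (intro exI conjI)
    show "\<forall>(s, t, u)\<in>set cf. t \<le> real_of_rat \<tau>" using \<tau>_ge(2) by blast
    show "admissible (real_of_rat g) ((!) a) cf"
      unfolding admissible_def
    proof (clarify, intro conjI)
      fix j \<eta> \<delta> t u assume in_cf: "((j, \<eta>, \<delta>), t, u) \<in> set cf"
      then show j: "j < m" "0 \<le> \<eta>" "0 \<le> t" "u \<in> \<Omega> j" using adm by (fastforce simp: admissible_def)+
      show "norm (u - a ! j) < real_of_rat \<delta> - real_of_rat g"
        using gap[OF in_cf] y'(2)[OF j(1)] d(2) a(2)[OF j(1)] norm_triangle_ineq[of "u - y j" "y j - y' j"] by simp
    qed
    have "val l ((!) a) (\<lambda>i. a ! (m + i)) cf w \<le> val l y H cf w + B * d"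
      unfolding B_def
    proof (rule val_perturb)
      show "\<forall>((j, \<eta>, \<delta>), t, u)\<in>set cf. j < m \<and> 0 \<le> \<eta> \<and> 0 \<le> t \<and> t \<le> real_of_rat \<tau>"
        using adm \<tau>_ge(2) by (fastforce simp: admissible_def)
    qed (use a y' H' in auto)
    then show "val l ((!) a) (\<lambda>i. a ! (m + i)) cf w < real_of_rat v0" using d(3) by (simp add: r_def)
  qed auto
  from W[OF a(1) this] obtain b' where b': "set b' \<subseteq> D" "witness ?q a b'" by blast
  then obtain cf' w' where cf': "map fst cf' = map fst cf" "b' = w' # map (snd \<circ> snd) cf'"
    "\<forall>(s, t, u)\<in>set cf'. t \<le> real_of_rat \<tau>" "admissible (real_of_rat g) ((!) a) cf'"
    "val l ((!) a) (\<lambda>i. a ! (m + i)) cf' w' < real_of_rat v0"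
    unfolding witness_def prod.case by (elim exE conjE) (rule that)
  show thesis
  proof
    show "map fst cf' = map fst cf" by (rule cf')
    show "w' \<in> D" using b'(1) cf'(2) by simp
    show "u \<in> D" if "(s, t, u) \<in> set cf'" for s t u
    proof -
      have "u \<in> set (map (snd \<circ> snd) cf')" using that by force
      then show ?thesis using b'(1) cf'(2) by auto
    qed
    show "admissible 0 y cf'"
      unfolding admissible_def
    proof (clarify, intro conjI)
      fix j \<eta> \<delta> t u assume in_cf: "((j, \<eta>, \<delta>), t, u) \<in> set cf'"
      then show j: "j < m" "0 \<le> \<eta>" "0 \<le> t" "u \<in> \<Omega> j" using cf'(4) by (fastforce simp: admissible_def)+
      have "norm (u - a ! j) < real_of_rat \<delta> - real_of_rat g" using cf'(4) in_cf by (fastforce simp: admissible_def)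
      then show "norm (u - y j) < real_of_rat \<delta> - 0"
        using y'(2)[OF j(1)] d(2) a(2)[OF j(1)] norm_triangle_ineq[of "u - y' j" "y' j - y j"] by (simp add: norm_minus_commute)
    qed
    have "val l y H cf' w' \<le> val l ((!) a) (\<lambda>i. a ! (m + i)) cf' w' + B * d"
      unfolding B_def cf'(1)[symmetric]
    proof (rule val_perturb)
      show "\<forall>((j, \<eta>, \<delta>), t, u)\<in>set cf'. j < m \<and> 0 \<le> \<eta> \<and> 0 \<le> t \<and> t \<le> real_of_rat \<tau>"
        using cf'(3,4) by (fastforce simp: admissible_def)
      show "norm (a ! i - y i) \<le> d" if "i < m" for i
        using y'(2)[OF that] unfolding a(2)[OF that] by (subst norm_minus_commute)
      show "norm (a ! (m + i) - H i) \<le> d" if "i < m" for i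
        using H'(2)[OF that] unfolding a(3)[OF that] by (subst norm_minus_commute)
    qed
    then show "val l y H cf' w' < v" using cf'(5) d(3) by (simp add: r_def)
  qed
qed

end

lemma lookup_scaleR: "Poly_Mapping.lookup (r *\<^sub>R x) i = r *\<^sub>R Poly_Mapping.lookup x i"
proof -
  have "finite {i. r *\<^sub>R Poly_Mapping.lookup x i \<noteq> 0}"
    by (rule finite_subset[OF _ finite_lookup[of x]]) auto
  then show ?thesis unfolding scaleR_poly_mapping_def by (simp add: lookup_Abs_poly_mapping)
qed

section \<open>The cone of configurations and the extension of normals\<close>

lemma part_append: "part (cf @ cf') y i = part cf y i + part cf' y i"
  by (simp add: part_def)

lemma cost_append: "cost (cf @ cf') y = cost cf y + cost cf' y"
  by (simp add: cost_def)

abbreviation rescale :: "real \<Rightarrow> (shape \<times> real \<times> 'a) list \<Rightarrow> (shape \<times> real \<times> 'a) list" where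
  "rescale r \<equiv> map (\<lambda>(s, t, u). (s, r * t, u))"

lemma part_rescale: "part (rescale r cf) y i = r *\<^sub>R part cf y i"
  by (induction cf) (auto simp: part_def scaleR_add_right)

lemma cost_rescale: "cost (rescale r cf) y = r * cost cf y"
  by (induction cf) (auto simp: cost_def algebra_simps)

context separable_reduction
begin

lemma val_append: "val l y (\<lambda>i. H i + H' i) (cf @ cf') (w + w') \<le> val l y H cf w + val l y H' cf' w'"
proof -
  have "norm (H i + H' i - (w + w') - part (cf @ cf') y i) \<le> norm (H i - w - part cf y i) + norm (H' i - w' - part cf' y i)" for i
    using norm_triangle_ineq[of "H i - w - part cf y i" "H' i - w' - part cf' y i"] by (simp add: part_append algebra_simps)
  then have "(\<Sum>i<m. norm (H i + H' i - (w + w') - part (cf @ cf') y i)) \<le>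
      (\<Sum>i<m. norm (H i - w - part cf y i)) + (\<Sum>i<m. norm (H' i - w' - part cf' y i))"
    unfolding sum.distrib[symmetric] by (intro sum_mono)
  then have "C * (\<Sum>i<m. norm (H i + H' i - (w + w') - part (cf @ cf') y i)) \<le>
      C * ((\<Sum>i<m. norm (H i - w - part cf y i)) + (\<Sum>i<m. norm (H' i - w' - part cf' y i)))" using C by (rule mult_left_mono)
  moreover have "\<epsilon> * norm (w + w') \<le> \<epsilon> * (norm w + norm w')" using eps by (intro mult_left_mono norm_triangle_ineq)
  ultimately show ?thesis unfolding val_def cost_append linear_add[OF f] distrib_left by linarith
qed

lemma val_rescale: assumes "r > 0" shows "val l y (\<lambda>i. r *\<^sub>R H i) (rescale r cf) (r *\<^sub>R w) = r * val l y H cf w"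
proof -
  have "norm (r *\<^sub>R H i - r *\<^sub>R w - part (rescale r cf) y i) = r * norm (H i - w - part cf y i)" for i
    using assms unfolding part_rescale scaleR_diff_right[symmetric] by simp
  then show ?thesis using assms
    unfolding val_def cost_rescale linear_scale[OF f] by (simp add: sum_distrib_left[symmetric] distrib_left)
qed

lemma admissible_append: "admissible \<gamma> y (cf @ cf') \<longleftrightarrow> admissible \<gamma> y cf \<and> admissible \<gamma> y cf'"
  unfolding admissible_def set_append ball_Un ..

lemma admissible_rescale: "admissible \<gamma> y cf \<Longrightarrow> r > 0 \<Longrightarrow> admissible \<gamma> y (rescale r cf)"
  by (simp add: admissible_def case_prod_unfold)

text \<open>Every \<open>H i\<close> is the sum of a remainder, the common vector \<open>w\<close>
  and its part. The norm bound \<open>C\<close> controls the remainders, the estimate of the sum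
  controls \<open>w\<close>, and the normal inequalities bound the parts by
  \<open>cost\<close>.\<close>

lemma val_ge_on_subspace:
  assumes Y: "subspace Y" and y: "\<And>i. i < m \<Longrightarrow> y i \<in> Y" and H: "\<And>i. i < m \<Longrightarrow> H i \<in> Y" and w: "w \<in> Y"
    and u: "\<And>s t u. (s, t, u) \<in> set cf \<Longrightarrow> u \<in> Y" and adm: "admissible 0 y cf"
    and g: "\<And>i. i < m \<Longrightarrow> g i \<in> dual_on Y" and gC: "\<And>i h. i < m \<Longrightarrow> h \<in> Y \<Longrightarrow> \<bar>g i h\<bar> \<le> C * norm h"
    and g_sum: "\<And>h. h \<in> Y \<Longrightarrow> \<bar>(\<Sum>i<m. g i h) - real_of_rat l * f h\<bar> \<le> \<epsilon> * norm h"
    and g_normal: "\<And>j \<eta> \<delta> t u. ((j, \<eta>, \<delta>), t, u) \<in> set cf \<Longrightarrow> g j (u - y j) \<le> real_of_rat \<eta> * norm (u - y j)"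
  shows "(\<Sum>i<m. g i (H i)) \<le> val l y H cf w"
proof -
  have parts: "(\<forall>i<m. part cf y i \<in> Y) \<and> (\<Sum>i<m. g i (part cf y i)) \<le> cost cf y"
    using u adm g_normal
  proof (induction cf)
    case Nil
    then show ?case using subspace_0[OF Y] dual_on_0[OF g Y] by (simp add: part_def cost_def)
  next
    case (Cons c cf)
    obtain j \<eta> \<delta> t u where c: "c = ((j, \<eta>, \<delta>), t, u)" by (metis prod.exhaust)
    have j: "j < m" "0 \<le> t" using Cons.prems(2) by (auto simp: admissible_def c)
    have IH: "(\<forall>i<m. part cf y i \<in> Y) \<and> (\<Sum>i<m. g i (part cf y i)) \<le> cost cf y"
    proof (rule Cons.IH)
      show "u \<in> Y" if "(s, t, u) \<in> set cf" for s t u by (rule Cons.prems(1)) (use that in auto)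
      show "admissible 0 y cf" using Cons.prems(2) by (auto simp: admissible_def)
      show "g j (u - y j) \<le> real_of_rat \<eta> * norm (u - y j)" if "((j, \<eta>, \<delta>), t, u) \<in> set cf" for j \<eta> \<delta> t u
        by (rule Cons.prems(3)) (use that in auto)
    qed
    have uY: "u \<in> Y" by (rule Cons.prems(1)[of "(j, \<eta>, \<delta>)" t]) (simp add: c)
    have uy: "u - y j \<in> Y" "t *\<^sub>R (u - y j) \<in> Y" using Y uY y[OF j(1)] by (auto intro: subspace_diff subspace_scale)
    have p: "part (c # cf) y i = (if j = i then t *\<^sub>R (u - y j) else 0) + part cf y i" for i by (simp add: part_def c)
    have "part (c # cf) y i \<in> Y" if "i < m" for i
      unfolding p using uy IH that Y by (auto intro: subspace_add simp: subspace_0)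
    moreover have "g i (part (c # cf) y i) = (if i = j then t * g j (u - y j) else 0) + g i (part cf y i)" if "i < m" for i
      unfolding p using IH that uy g[OF that] by (auto simp: dual_on_add dual_on_scale)
    then have "(\<Sum>i<m. g i (part (c # cf) y i)) = t * g j (u - y j) + (\<Sum>i<m. g i (part cf y i))"
      using j(1) by (simp add: sum.distrib)
    moreover have "t * g j (u - y j) \<le> t * (real_of_rat \<eta> * norm (u - y j))"
      using j(2) by (intro mult_left_mono Cons.prems(3)[of j \<eta> \<delta> t]) (auto simp: c)
    moreover have "cost (c # cf) y = t * real_of_rat \<eta> * norm (u - y j) + cost cf y" by (simp add: cost_def c)
    ultimately show ?case using IH by auto
  qed
  have "g i (H i) = g i (H i - w - part cf y i) + g i w + g i (part cf y i)"
    and "g i (H i - w - part cf y i) \<le> C * norm (H i - w - part cf y i)" if i: "i < m" for i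
  proof -
    have mem: "H i - w \<in> Y" "H i - w - part cf y i \<in> Y" "part cf y i \<in> Y" using Y H[OF i] w parts i by (auto intro: subspace_diff)
    show "g i (H i) = g i (H i - w - part cf y i) + g i w + g i (part cf y i)"
      using dual_on_diff[OF g[OF i] Y mem(1,3)] dual_on_diff[OF g[OF i] Y H[OF i] w] by simp
    show "g i (H i - w - part cf y i) \<le> C * norm (H i - w - part cf y i)" using gC[OF i mem(2)] by linarith
  qed
  then have "(\<Sum>i<m. g i (H i)) \<le> (\<Sum>i<m. C * norm (H i - w - part cf y i) + g i w + g i (part cf y i))"
    by (intro sum_mono) (smt (verit) lessThan_iff)
  also have "\<dots> = C * (\<Sum>i<m. norm (H i - w - part cf y i)) + (\<Sum>i<m. g i w) + (\<Sum>i<m. g i (part cf y i))"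
    by (simp add: sum.distrib sum_distrib_left)
  also have "\<dots> \<le> val l y H cf w" using g_sum[OF w] parts unfolding val_def by linarith
  finally show ?thesis .
qed

text \<open>The demands on an extension, collected over all configurations, form the cone of
  \<open>Hahn_Banach_cone\<close>. They are compatible with \<open>g\<close>: a conflict on the
  subspace could be moved into \<open>D\<close> by \<open>reduce\<close>, where
  \<open>val_ge_on_subspace\<close> excludes it. The properties of the extension are then read off
  from three special configurations.\<close>

lemma extend_normals:
  assumes W: "\<And>q a b. set a \<subseteq> D \<Longrightarrow> witness q a b \<Longrightarrow> \<exists>b'. set b' \<subseteq> D \<and> witness q a b'"
    and Y: "subspace (closure D)" and y: "\<And>i. i < m \<Longrightarrow> y i \<in> closure D"
    and g: "\<And>i. i < m \<Longrightarrow> g i \<in> dual_on (closure D)"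
    and gC: "\<And>i h. i < m \<Longrightarrow> h \<in> closure D \<Longrightarrow> \<bar>g i h\<bar> \<le> C * norm h"
    and g_sum: "\<And>h. h \<in> closure D \<Longrightarrow> \<bar>(\<Sum>i<m. g i h) - real_of_rat l * f h\<bar> \<le> \<epsilon> * norm h"
    and g_normal: "\<And>i e. i < m \<Longrightarrow> e > 0 \<Longrightarrow>
      \<exists>d>0. \<forall>u\<in>\<Omega> i \<inter> closure D. norm (u - y i) < d \<longrightarrow> g i (u - y i) \<le> e * norm (u - y i)"
  obtains G :: "nat \<Rightarrow> 'a \<Rightarrow>\<^sub>L real" where
    "\<And>i h. i < m \<Longrightarrow> h \<in> closure D \<Longrightarrow> G i h = g i h"
    "\<And>h. \<bar>(\<Sum>i<m. G i h) - real_of_rat l * f h\<bar> \<le> \<epsilon> * norm h"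
    "\<And>i e. i < m \<Longrightarrow> e > 0 \<Longrightarrow> \<exists>d>0. \<forall>u\<in>\<Omega> i. norm (u - y i) < d \<longrightarrow> G i (u - y i) \<le> e * norm (u - y i)"
proof -
  let ?Y = "closure D"
  let ?lk = "Poly_Mapping.lookup"
  define \<eta> where "\<eta> k = (1 / of_nat (Suc k) :: rat)" for k
  have \<eta>: "0 < real_of_rat (\<eta> k)" "0 \<le> \<eta> k" for k by (simp_all add: \<eta>_def)
  \<comment> \<open>For each slope one rational radius serves all indices; these countably many
    inequalities encode normality, and the extension satisfies them with the same radii.\<close>
  have "\<forall>k. \<exists>\<delta>. 0 < real_of_rat \<delta> \<and> (\<forall>i<m. \<forall>u\<in>\<Omega> i \<inter> ?Y. norm (u - y i) < real_of_rat \<delta> \<longrightarrow> g i (u - y i) \<le> real_of_rat (\<eta> k) * norm (u - y i))"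
  proof (rule allI)
    fix k
    have "\<exists>d. \<forall>i. i < m \<longrightarrow> 0 < d i \<and> (\<forall>u\<in>\<Omega> i \<inter> ?Y. norm (u - y i) < d i \<longrightarrow> g i (u - y i) \<le> real_of_rat (\<eta> k) * norm (u - y i))"
    proof (rule choice, rule allI)
      fix i
      show "\<exists>d. i < m \<longrightarrow> 0 < d \<and> (\<forall>u\<in>\<Omega> i \<inter> ?Y. norm (u - y i) < d \<longrightarrow> g i (u - y i) \<le> real_of_rat (\<eta> k) * norm (u - y i))"
        using g_normal[of i, OF _ \<eta>(1)[of k]] by blast
    qed
    then obtain d where d: "\<And>i. i < m \<Longrightarrow> 0 < d i"
      "\<And>i u. i < m \<Longrightarrow> u \<in> \<Omega> i \<Longrightarrow> u \<in> ?Y \<Longrightarrow> norm (u - y i) < d i \<Longrightarrow> g i (u - y i) \<le> real_of_rat (\<eta> k) * norm (u - y i)" by blast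
    have "0 < Min (insert 1 (d ` {..<m}))" using d(1) by (subst Min_gr_iff) auto
    then obtain \<delta> where \<delta>: "0 < real_of_rat \<delta>" "real_of_rat \<delta> < Min (insert 1 (d ` {..<m}))" using of_rat_dense by blast
    have "real_of_rat \<delta> < d i" if "i < m" for i using \<delta>(2) that by (subst (asm) Min_gr_iff) auto
    then show "\<exists>\<delta>. 0 < real_of_rat \<delta> \<and> (\<forall>i<m. \<forall>u\<in>\<Omega> i \<inter> ?Y. norm (u - y i) < real_of_rat \<delta> \<longrightarrow> g i (u - y i) \<le> real_of_rat (\<eta> k) * norm (u - y i))"
      using \<delta>(1) d(2) by (intro exI[of _ \<delta>]) (auto intro: less_trans)
  qed
  from choice[OF this] obtain \<delta> where \<delta>: "\<And>k. 0 < real_of_rat (\<delta> k)"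
    "\<And>k i u. i < m \<Longrightarrow> u \<in> \<Omega> i \<Longrightarrow> u \<in> ?Y \<Longrightarrow> norm (u - y i) < real_of_rat (\<delta> k) \<Longrightarrow> g i (u - y i) \<le> real_of_rat (\<eta> k) * norm (u - y i)" by blast
  \<comment> \<open>Only admissibility and the list of shapes enter, and \<open>reduce\<close>
    preserves both.\<close>
  define ok :: "(shape \<times> real \<times> 'a) list \<Rightarrow> bool" where
    "ok cf \<longleftrightarrow> admissible 0 y cf \<and> (\<forall>s\<in>set (map fst cf). \<exists>k. snd s = (\<eta> k, \<delta> k))" for cf
  define S where "S = {(H, c). \<exists>cf w. ok cf \<and> val l y (?lk H) cf w \<le> c}"
  define G0 where "G0 = {(H, a). (\<forall>i. ?lk H i \<in> ?Y) \<and> a = (\<Sum>i<m. g i (?lk H i))}"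
  \<comment> \<open>The finitely supported functions form one vector space that contains the
    \<open>m\<close>-fold product for every \<open>m\<close>.\<close>
  obtain L :: "(nat \<Rightarrow>\<^sub>0 'a) \<Rightarrow> real" where L: "linear L" "\<And>H c. (H, c) \<in> S \<Longrightarrow> L H \<le> c" "\<And>H a. (H, a) \<in> G0 \<Longrightarrow> L H = a"
  proof (rule Hahn_Banach_cone[of S G0])
    show "p + p' \<in> S" if "p \<in> S" "p' \<in> S" for p p'
    proof -
      obtain H c cf w where p: "p = (H, c)" "ok cf" "val l y (?lk H) cf w \<le> c" using \<open>p \<in> S\<close> by (auto simp: S_def)
      obtain H' c' cf' w' where p': "p' = (H', c')" "ok cf'" "val l y (?lk H') cf' w' \<le> c'" using \<open>p' \<in> S\<close> by (auto simp: S_def)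
      have "?lk (H + H') = (\<lambda>i. ?lk H i + ?lk H' i)" by (rule ext) (rule lookup_add)
      then have "val l y (?lk (H + H')) (cf @ cf') (w + w') \<le> c + c'"
        using val_append[of l y "?lk H" "?lk H'" cf cf' w w'] p p' by simp
      moreover have "ok (cf @ cf')" using p(2) p'(2)
        unfolding ok_def admissible_append map_append set_append ball_Un by simp
      ultimately show ?thesis unfolding p p' S_def by auto
    qed
    show "r *\<^sub>R p \<in> S" if "p \<in> S" "r > 0" for r p
    proof -
      obtain H c cf w where p: "p = (H, c)" "ok cf" "val l y (?lk H) cf w \<le> c" using \<open>p \<in> S\<close> by (auto simp: S_def)
      have "?lk (r *\<^sub>R H) = (\<lambda>i. r *\<^sub>R ?lk H i)" by (rule ext) (rule lookup_scaleR)
      then have "val l y (?lk (r *\<^sub>R H)) (rescale r cf) (r *\<^sub>R w) \<le> r * c"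
        using val_rescale[OF that(2), of l y "?lk H" cf w] p that(2) by simp
      moreover have "ok (rescale r cf)" using p(2) admissible_rescale[OF _ that(2)] by (simp add: ok_def case_prod_unfold)
      ultimately show ?thesis unfolding p S_def by auto
    qed
    show "\<exists>c. (H, c) \<in> S" for H
      unfolding S_def by (auto simp: ok_def admissible_def intro!: exI[of _ "[]"])
    show "subspace G0"
    proof (rule subspaceI)
      show "0 \<in> G0" using subspace_0[OF Y] dual_on_0[OF g Y] by (simp add: G0_def zero_prod_def)
      show "p + p' \<in> G0" if "p \<in> G0" "p' \<in> G0" for p p'
        using that subspace_add[OF Y] by (auto simp: G0_def lookup_add dual_on_add[OF g] sum.distrib[symmetric] intro!: sum.cong)
      show "r *\<^sub>R p \<in> G0" if "p \<in> G0" for r p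
        using that subspace_scale[OF Y] by (auto simp: G0_def lookup_scaleR dual_on_scale[OF g] sum_distrib_left intro!: sum.cong)
    qed
    show "a \<le> c" if HG: "(H, a) \<in> G0" and HS: "(H, c) \<in> S" for H a c
    \<comment> \<open>\<open>reduce\<close> starts from a strict bound, hence the arbitrary
      \<open>v\<close> above \<open>c\<close>.\<close>
    proof (rule dense_ge)
      fix v assume v: "c < v"
      have H: "\<And>i. ?lk H i \<in> ?Y" "a = (\<Sum>i<m. g i (?lk H i))" using HG by (auto simp: G0_def)
      obtain cf w where cf: "ok cf" "val l y (?lk H) cf w \<le> c" using HS by (auto simp: S_def)
      have adm: "admissible 0 y cf" using cf(1) by (simp add: ok_def)
      have lt: "val l y (?lk H) cf w < v" using cf(2) v by linarith
      obtain cf' w' where cf': "map fst cf' = map fst cf" "admissible 0 y cf'"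
        "val l y (?lk H) cf' w' < v" "w' \<in> D" "\<And>s t u. (s, t, u) \<in> set cf' \<Longrightarrow> u \<in> D"
      proof (rule reduce[where D = D and y = y and H = "?lk H" and cf = cf and w = w and v = v and l = l])
        show "\<exists>b'. set b' \<subseteq> D \<and> witness q a b'" if "set a \<subseteq> D" "witness q a b" for q a b by (rule W[OF that])
        show "y i \<in> ?Y" if "i < m" for i by (rule y[OF that])
      qed (rule H adm lt | blast)+
      have "a \<le> val l y (?lk H) cf' w'" unfolding H(2)
      proof (rule val_ge_on_subspace[where g = g and H = "?lk H", OF Y])
        show "admissible 0 y cf'" by (rule cf'(2))
        show "w' \<in> ?Y" "\<And>s t u. (s, t, u) \<in> set cf' \<Longrightarrow> u \<in> ?Y" using cf'(4,5) closure_subset by blast+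
        fix j \<eta>1 \<delta>1 t u assume in_cf: "((j, \<eta>1, \<delta>1), t, u) \<in> set cf'"
        then have "(j, \<eta>1, \<delta>1) \<in> set (map fst cf')" by force
        then have "(j, \<eta>1, \<delta>1) \<in> set (map fst cf)" unfolding cf'(1) .
        then obtain k where k: "\<eta>1 = \<eta> k" "\<delta>1 = \<delta> k" using cf(1) unfolding ok_def by fastforce
        have "j < m" "u \<in> \<Omega> j" "norm (u - y j) < real_of_rat \<delta>1" using cf'(2) in_cf by (fastforce simp: admissible_def)+
        then show "g j (u - y j) \<le> real_of_rat \<eta>1 * norm (u - y j)"
          using \<delta>(2)[of j u k] cf'(5)[OF in_cf] closure_subset k by blast
      qed (use y H(1) g gC g_sum in blast)+
      then show "a \<le> v" using cf'(3) by linarith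
    qed
  qed blast
  have L_le: "L H \<le> val l y (?lk H) cf w" if "ok cf" for H cf w
    by (rule L(2)) (use that in \<open>auto simp: S_def\<close>)
  have ok_Nil: "ok []" by (simp add: ok_def admissible_def)
  define s where "s i h = Poly_Mapping.single i (h :: 'a)" for i :: nat and h
  have lk_s: "?lk (s i h) j = (if i = j then h else 0)" for i j h by (simp add: s_def lookup_single)
  have s_lin: "linear (\<lambda>h. L (s i h))" for i
  proof (rule linearI)
    show "L (s i (a + b)) = L (s i a) + L (s i b)" for a b
      unfolding linear_add[OF L(1), symmetric] s_def single_add ..
    have "s i (r *\<^sub>R a) = r *\<^sub>R s i a" for r a by (rule poly_mapping_eqI) (simp add: lookup_scaleR lk_s)
    then show "L (s i (r *\<^sub>R a)) = r *\<^sub>R L (s i a)" for r a by (simp add: linear_scale[OF L(1)])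
  qed
  \<comment> \<open>With the empty configuration and \<open>w = 0\<close> only the remainder is
    left.\<close>
  have s_bound: "L (s i h) \<le> C * norm h" if "i < m" for i h
    using L_le[OF ok_Nil, of "s i h" 0] that
    by (simp add: val_def cost_def part_def lk_s linear_0[OF f] if_distrib[of norm] cong: if_cong)
  have blin: "bounded_linear (\<lambda>h. L (s i h))" if "i < m" for i
  proof (rule bounded_linear_intro[where K = C])
    show "norm (L (s i h)) \<le> norm h * C" for h
      using s_bound[OF that, of h] s_bound[OF that, of "- h"] linear_neg[OF s_lin, of i h] by (simp add: mult.commute abs_le_iff)
  qed (use linear_add[OF s_lin] linear_scale[OF s_lin] in auto)
  define G where "G i = Blinfun (\<lambda>h. L (s i h))" for i
  have G: "blinfun_apply (G i) h = L (s i h)" if "i < m" for i h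
    using blin[OF that] by (simp add: G_def bounded_linear_Blinfun_apply)
  show thesis
  proof
    show "G i h = g i h" if "i < m" "h \<in> ?Y" for i h
    proof -
      have "(\<Sum>j<m. g j (?lk (s i h) j)) = (\<Sum>j<m. if j = i then g i h else 0)"
        by (rule sum.cong) (use dual_on_0[OF g Y] in \<open>auto simp: lk_s\<close>)
      also have "\<dots> = g i h" using that(1) by simp
      finally have "(s i h, g i h) \<in> G0" using that(2) Y by (simp add: G0_def lk_s subspace_0)
      then show ?thesis using L(3) G[OF that(1)] by simp
    qed
    \<comment> \<open>On a constant tuple the choice \<open>w = h\<close> cancels every
      remainder.\<close>
    have half: "(\<Sum>i<m. L (s i h)) \<le> real_of_rat l * f h + \<epsilon> * norm h" for h
    proof -
      have "?lk (\<Sum>i<m. s i h) j = h" if "j < m" for j using that by (simp add: lookup_sum lk_s)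
      then have "val l y (?lk (\<Sum>i<m. s i h)) [] h = real_of_rat l * f h + \<epsilon> * norm h"
        by (simp add: val_def cost_def part_def)
      then show ?thesis using L_le[OF ok_Nil, of "\<Sum>i<m. s i h" h] by (simp add: linear_sum[OF L(1)])
    qed
    show "\<bar>(\<Sum>i<m. G i h) - real_of_rat l * f h\<bar> \<le> \<epsilon> * norm h" for h
      using half[of h] half[of "- h"] by (simp add: G linear_neg[OF s_lin] linear_neg[OF f] sum_negf abs_le_iff)
    show "\<exists>d>0. \<forall>u\<in>\<Omega> i. norm (u - y i) < d \<longrightarrow> G i (u - y i) \<le> e * norm (u - y i)" if i: "i < m" and e: "e > 0" for i e
    proof -
      obtain k where k: "inverse (real (Suc k)) < e" using reals_Archimedean[OF e] by blast
      have "real_of_rat (\<eta> k) = inverse (real (Suc k))"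
        by (simp only: \<eta>_def of_rat_divide of_rat_1 of_rat_of_nat_eq inverse_eq_divide)
      then have \<eta>k: "real_of_rat (\<eta> k) \<le> e" using k by linarith
      have "G i (u - y i) \<le> e * norm (u - y i)" if u: "u \<in> \<Omega> i" "norm (u - y i) < real_of_rat (\<delta> k)" for u
      proof -
        \<comment> \<open>With weight 1 the part of this single entry is the whole argument, so only
          its cost is left.\<close>
        let ?cf = "[((i, \<eta> k, \<delta> k), 1, u)]"
        have "ok ?cf" using i u \<eta>(2) by (auto simp: ok_def admissible_def)
        moreover have "val l y (?lk (s i (u - y i))) ?cf 0 = real_of_rat (\<eta> k) * norm (u - y i)"
          by (simp add: val_def cost_def part_def lk_s linear_0[OF f]) (auto intro!: sum.neutral)
        ultimately have "L (s i (u - y i)) \<le> real_of_rat (\<eta> k) * norm (u - y i)" using L_le by metis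
        then show ?thesis using G[OF i] mult_right_mono[OF \<eta>k norm_ge_zero[of "u - y i"]] by simp
      qed
      then show ?thesis using \<delta>(1) by blast
    qed
  qed
qed

end

section \<open>Normals from rated separation\<close>

lemma frechet_normal_coneI:
  assumes x: "x \<in> \<Omega>" and F: "\<And>e. e > 0 \<Longrightarrow> \<exists>d>0. \<forall>u\<in>\<Omega>. norm (u - x) < d \<longrightarrow> blinfun_apply F (u - x) \<le> e * norm (u - x)"
  shows "F \<in> frechet_normal_cone x \<Omega>"
proof -
  have "Limsup (at x within \<Omega>) (\<lambda>u. ereal (F (u - x) / norm (u - x))) \<le> 0"
    unfolding Limsup_le_iff
  proof (intro allI impI)
    fix c :: ereal assume "0 < c"
    then obtain e where e: "0 < ereal e" "ereal e < c" using ereal_dense2 by blast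
    from F[of e] e(1) obtain d where d: "d > 0" "\<And>u. u \<in> \<Omega> \<Longrightarrow> norm (u - x) < d \<Longrightarrow> F (u - x) \<le> e * norm (u - x)" by auto
    have "ereal (F (u - x) / norm (u - x)) < c" if "u \<in> \<Omega>" "u \<noteq> x" "dist u x < d" for u
    proof -
      have "F (u - x) / norm (u - x) \<le> e" using d(2)[of u] that by (simp add: dist_norm pos_divide_le_eq)
      then have "ereal (F (u - x) / norm (u - x)) \<le> ereal e" by simp
      then show ?thesis using e(2) by (rule order.strict_trans1)
    qed
    then show "\<forall>\<^sub>F u in at x within \<Omega>. ereal (F (u - x) / norm (u - x)) < c"
      unfolding eventually_at using d(1) by blast
  qed
  then show ?thesis using x by (simp add: frechet_normal_cone_def)
qed

text \<open>The factor 128 is twice the 64 in \<open>approximate_multipliers\<close>: half of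
  \<open>\<eta>\<close> covers the perturbations of all variables, and the other half pays for a
  rational multiplier.\<close>

lemma normals_from_separation:
  fixes \<Omega> :: "nat \<Rightarrow> 'a::banach set" and f :: "'a \<Rightarrow>\<^sub>L real"
  assumes asp: "asplund TYPE('a)" and x\<Omega>: "\<And>i. i < m \<Longrightarrow> xbar \<in> \<Omega> i"
    and cl: "\<And>i. i < m \<Longrightarrow> closed (\<Omega> i \<inter> cball xbar \<rho>)" and s: "s > 0" and \<rho>: "\<rho> > 0"
    and sep: "\<And>x. x \<in> cball xbar \<rho> \<Longrightarrow> (\<And>i. i < m \<Longrightarrow> x \<in> \<Omega> i) \<Longrightarrow> f (x - xbar) < s"
    and \<eta>: "128 * (real m + 1) * s / \<rho> \<le> \<eta>" "\<eta> \<le> 1 / 2"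
  obtains y and G :: "nat \<Rightarrow> 'a \<Rightarrow>\<^sub>L real" and l where
    "\<And>i. i < m \<Longrightarrow> y i \<in> \<Omega> i \<and> norm (y i - xbar) \<le> \<rho> / 2"
    "\<And>i e. i < m \<Longrightarrow> e > 0 \<Longrightarrow> \<exists>d>0. \<forall>u\<in>\<Omega> i. norm (u - y i) < d \<longrightarrow> G i (u - y i) \<le> e * norm (u - y i)"
    "l \<ge> 0" "norm ((\<Sum>i<m. G i) - l *\<^sub>R f) \<le> \<eta>" "1 / 16 \<le> l\<^sup>2 + (\<Sum>i<m. (norm (G i))\<^sup>2)"
proof -
  define \<kappa> where "\<kappa> = 64 * s / \<rho>"
  have \<kappa>: "0 < \<kappa>" "(real m + 1) * \<kappa> \<le> \<eta> / 2" using s \<rho> \<eta> by (auto simp: \<kappa>_def mult_ac)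
  have \<eta>0: "0 < \<eta>" using \<kappa> mult_pos_pos[of "real m + 1" \<kappa>] by linarith
  \<comment> \<open>Both bounds are fixed before any multiplier is known, so \<open>D\<close> can be
    constructed first.\<close>
  interpret separable_reduction m \<Omega> f "1 + \<kappa>" \<eta>
  proof (rule separable_reduction.intro)
    show "linear f" by (rule bounded_linear.linear[OF blinfun.bounded_linear_right])
  qed (use \<kappa>(1) \<eta>0 in simp_all)
  obtain D where D: "countable D" "xbar \<in> D" "subspace (closure D)"
    and W: "\<And>q a b. set a \<subseteq> D \<Longrightarrow> witness q a b \<Longrightarrow> \<exists>b'. set b' \<subseteq> D \<and> witness q a b'"
    by (rule separable_subspace_with_witnesses[of xbar witness]) blast
  have DY: "D \<subseteq> closure D" by (rule closure_subset)
  have "separable_space (top_of_set (closure D))"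
    unfolding separable_space_def
    by (intro exI[of _ D]) (use D(1) DY in \<open>auto simp: closure_of_subtopology Int_absorb1\<close>)
  then have "separable_dual (closure D)" using asp D(3) unfolding asplund_def by blast
  then obtain \<theta> where "smooth_square (closure D) \<theta>"
    using smooth_square_exists[OF D(3,1) DY] by blast
  then interpret smooth_square "closure D" \<theta> .
  have "complete (closure D)" by (simp add: complete_eq_closed)
  obtain y g l0 v \<tau> where y: "\<And>i. i < m \<Longrightarrow> y i \<in> \<Omega> i \<and> y i \<in> closure D \<and> norm (y i - xbar) \<le> \<rho> / 2"
    and g: "\<And>i. i < m \<Longrightarrow> g i \<in> dual_on (closure D)"
    "\<And>i h. i < m \<Longrightarrow> h \<in> closure D \<Longrightarrow> \<bar>g i h\<bar> \<le> (1 + \<kappa>) * norm h"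
    "\<And>i e. i < m \<Longrightarrow> e > 0 \<Longrightarrow> \<exists>d>0. \<forall>u\<in>\<Omega> i \<inter> closure D. norm (u - y i) < d \<longrightarrow> g i (u - y i) \<le> e * norm (u - y i)"
    and l0: "l0 \<ge> 0" and g_sum: "\<And>h. h \<in> closure D \<Longrightarrow> \<bar>(\<Sum>i<m. g i h) - l0 * f h\<bar> \<le> (real m + 1) * \<kappa> * norm h"
    and v: "\<And>i. i < m \<Longrightarrow> v i \<in> closure D \<and> norm (v i) \<le> 2 * \<tau> i \<and> 0 \<le> \<tau> i \<and> (\<tau> i)\<^sup>2 - 2 * \<kappa> * \<tau> i \<le> g i (v i)"
    and one: "l0\<^sup>2 + (\<Sum>i<m. (\<tau> i)\<^sup>2) = (1::real)"
  proof (rule approximate_multipliers[of xbar m \<Omega> \<rho> "blinfun_apply f" s, folded \<kappa>_def])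
    show "complete (closure D)" by fact
    show "xbar \<in> closure D" using D(2) DY by blast
    show "bounded_linear f" by (rule blinfun.bounded_linear_right)
    show "xbar \<in> \<Omega> i" "closed (\<Omega> i \<inter> cball xbar \<rho>)" if "i < m" for i by (rule x\<Omega>[OF that], rule cl[OF that])
    show "f (x - xbar) < s" if "x \<in> cball xbar \<rho>" "\<And>i. i < m \<Longrightarrow> x \<in> \<Omega> i" for x by (rule sep[OF that])
  qed (rule s \<rho> | blast)+
  \<comment> \<open>The multiplier is part of the queries answered by \<open>D\<close>, so it has to
    be rational. Rounding upwards keeps it nonnegative and does not decrease its square.\<close>
  obtain l where l: "l0 < real_of_rat l" "real_of_rat l < l0 + \<eta> / (2 * (norm f + 1))"
    using of_rat_dense[of l0 "l0 + \<eta> / (2 * (norm f + 1))"] \<eta>0 by (auto simp: add_nonneg_pos)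
  have fpos: "0 < norm f + 1" using norm_ge_zero[of f] by linarith
  have l_f: "(real_of_rat l - l0) * norm f \<le> \<eta> / 2"
  proof -
    have "(real_of_rat l - l0) * norm f \<le> \<eta> / (2 * (norm f + 1)) * (norm f + 1)"
      using l by (intro mult_mono) auto
    also have "\<dots> = \<eta> / 2" using fpos by (simp add: field_simps)
    finally show ?thesis .
  qed
  have g_sum': "\<bar>(\<Sum>i<m. g i h) - real_of_rat l * f h\<bar> \<le> \<eta> * norm h" if h: "h \<in> closure D" for h
  proof -
    have "\<bar>(real_of_rat l - l0) * f h\<bar> \<le> (real_of_rat l - l0) * (norm f * norm h)"
      unfolding abs_mult using l norm_blinfun[of f h] by (intro mult_mono) auto
    also have "\<dots> \<le> \<eta> / 2 * norm h" unfolding mult.assoc[symmetric] by (rule mult_right_mono[OF l_f]) simp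
    finally have "\<bar>(real_of_rat l - l0) * f h\<bar> \<le> \<eta> / 2 * norm h" .
    moreover have "(real m + 1) * \<kappa> * norm h \<le> \<eta> / 2 * norm h" by (rule mult_right_mono[OF \<kappa>(2)]) simp
    moreover have "(\<Sum>i<m. g i h) - real_of_rat l * f h = ((\<Sum>i<m. g i h) - l0 * f h) - (real_of_rat l - l0) * f h"
      by (simp add: algebra_simps)
    ultimately show ?thesis using g_sum[OF h] by linarith
  qed
  obtain G :: "nat \<Rightarrow> 'a \<Rightarrow>\<^sub>L real" where G: "\<And>i h. i < m \<Longrightarrow> h \<in> closure D \<Longrightarrow> G i h = g i h"
    "\<And>h. \<bar>(\<Sum>i<m. G i h) - real_of_rat l * f h\<bar> \<le> \<eta> * norm h"
    "\<And>i e. i < m \<Longrightarrow> e > 0 \<Longrightarrow> \<exists>d>0. \<forall>u\<in>\<Omega> i. norm (u - y i) < d \<longrightarrow> G i (u - y i) \<le> e * norm (u - y i)"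
  proof (rule extend_normals[of D y g l])
    show "\<exists>b'. set b' \<subseteq> D \<and> witness q a b'" if "set a \<subseteq> D" "witness q a b" for q a b by (rule W[OF that])
    show "y i \<in> closure D" if "i < m" for i using y[OF that] by blast
  qed (rule D(3) g g_sum'; assumption | blast)+
  \<comment> \<open>Testing \<open>G i\<close> on \<open>v i\<close> gives
    \<open>\<tau> i \<le> 2 * (norm (G i) + \<kappa>)\<close>; the square of the sum is at most
    twice the sum of the squares.\<close>
  have lower: "(\<tau> i)\<^sup>2 \<le> 8 * (norm (G i))\<^sup>2 + 8 * \<kappa>\<^sup>2" if i: "i < m" for i
  proof -
    have "\<tau> i \<le> 2 * (norm (G i) + \<kappa>)"
    proof (cases "\<tau> i = 0")
      case False
      then have \<tau>: "\<tau> i > 0" using v[OF i] by simp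
      have "(\<tau> i)\<^sup>2 - 2 * \<kappa> * \<tau> i \<le> G i (v i)" using v[OF i] G(1)[OF i] by simp
      also have "\<dots> \<le> norm (G i) * norm (v i)" using norm_blinfun[of "G i" "v i"] by simp
      also have "\<dots> \<le> norm (G i) * (2 * \<tau> i)" using v[OF i] by (intro mult_left_mono) auto
      finally have "\<tau> i * \<tau> i \<le> (2 * (norm (G i) + \<kappa>)) * \<tau> i" by (simp add: power2_eq_square algebra_simps)
      then show ?thesis using \<tau> by (rule mult_right_le_imp_le)
    qed (use \<kappa> in simp)
    then have "(\<tau> i)\<^sup>2 \<le> (2 * (norm (G i) + \<kappa>))\<^sup>2" using v[OF i] by (intro power_mono) auto
    also have "\<dots> \<le> 8 * (norm (G i))\<^sup>2 + 8 * \<kappa>\<^sup>2"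
      using sum_squares_bound[of "norm (G i)" \<kappa>] by (simp add: power2_eq_square algebra_simps)
    finally show ?thesis .
  qed
  show thesis
  proof
    show "y i \<in> \<Omega> i \<and> norm (y i - xbar) \<le> \<rho> / 2" if "i < m" for i using y[OF that] by blast
    show "\<exists>d>0. \<forall>u\<in>\<Omega> i. norm (u - y i) < d \<longrightarrow> G i (u - y i) \<le> e * norm (u - y i)" if "i < m" "e > 0" for i e
      using G(3)[OF that] .
    show "real_of_rat l \<ge> 0" using l l0 by linarith
    show "norm ((\<Sum>i<m. G i) - real_of_rat l *\<^sub>R f) \<le> \<eta>"
    proof (rule norm_blinfun_bound)
      show "norm (((\<Sum>i<m. G i) - real_of_rat l *\<^sub>R f) h) \<le> \<eta> * norm h" for h
        using G(2)[of h] by (simp add: blinfun.diff_left blinfun.sum_left blinfun.scaleR_left)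
    qed (use \<eta>0 in simp)
    have "1 \<le> (real_of_rat l)\<^sup>2 + (\<Sum>i<m. 8 * (norm (G i))\<^sup>2 + 8 * \<kappa>\<^sup>2)"
      unfolding one[symmetric] using lower l l0 by (intro add_mono sum_mono power_mono) auto
    also have "\<dots> = (real_of_rat l)\<^sup>2 + 8 * (\<Sum>i<m. (norm (G i))\<^sup>2) + 8 * (real m * \<kappa>\<^sup>2)"
      by (simp add: sum.distrib sum_distrib_left)
    \<comment> \<open>Eight times this is at most 1/2, so half of the normalisation remains; the
      factor 8 in front of the norms then leaves 1/16.\<close>
    also have "real m * \<kappa>\<^sup>2 \<le> 1 / 16"
    proof -
      have k: "(real m + 1) * \<kappa> \<le> 1 / 4" using \<kappa> \<eta> by linarith
      have "1 * \<kappa> \<le> (real m + 1) * \<kappa>" using \<kappa>(1) by (intro mult_right_mono) auto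
      then have "\<kappa> \<le> 1 / 4" using k by linarith
      moreover have "real m * \<kappa> \<le> 1 / 4" using k \<kappa>(1) by (simp add: distrib_right)
      ultimately have "(real m * \<kappa>) * \<kappa> \<le> 1 / 4 * (1 / 4)" using \<kappa>(1) by (intro mult_mono) auto
      then show ?thesis by (simp add: power2_eq_square mult.assoc)
    qed
    finally have "1 / 2 \<le> (real_of_rat l)\<^sup>2 + 8 * (\<Sum>i<m. (norm (G i))\<^sup>2)" by simp
    moreover have "0 \<le> (real_of_rat l)\<^sup>2" by simp
    ultimately show "1 / 16 \<le> (real_of_rat l)\<^sup>2 + (\<Sum>i<m. (norm (G i))\<^sup>2)" by linarith
  qed
qed

text \<open>One sufficiently small \<open>r\<close> is enough. On the ball of radius
  \<open>r * R r\<close> the error \<open>r * norm (x - xbar)\<close> is at most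
  \<open>r * M\<close>, so \<open>s = r * (1 + M)\<close> separates, and \<open>s\<close> divided by
  the radius is \<open>(1 + M) / R r\<close>, which outweighs the cardinality. If \<open>c\<close>
  caps the radius, the bound \<open>r * R r \<le> M\<close> is used once more.\<close>

lemma rated_normal_separation:
  fixes \<Omega> :: "'i \<Rightarrow> 'a::real_normed_vector set"
  assumes R: "rate_function R" and f: "rated_normal R T \<Omega> xbar f" and \<eta>: "\<eta> > 0" and c: "c > 0"
  obtains I s \<rho> where "finite I" "I \<subseteq> T" "s > 0" "0 < \<rho>" "\<rho> \<le> c" "(real (card I) + 1) * s / \<rho> \<le> \<eta>"
    "\<And>x. x \<in> cball xbar \<rho> \<Longrightarrow> (\<And>i. i \<in> I \<Longrightarrow> x \<in> \<Omega> i) \<Longrightarrow> blinfun_apply f (x - xbar) < s"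
proof -
  obtain M0 where M0: "\<And>r. r \<ge> 0 \<Longrightarrow> r * R r \<le> M0" using R unfolding rate_function_def by blast
  define M where "M = max M0 0"
  have M: "0 \<le> M" "\<And>r. r \<ge> 0 \<Longrightarrow> r * R r \<le> M" using M0 by (force simp: M_def)+
  obtain I where o: "(\<lambda>r. real (card (I r)) powr (3 / 2)) \<in> o[at_right 0](R)"
    and ev: "\<forall>\<^sub>F r in at_right 0. finite (I r) \<and> I r \<subseteq> T \<and>
      (\<forall>x \<in> (\<Inter>i\<in>I r. \<Omega> i) \<inter> cball xbar (r * R r). blinfun_apply f (x - xbar) - r * norm (x - xbar) < r)"
    using f unfolding rated_normal_def by blast
  \<comment> \<open>The two factors serve the two cases of the minimum: they ensure
    \<open>q * (1 + M) \<le> \<eta>\<close> for the radius \<open>r * R r\<close>, and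
    \<open>q * (1 + M) * (M / c) \<le> \<eta>\<close> for the radius \<open>c\<close>.\<close>
  define q where "q = \<eta> / ((1 + M) * (1 + M / c))"
  have pos: "0 < (1 + M) * (1 + M / c)" using M(1) c by (intro mult_pos_pos add_pos_nonneg) auto
  have q: "0 < q" using \<eta> pos by (simp add: q_def)
  have ev_o: "\<forall>\<^sub>F r in at_right 0. norm (real (card (I r)) powr (3 / 2)) \<le> q / 2 * norm (R r)"
    by (rule landau_o.smallD[OF o]) (use q in simp)
  have ev_R: "\<forall>\<^sub>F r in at_right 0. 2 / q \<le> R r"
    using R unfolding rate_function_def by (intro filterlim_at_top[THEN iffD1, rule_format]) auto
  have "\<forall>\<^sub>F r in at_right (0::real). 0 < r" by (rule eventually_at_right_less)
  from eventually_happens'[OF trivial_limit_at_right_real eventually_conj[OF this eventually_conj[OF ev_R eventually_conj[OF ev_o ev]]]]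
  obtain r where r: "0 < r" "2 / q \<le> R r" "norm (real (card (I r)) powr (3 / 2)) \<le> q / 2 * norm (R r)"
    and Ir: "finite (I r)" "I r \<subseteq> T"
      "\<And>x. x \<in> (\<Inter>i\<in>I r. \<Omega> i) \<inter> cball xbar (r * R r) \<Longrightarrow> blinfun_apply f (x - xbar) - r * norm (x - xbar) < r" by blast
  define m where "m = real (card (I r))"
  have Rr: "0 < R r" using r(2) q by (meson divide_pos_pos less_le_trans zero_less_numeral)
  \<comment> \<open>A cardinality is either 0 or at least 1.\<close>
  have "m \<le> m powr (3 / 2)"
  proof (cases "card (I r) = 0")
    case False
    then have "m powr 1 \<le> m powr (3 / 2)" by (intro powr_mono) (auto simp: m_def)
    then show ?thesis by (simp add: m_def)
  qed (simp add: m_def)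
  then have "m \<le> q / 2 * R r" using r(3) Rr by (simp add: m_def)
  moreover have "1 \<le> q / 2 * R r" using r(2) q by (simp add: field_simps)
  ultimately have mR: "m + 1 \<le> q * R r" by simp
  have m0: "0 \<le> m" by (simp add: m_def)
  define s where "s = r * (1 + M)"
  define \<rho> where "\<rho> = min (r * R r) c"
  show thesis
  proof
    show "finite (I r)" "I r \<subseteq> T" by fact+
    show "s > 0" using r(1) M(1) by (simp add: s_def)
    show "0 < \<rho>" "\<rho> \<le> c" using r(1) Rr c by (auto simp: \<rho>_def)
    have "(m + 1) * s \<le> \<eta> * \<rho>"
    proof -
      have q': "q * (1 + M) * (1 + M / c) = \<eta>"
        unfolding mult.assoc using pos by (metis q_def less_irrefl nonzero_eq_divide_eq)
      have 1: "(m + 1) * s \<le> q * R r * s" using mR \<open>s > 0\<close> by (intro mult_right_mono) auto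
      have "1 \<le> 1 + M / c" "M / c \<le> 1 + M / c" using M(1) c by auto
      moreover have "0 \<le> q * (1 + M)" using q M(1) by simp
      ultimately have q1: "q * (1 + M) * 1 \<le> \<eta>" "q * (1 + M) * (M / c) \<le> \<eta>"
        unfolding q'[symmetric] by (blast intro: mult_left_mono)+
      have "q * R r * s = q * (1 + M) * 1 * (r * R r)" by (simp add: s_def)
      also have "\<dots> \<le> \<eta> * (r * R r)" using q1(1) r(1) Rr by (intro mult_right_mono) auto
      finally have 2: "q * R r * s \<le> \<eta> * (r * R r)" .
      have "q * R r * s = q * (1 + M) * (r * R r)" by (simp add: s_def)
      also have "\<dots> \<le> q * (1 + M) * M" using M q r(1) by (intro mult_left_mono) auto
      also have "\<dots> = q * (1 + M) * (M / c) * c" using c by simp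
      also have "\<dots> \<le> \<eta> * c" using q1(2) c by (intro mult_right_mono) auto
      finally show ?thesis using 1 2 by (auto simp: \<rho>_def min_def)
    qed
    then show "(real (card (I r)) + 1) * s / \<rho> \<le> \<eta>" using \<open>0 < \<rho>\<close> by (simp add: m_def pos_divide_le_eq)
    show "f (x - xbar) < s" if x: "x \<in> cball xbar \<rho>" "\<And>i. i \<in> I r \<Longrightarrow> x \<in> \<Omega> i" for x
    proof -
      have d: "norm (x - xbar) \<le> r * R r" using x(1) by (simp add: \<rho>_def dist_norm norm_minus_commute)
      then have "f (x - xbar) - r * norm (x - xbar) < r"
        by (intro Ir(3)) (use x(2) in \<open>auto simp: dist_norm norm_minus_commute\<close>)
      moreover have "r * norm (x - xbar) \<le> r * M" using d M(2)[of r] r(1) by (intro mult_left_mono) auto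
      ultimately show ?thesis by (simp add: s_def distrib_left)
    qed
  qed
qed

theorem theorem5p5:
  fixes T :: "'i set" and \<Omega> :: "'i \<Rightarrow> 'a::banach set" and xbar :: 'a
    and xstar :: "'a \<Rightarrow>\<^sub>L real" and R :: "real \<Rightarrow> real" and \<epsilon> :: real
  assumes "asplund TYPE('a)"
    and "xbar \<in> (\<Inter>i\<in>T. \<Omega> i)"
    and "system_closed_around T \<Omega> xbar"
    and "rate_function R"
    and "rated_normal R T \<Omega> xbar xstar"
    and "\<epsilon> > 0"
  shows "\<exists>(I :: 'i set) (x :: 'i \<Rightarrow> 'a) (xs :: 'i \<Rightarrow> ('a \<Rightarrow>\<^sub>L real)) (l :: real).
           finite I \<and> I \<subseteq> T \<and> l \<ge> 0 \<and>
           (\<forall>i\<in>I. xs i \<in> frechet_normal_cone (x i) (\<Omega> i) \<and> norm (x i - xbar) < \<epsilon>) \<and>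
           (\<exists>b \<in> cball 0 1. l *\<^sub>R xstar = (\<Sum>i\<in>I. xs i) + \<epsilon> *\<^sub>R b) \<and>
           l\<^sup>2 + l\<^sup>2 * (norm xstar)\<^sup>2 + (\<Sum>i\<in>I. (norm (xs i))\<^sup>2) = 1"
proof -
  obtain \<rho>0 where \<rho>0: "\<rho>0 > 0" "\<And>i. i \<in> T \<Longrightarrow> closed (\<Omega> i \<inter> cball xbar \<rho>0)"
    using assms(3) unfolding system_closed_around_def by blast
  \<comment> \<open>The final normalisation multiplies by \<open>\<mu> \<le> 4\<close>, as
    \<open>S\<close> is at least 1/16; so only a quarter of \<open>\<epsilon>\<close> may be used
    before it.\<close>
  define \<eta> where "\<eta> = min (1 / 2) (\<epsilon> / 4)"
  have \<eta>: "\<eta> > 0" "\<eta> \<le> 1 / 2" "4 * \<eta> \<le> \<epsilon>" using assms(6) by (auto simp: \<eta>_def)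
  have c: "min \<rho>0 \<epsilon> > 0" "\<eta> / 128 > 0" using \<rho>0 assms(6) \<eta> by auto
  obtain I s \<rho> where I: "finite I" "I \<subseteq> T" and s: "s > 0" and \<rho>: "0 < \<rho>" "\<rho> \<le> min \<rho>0 \<epsilon>"
    and small: "(real (card I) + 1) * s / \<rho> \<le> \<eta> / 128"
    and sep: "\<And>x. x \<in> cball xbar \<rho> \<Longrightarrow> (\<And>i. i \<in> I \<Longrightarrow> x \<in> \<Omega> i) \<Longrightarrow> xstar (x - xbar) < s"
    by (rule rated_normal_separation[OF assms(4,5) c(2,1)]) blast
  define m where "m = card I"
  obtain e where e: "bij_betw e {..<m} I" using ex_bij_betw_nat_finite[OF I(1)] by (auto simp: m_def atLeast0LessThan)
  have eI: "e k \<in> I" if "k < m" for k using e that by (auto simp: bij_betw_def)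
  obtain y and G :: "nat \<Rightarrow> 'a \<Rightarrow>\<^sub>L real" and l where
    y: "\<And>k. k < m \<Longrightarrow> y k \<in> \<Omega> (e k) \<and> norm (y k - xbar) \<le> \<rho> / 2"
    and G: "\<And>k r. k < m \<Longrightarrow> r > 0 \<Longrightarrow> \<exists>d>0. \<forall>u\<in>\<Omega> (e k). norm (u - y k) < d \<longrightarrow> G k (u - y k) \<le> r * norm (u - y k)"
    and l: "l \<ge> 0" "norm ((\<Sum>k<m. G k) - l *\<^sub>R xstar) \<le> \<eta>" "1 / 16 \<le> l\<^sup>2 + (\<Sum>k<m. (norm (G k))\<^sup>2)"
  proof (rule normals_from_separation[of m xbar "\<lambda>k. \<Omega> (e k)" \<rho> s xstar \<eta>])
    show "xbar \<in> \<Omega> (e k)" if "k < m" for k using assms(2) eI[OF that] I(2) by blast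
    show "closed (\<Omega> (e k) \<inter> cball xbar \<rho>)" if "k < m" for k
    proof -
      have "\<Omega> (e k) \<inter> cball xbar \<rho> = (\<Omega> (e k) \<inter> cball xbar \<rho>0) \<inter> cball xbar \<rho>" using \<rho>(2) by auto
      then show ?thesis using \<rho>0(2)[of "e k"] eI[OF that] I(2) by (metis closed_Int closed_cball subsetD)
    qed
    show "xstar (x - xbar) < s" if "x \<in> cball xbar \<rho>" "\<And>k. k < m \<Longrightarrow> x \<in> \<Omega> (e k)" for x
      using that e by (intro sep) (auto simp: bij_betw_def)
    show "128 * (real m + 1) * s / \<rho> \<le> \<eta>" using mult_left_mono[OF small, of 128] by (simp only: m_def) (simp add: mult_ac)
  qed (use assms(1) s \<rho> \<eta> in blast)+
  define S where "S = l\<^sup>2 + l\<^sup>2 * (norm xstar)\<^sup>2 + (\<Sum>k<m. (norm (G k))\<^sup>2)"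
  have S: "1 / 16 \<le> S" using add_increasing2[of "l\<^sup>2 * (norm xstar)\<^sup>2", OF _ l(3)] unfolding S_def by (simp add: add_ac)
  define \<mu> where "\<mu> = 1 / sqrt S"
  have "sqrt (1 / 16) \<le> sqrt S" using S by (rule real_sqrt_le_mono)
  then have sq: "1 / 4 \<le> sqrt S" by (simp add: real_sqrt_divide)
  have \<mu>: "0 < \<mu>" "\<mu> \<le> 4" "\<mu>\<^sup>2 * S = 1" using sq S by (auto simp: \<mu>_def field_simps)
  \<comment> \<open>The inverse enumeration carries the results for \<open>{..<m}\<close> back to
    the index set \<open>I\<close>.\<close>
  define k where "k = the_inv_into {..<m} e"
  have k: "k (e j) = j" if "j < m" for j using e that by (simp add: k_def the_inv_into_f_f bij_betw_def)
  have kI: "k i < m" "e (k i) = i" if "i \<in> I" for i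
    using bij_betw_the_inv_into[OF e] f_the_inv_into_f_bij_betw[OF e] that by (auto simp: k_def bij_betw_def)
  define xs where "xs i = \<mu> *\<^sub>R G (k i)" for i
  define b where "b = (1 / \<epsilon>) *\<^sub>R (\<mu> *\<^sub>R (l *\<^sub>R xstar - (\<Sum>j<m. G j)))"
  have sum_xs: "(\<Sum>i\<in>I. xs i) = \<mu> *\<^sub>R (\<Sum>j<m. G j)"
    using sum.reindex_bij_betw[OF e, of xs] k by (simp add: xs_def scaleR_sum_right)
  have sum_norm: "(\<Sum>i\<in>I. (norm (xs i))\<^sup>2) = \<mu>\<^sup>2 * (\<Sum>j<m. (norm (G j))\<^sup>2)"
    using sum.reindex_bij_betw[OF e, of "\<lambda>i. (norm (xs i))\<^sup>2"] k
    by (simp add: xs_def power_mult_distrib sum_distrib_left)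
  have "norm b \<le> 1"
  proof -
    have "norm b = \<mu> * norm ((\<Sum>j<m. G j) - l *\<^sub>R xstar) / \<epsilon>" using \<mu> assms(6) by (simp add: b_def norm_minus_commute)
    also have "\<dots> \<le> 4 * \<eta> / \<epsilon>" using \<mu> l(2) assms(6) by (intro divide_right_mono mult_mono) auto
    also have "\<dots> \<le> 1" using \<eta>(3) assms(6) by simp
    finally show ?thesis .
  qed
  moreover have "(\<mu> * l) *\<^sub>R xstar = (\<Sum>i\<in>I. xs i) + \<epsilon> *\<^sub>R b"
    unfolding sum_xs b_def using assms(6) by (simp add: scaleR_diff_right)
  moreover have "(\<mu> * l)\<^sup>2 + (\<mu> * l)\<^sup>2 * (norm xstar)\<^sup>2 + (\<Sum>i\<in>I. (norm (xs i))\<^sup>2) = 1"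
    unfolding sum_norm \<mu>(3)[symmetric] S_def by (simp add: power_mult_distrib algebra_simps)
  moreover have "xs i \<in> frechet_normal_cone (y (k i)) (\<Omega> i) \<and> norm (y (k i) - xbar) < \<epsilon>" if i: "i \<in> I" for i
  proof
    show "xs i \<in> frechet_normal_cone (y (k i)) (\<Omega> i)"
    proof (rule frechet_normal_coneI)
      show "y (k i) \<in> \<Omega> i" using y[OF kI(1)[OF i]] kI(2)[OF i] by simp
      fix r :: real assume "r > 0"
      then obtain d where d: "d > 0" "\<And>u. u \<in> \<Omega> i \<Longrightarrow> norm (u - y (k i)) < d \<Longrightarrow> G (k i) (u - y (k i)) \<le> r / \<mu> * norm (u - y (k i))"
        using G[OF kI(1)[OF i], of "r / \<mu>"] \<mu>(1) kI(2)[OF i] by auto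
      have "xs i (u - y (k i)) \<le> r * norm (u - y (k i))" if "u \<in> \<Omega> i" "norm (u - y (k i)) < d" for u
        using d(2)[OF that] \<mu>(1) by (simp add: xs_def blinfun.scaleR_left field_simps)
      then show "\<exists>d>0. \<forall>u\<in>\<Omega> i. norm (u - y (k i)) < d \<longrightarrow> xs i (u - y (k i)) \<le> r * norm (u - y (k i))" using d(1) by blast
    qed
    show "norm (y (k i) - xbar) < \<epsilon>" using y[OF kI(1)[OF i]] \<rho> by auto
  qed
  ultimately show ?thesis
    using I l(1) \<mu>(1) by (intro exI[of _ I] exI[of _ "\<lambda>i. y (k i)"] exI[of _ xs] exI[of _ "\<mu> * l"]) auto
qed

end
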